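(* Suppose the following hold. (i) There are constants $a_0,b_0>0$, $0<\gamma_0<\frac12$ and $0<p=p(n)<1$ such that $$a_0np\le \sum_{v\in\mathcal S,\,v\ne u}p(u,v)\le\sum_{v\neq u}p(u,v)\le b_0np$$ for all vertices $u$ and all sets $\mathcal S\subseteq\{1,\dots,n\}$ containing at least $\gamma_0n$ vertices. (ii) The edge weight ccdf $F_c(x)$ is continuous for all large $x$, and $$\delta_{low}\le(\mathbb E r(X_1,X_2))^2\le\mathbb E r^2(X_1,X_2)\le\delta_{up}$$ for some constants $\delta_{low},\delta_{up}>0$. (a) There are constants $C_0,x_0>0$ and $s>3$ such that $F_c(ax)\le\frac{C_0}{a^s}F_c(x)$ for all $a>1$ and all $x>x_0$. (b) There are constants $c_1,c_2>0$ such that the edge cost ccdf $F_c^{(ct)}$ satisfies $F_c(x)\ge c_1F_c^{(ct)}(c_2x)$ for all $x>0$. Then there is a constant $\theta>0$ such that if $p\ge\frac{\theta\log n}{n}$, then $$\mathbb P\left(\chi_n\le\theta nH_c(np)\right)\ge1-\theta^{-1}p,$$ $$\mathbb E\chi_n\le\theta nH_c(np)\quad\text{and}\quad \mathrm{var}(\chi_n)\le\theta n^2pH_c^2(np).$$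
   Context: For each integer $n\ge2$ let $K_n$ be the complete graph on $\{1,\dots,n\}$; edges $h=(u,v)$ are undirected. Let $\{Z(h)\}_{h\in K_n}$ be independent Bernoulli random variables with $\mathbb P(Z(h)=1)=p(h)=1-\mathbb P(Z(h)=0)$, $0<p(h)<1$; write $p(h)=p(u,v)=p(v,u)$. The random graph $G$ has vertex set $\{1,\dots,n\}$ and edge set $\{h:Z(h)=1\}$. Each edge $h$ has a positive random weight $W(h)=W(u,v)$, the weights being i.i.d.; each vertex $u$ has a random mark $X_u$, the marks $X_1,\dots,X_n$ being i.i.d. with values in a (measurable) set $\Omega_{mk}$. The families $\{Z(h)\}$, $\{W(h)\}$, $\{X_u\}$ are mutually independent. For a deterministic symmetric measurable function $r:\Omega_{mk}\times\Omega_{mk}\to(0,\infty)$, the cost of $h=(u,v)$ is $c(h)=c(u,v)=r(X_u,X_v)\,W(u,v)$. The edge weight ccdf is $F_c(x)=\mathbb P(W(h)>x)$ and the edge cost ccdf is $F_c^{(ct)}(x)=\mathbb P(c(h)>x)$, $x>0$. The inverse edge weight ccdf is $H_c(y)=\sup\{x>0:F_c(x)\ge 1/y\}$ for $y>1$. The cost of a tree is the sum of the costs of its edges. $\chi_n$ is the maximum cost of a spanning tree of the largest component of $G$ (ties between largest components broken by any fixed rule). The edge probabilities, the law of the marks and $r$ may depend on $n$; the law of the weights does not. "Constants" do not depend on $n$. *)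

theory Defs
  imports "HOL-Probability.Probability"
begin

section \<open>Finite simple graphs\<close>

text \<open>
  Undirected edges are two-element sets of vertices.  A graph is a vertex set together with a
  set of such edges.
\<close>

definition complete_edges :: "nat \<Rightarrow> nat set set" where
  "complete_edges n = {{u, v} | u v. u \<in> {1..n} \<and> v \<in> {1..n} \<and> u \<noteq> v}"

definition adjacency :: "'v set set \<Rightarrow> ('v \<times> 'v) set" where
  "adjacency E = {(u, v). {u, v} \<in> E}"

definition graph_components :: "'v set \<Rightarrow> 'v set set \<Rightarrow> 'v set set" where
  "graph_components V E = {{v \<in> V. (u, v) \<in> (adjacency E)\<^sup>*} | u. u \<in> V}"

definition largest_component :: "'v set \<Rightarrow> 'v set set \<Rightarrow> 'v set \<Rightarrow> bool" where
  "largest_component V E C \<longleftrightarrow>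
     C \<in> graph_components V E \<and> (\<forall>D \<in> graph_components V E. card D \<le> card C)"

definition graph_connected :: "'v set \<Rightarrow> 'v set set \<Rightarrow> bool" where
  "graph_connected V E \<longleftrightarrow> V \<noteq> {} \<and> (\<forall>u \<in> V. \<forall>v \<in> V. (u, v) \<in> (adjacency E)\<^sup>*)"

definition graph_cycle :: "'v set set \<Rightarrow> 'v list \<Rightarrow> bool" where
  "graph_cycle E vs \<longleftrightarrow> length vs \<ge> 3 \<and> distinct vs \<and>
     (\<forall>i < length vs. {vs ! i, vs ! (Suc i mod length vs)} \<in> E)"

text \<open>
  Spanning trees of the subgraph induced by \<open>E\<close> on \<open>C\<close>; a tree is identified with its edge set.
\<close>

definition spanning_trees :: "'v set \<Rightarrow> 'v set set \<Rightarrow> 'v set set set" where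
  "spanning_trees C E =
     {T. T \<subseteq> {h \<in> E. h \<subseteq> C} \<and> graph_connected C T \<and> (\<nexists>vs. graph_cycle T vs)}"

section \<open>Complementary distribution functions\<close>

definition ccdf :: "real measure \<Rightarrow> real \<Rightarrow> real" where
  "ccdf D x = measure D {x<..}"

text \<open>
  Meaningful for \<open>y > 1\<close>: if \<open>F\<close> is the ccdf of a law on the positive reals, the set is then
  nonempty and bounded above.
\<close>

definition inv_ccdf :: "(real \<Rightarrow> real) \<Rightarrow> real \<Rightarrow> real" where
  "inv_ccdf F y = Sup {x. x > 0 \<and> F x \<ge> 1 / y}"

section \<open>The weighted random graph\<close>

datatype source = Edge_states | Weights | Marks

text \<open>
  The locale fixes the number \<open>n\<close> of vertices; \<open>q\<close> gives the edge probabilities, \<open>Z\<close> the edge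
  states (\<open>True\<close> meaning that the edge is present), \<open>W\<close> the weights with common law \<open>D\<close>, and
  \<open>X\<close> the marks with values in \<open>space mk\<close>.  Of \<open>mk\<close> only the underlying measurable space
  is used.
\<close>

locale weighted_random_graph = prob_space M for M :: "'a measure" +
  fixes n :: nat
    and q :: "nat set \<Rightarrow> real"
    and Z :: "nat set \<Rightarrow> 'a \<Rightarrow> bool"
    and W :: "nat set \<Rightarrow> 'a \<Rightarrow> real"
    and D :: "real measure"
    and mk :: "'m measure"
    and X :: "nat \<Rightarrow> 'a \<Rightarrow> 'm"
    and r :: "'m \<Rightarrow> 'm \<Rightarrow> real"
  assumes edge_prob: "\<And>h. h \<in> complete_edges n \<Longrightarrow> 0 < q h \<and> q h < 1"
    and Z_bernoulli: "\<And>h. h \<in> complete_edges n \<Longrightarrow> \<P>(\<omega> in M. Z h \<omega>) = q h"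
    and Z_indep: "indep_vars (\<lambda>_. count_space UNIV) Z (complete_edges n)"
    and W_pos: "\<And>h \<omega>. h \<in> complete_edges n \<Longrightarrow> \<omega> \<in> space M \<Longrightarrow> 0 < W h \<omega>"
    and W_law: "\<And>h. h \<in> complete_edges n \<Longrightarrow> distr M borel (W h) = D"
    and W_indep: "indep_vars (\<lambda>_. borel) W (complete_edges n)"
    and X_ident: "\<And>u v. u \<in> {1..n} \<Longrightarrow> v \<in> {1..n} \<Longrightarrow> distr M mk (X u) = distr M mk (X v)"
    and X_indep: "indep_vars (\<lambda>_. mk) X {1..n}"
    and families_indep: "indep_sets
      (\<lambda>s. case s of
         Edge_states \<Rightarrow> sets (vimage_algebra (space M) (\<lambda>\<omega>. \<lambda>h\<in>complete_edges n. Z h \<omega>)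
                          (Pi\<^sub>M (complete_edges n) (\<lambda>_. count_space UNIV)))
       | Weights \<Rightarrow> sets (vimage_algebra (space M) (\<lambda>\<omega>. \<lambda>h\<in>complete_edges n. W h \<omega>)
                          (Pi\<^sub>M (complete_edges n) (\<lambda>_. borel)))
       | Marks \<Rightarrow> sets (vimage_algebra (space M) (\<lambda>\<omega>. \<lambda>u\<in>{1..n}. X u \<omega>)
                          (Pi\<^sub>M {1..n} (\<lambda>_. mk)))) UNIV"
    and r_measurable: "(\<lambda>(x, y). r x y) \<in> borel_measurable (mk \<Otimes>\<^sub>M mk)"
    and r_sym: "\<And>x y. x \<in> space mk \<Longrightarrow> y \<in> space mk \<Longrightarrow> r x y = r y x"
    and r_pos: "\<And>x y. x \<in> space mk \<Longrightarrow> y \<in> space mk \<Longrightarrow> 0 < r x y"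

definition random_edges :: "nat \<Rightarrow> (nat set \<Rightarrow> 'a \<Rightarrow> bool) \<Rightarrow> 'a \<Rightarrow> nat set set" where
  "random_edges n Z \<omega> = {h \<in> complete_edges n. Z h \<omega>}"

text \<open>
  For \<open>h = {u, v}\<close> the endpoints are recovered as \<open>Min h\<close> and \<open>Max h\<close>; their order is
  immaterial because \<open>r\<close> is symmetric.
\<close>

definition edge_cost ::
  "('m \<Rightarrow> 'm \<Rightarrow> real) \<Rightarrow> (nat \<Rightarrow> 'a \<Rightarrow> 'm) \<Rightarrow> (nat set \<Rightarrow> 'a \<Rightarrow> real) \<Rightarrow> nat set \<Rightarrow> 'a \<Rightarrow> real" where
  "edge_cost r X W h \<omega> = r (X (Min h) \<omega>) (X (Max h) \<omega>) * W h \<omega>"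

text \<open>
  \<open>sel\<close> is the rule that selects, from the edge set of a graph on \<open>{1..n}\<close>, one of its largest
  components.
\<close>

definition max_tree_cost ::
  "nat \<Rightarrow> (nat set set \<Rightarrow> nat set) \<Rightarrow> (nat set \<Rightarrow> 'a \<Rightarrow> bool) \<Rightarrow> (nat set \<Rightarrow> 'a \<Rightarrow> real) \<Rightarrow> 'a \<Rightarrow> real"
where
  "max_tree_cost n sel Z c \<omega> =
     Max ((\<lambda>T. \<Sum>h\<in>T. c h \<omega>) `
       spanning_trees (sel (random_edges n Z \<omega>)) (random_edges n Z \<omega>))"

end

theory Submission
  imports Defs
begin

text \<open>
  Let \<open>f\<close> be the maximum cost of a forest in the random graph.  It dominates the cost \<open>\<chi>\<close> of the
  maximum spanning tree, with equality when the graph is connected, which fails with probability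
  \<open>O(n\<^sup>-\<^sup>4)\<close> since \<open>np\<close> exceeds a large multiple of \<open>log n\<close>.  A forest has at most \<open>n\<close> edges, so
  truncating costs at \<open>L = const * H(np)\<close> gives \<open>f \<le> nL + \<Sum> Z(h) c(h) 1[c(h) > L]\<close>, and the tail
  condition gives \<open>E (c(h)\<^sup>2 1[c(h) > L]) = O(L\<^sup>2 / (np))\<close>.

  For the variance, apply the Efron-Stein inequality to the independent edge states, weights and
  marks.  Setting the costs of the edges at \<open>u\<close> to zero removes the dependence on the mark of \<open>u\<close> and
  lowers \<open>f\<close> by at most the cost of these edges in an optimal forest \<open>T\<close>.  Up to the excess terms this
  sums to \<open>L\<^sup>2 \<Sum> deg\<^sub>T(u)\<^sup>2\<close>, which is of order \<open>L\<^sup>2 n\<^sup>2 p\<close> because graph degrees are of order \<open>np\<close>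
  and the degrees in \<open>T\<close> sum to at most \<open>2n\<close>.  The bound in probability is Chebyshev's inequality.
\<close>

section \<open>The Efron-Stein inequality\<close>

text \<open>Deleting an edge can change which component is largest, so the tree cost is not monotone
  in the edge states. The forest cost is monotone in the edge values, so the Efron-Stein argument is
  carried out for it alone and transferred to the tree cost at the end. Costs of edges with a common
  vertex are dependent through its mark. Marks are therefore coordinates of their own, and zeroing a
  whole star of edges avoids comparing costs under two values of one mark. The independence of the
  states from all costs is used twice: presence probabilities factor out of moments of large costs,
  and the probability of disconnection factors out of a crude second moment. The condition s > 3
  enters the moment bounds through 2^s \<ge> 8, which makes the dyadic sum of truncated squares
  converge. Since p < 1, the assumption on p forces n > \<theta> log 2, so a large \<theta> excludes
  the finitely many n for which (i) may fail. The failure probability of order p in the first claim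
  is the quotient in Chebyshev's inequality: a variance of order n^2 p H(np)^2 against a squared
  deviation of order n^2 H(np)^2.\<close>

lemma (in pair_prob_space) section_mean_square:
  fixes g :: "'a \<times> 'b \<Rightarrow> real"
  assumes g[measurable]: "g \<in> borel_measurable (M1 \<Otimes>\<^sub>M M2)"
    and g2: "integrable (M1 \<Otimes>\<^sub>M M2) (\<lambda>z. (g z)\<^sup>2)"
  shows "AE y in M2. integrable M1 (\<lambda>x. g (x, y)) \<and> integrable M1 (\<lambda>x. (g (x, y))\<^sup>2)"
    and "integrable M2 (\<lambda>y. (\<integral>x. g (x, y) \<partial>M1)\<^sup>2)"
    and "(\<integral>y. (\<integral>x. g (x, y) \<partial>M1)\<^sup>2 \<partial>M2) \<le> (\<integral>z. (g z)\<^sup>2 \<partial>(M1 \<Otimes>\<^sub>M M2))"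
proof -
  have g1: "integrable (M1 \<Otimes>\<^sub>M M2) g"
    by (rule square_integrable_imp_integrable[OF g g2])
  have a: "AE y in M2. integrable M1 (\<lambda>x. g (x, y))"
    using AE_integrable_snd[of "\<lambda>x y. g (x, y)"] g1 by simp
  have b: "AE y in M2. integrable M1 (\<lambda>x. (g (x, y))\<^sup>2)"
    using AE_integrable_snd[of "\<lambda>x y. (g (x, y))\<^sup>2"] g2 by (simp add: case_prod_beta')
  show ab: "AE y in M2. integrable M1 (\<lambda>x. g (x, y)) \<and> integrable M1 (\<lambda>x. (g (x, y))\<^sup>2)"
    using a b by auto
  have le: "AE y in M2. (\<integral>x. g (x, y) \<partial>M1)\<^sup>2 \<le> (\<integral>x. (g (x, y))\<^sup>2 \<partial>M1)"
    using ab
  proof eventually_elim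
    case (elim y)
    \<comment> \<open>Jensen's inequality for the square, read off from the nonnegativity of the
      variance of a section.\<close>
    then have "0 \<le> (\<integral>x. (g (x, y) - (\<integral>x. g (x, y) \<partial>M1))\<^sup>2 \<partial>M1)"
      by (intro integral_nonneg_AE) auto
    also have "\<dots> = (\<integral>x. (g (x, y))\<^sup>2 \<partial>M1) - (\<integral>x. g (x, y) \<partial>M1)\<^sup>2"
      using elim by (simp add: M1.variance_eq)
    finally show ?case by simp
  qed
  have i: "integrable M2 (\<lambda>y. \<integral>x. (g (x, y))\<^sup>2 \<partial>M1)"
    using integrable_snd[of "\<lambda>x y. (g (x, y))\<^sup>2"] g2 by (simp add: case_prod_beta')
  have e: "(\<integral>y. (\<integral>x. (g (x, y))\<^sup>2 \<partial>M1) \<partial>M2) = (\<integral>z. (g z)\<^sup>2 \<partial>(M1 \<Otimes>\<^sub>M M2))"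
    using integral_snd[of "\<lambda>x y. (g (x, y))\<^sup>2"] g2 by (simp add: case_prod_beta')
  show int: "integrable M2 (\<lambda>y. (\<integral>x. g (x, y) \<partial>M1)\<^sup>2)"
  proof (rule Bochner_Integration.integrable_bound[OF i])
    show "AE y in M2. norm ((\<integral>x. g (x, y) \<partial>M1)\<^sup>2) \<le> norm (\<integral>x. (g (x, y))\<^sup>2 \<partial>M1)"
      using le by eventually_elim auto
  qed measurable
  show "(\<integral>y. (\<integral>x. g (x, y) \<partial>M1)\<^sup>2 \<partial>M2) \<le> (\<integral>z. (g z)\<^sup>2 \<partial>(M1 \<Otimes>\<^sub>M M2))"
    unfolding e[symmetric] by (rule integral_mono_AE[OF int i le])
qed

text \<open>On a section, \<open>h\<close> is a constant, and the section mean of \<open>g\<close>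
  is the constant closest to \<open>g\<close> in mean square. In the decomposition of the variance
  into the mean of the section variances and the variance of the section means, the former can
  therefore only grow when the mean is replaced by \<open>h\<close>.\<close>

lemma (in pair_prob_space) variance_section_mean:
  fixes g h :: "'a \<times> 'b \<Rightarrow> real"
  assumes g[measurable]: "g \<in> borel_measurable (M1 \<Otimes>\<^sub>M M2)"
    and g2: "integrable (M1 \<Otimes>\<^sub>M M2) (\<lambda>z. (g z)\<^sup>2)"
    and h[measurable]: "h \<in> borel_measurable (M1 \<Otimes>\<^sub>M M2)"
    and h2: "integrable (M1 \<Otimes>\<^sub>M M2) (\<lambda>z. (h z)\<^sup>2)"
    and const: "\<And>x x' y. x \<in> space M1 \<Longrightarrow> x' \<in> space M1 \<Longrightarrow> y \<in> space M2 \<Longrightarrow> h (x, y) = h (x', y)"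
  shows "P.variance g \<le> (\<integral>z. (g z - h z)\<^sup>2 \<partial>(M1 \<Otimes>\<^sub>M M2)) + M2.variance (\<lambda>y. \<integral>x. g (x, y) \<partial>M1)"
proof -
  define E where "E = P.expectation g"
  define m where "m y = (\<integral>x. g (x, y) \<partial>M1)" for y
  have g1: "integrable (M1 \<Otimes>\<^sub>M M2) g"
    by (rule square_integrable_imp_integrable[OF g g2])
  have h1: "integrable (M1 \<Otimes>\<^sub>M M2) h"
    by (rule square_integrable_imp_integrable[OF h h2])
  have gh: "integrable (M1 \<Otimes>\<^sub>M M2) (\<lambda>z. g z * h z)"
  proof (rule Bochner_Integration.integrable_bound)
    show "integrable (M1 \<Otimes>\<^sub>M M2) (\<lambda>z. (g z)\<^sup>2 + (h z)\<^sup>2)"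
      using g2 h2 by simp
    have "\<bar>a * b\<bar> \<le> a\<^sup>2 + b\<^sup>2" for a b :: real
    proof -
      have "2 * \<bar>a * b\<bar> \<le> a\<^sup>2 + b\<^sup>2"
        using sum_squares_bound[of "\<bar>a\<bar>" "\<bar>b\<bar>"] by (simp add: abs_mult mult.assoc)
      then show ?thesis using abs_ge_zero[of "a * b"] by linarith
    qed
    then show "AE z in M1 \<Otimes>\<^sub>M M2. norm (g z * h z) \<le> norm ((g z)\<^sup>2 + (h z)\<^sup>2)"
      by (auto intro!: AE_I2)
  qed simp
  have Em: "E = M2.expectation m"
    unfolding E_def m_def using integral_snd[of "\<lambda>x y. g (x, y)"] g1 by simp
  have i1: "integrable (M1 \<Otimes>\<^sub>M M2) (\<lambda>z. (g z - E)\<^sup>2)"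
    using g1 g2 by (simp add: power2_diff)
  have i2: "integrable (M1 \<Otimes>\<^sub>M M2) (\<lambda>z. (g z - h z)\<^sup>2)"
    using g2 h2 gh by (simp add: power2_diff mult.assoc)
  have m2: "integrable M2 (\<lambda>y. (m y)\<^sup>2)"
    unfolding m_def by (rule section_mean_square(2)[OF g g2])
  have mm: "m \<in> borel_measurable M2" unfolding m_def by measurable
  have m1: "integrable M2 m"
    by (rule M2.square_integrable_imp_integrable[OF mm m2])
  have i3: "integrable M2 (\<lambda>y. (m y - E)\<^sup>2)"
    using m1 m2 by (simp add: power2_diff)
  note fub1 = integral_snd[of "\<lambda>x y. (g (x, y) - E)\<^sup>2"] integrable_snd[of "\<lambda>x y. (g (x, y) - E)\<^sup>2"]
  note fub2 = integral_snd[of "\<lambda>x y. (g (x, y) - h (x, y))\<^sup>2"] integrable_snd[of "\<lambda>x y. (g (x, y) - h (x, y))\<^sup>2"]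
  have "P.variance g = (\<integral>y. (\<integral>x. (g (x, y) - E)\<^sup>2 \<partial>M1) \<partial>M2)"
    using fub1 i1 by (simp add: case_prod_beta' E_def)
  also have "\<dots> \<le> (\<integral>y. (\<integral>x. (g (x, y) - h (x, y))\<^sup>2 \<partial>M1) + (m y - E)\<^sup>2 \<partial>M2)"
  proof (rule integral_mono_AE)
    show "integrable M2 (\<lambda>y. \<integral>x. (g (x, y) - E)\<^sup>2 \<partial>M1)"
      using fub1 i1 by (simp add: case_prod_beta')
    show "integrable M2 (\<lambda>y. (\<integral>x. (g (x, y) - h (x, y))\<^sup>2 \<partial>M1) + (m y - E)\<^sup>2)"
      using fub2 i2 i3 by (simp add: case_prod_beta')
    show "AE y in M2. (\<integral>x. (g (x, y) - E)\<^sup>2 \<partial>M1) \<le> (\<integral>x. (g (x, y) - h (x, y))\<^sup>2 \<partial>M1) + (m y - E)\<^sup>2"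
      using section_mean_square(1)[OF g g2] AE_space
    proof eventually_elim
      case (elim y)
      obtain x0 where x0: "x0 \<in> space M1" using M1.not_empty by auto
      define b where "b = h (x0, y)"
      have hb: "h (x, y) = b" if "x \<in> space M1" for x
        unfolding b_def using const x0 that elim by blast
      have "(\<integral>x. (g (x, y) - h (x, y))\<^sup>2 \<partial>M1) = (\<integral>x. (g (x, y) - b)\<^sup>2 \<partial>M1)"
        by (rule Bochner_Integration.integral_cong) (auto simp: hb)
      also have "\<dots> = (\<integral>x. (g (x, y))\<^sup>2 \<partial>M1) + b\<^sup>2 - 2 * m y * b"
        using elim by (simp add: power2_diff M1.prob_space m_def)
      moreover have "(\<integral>x. (g (x, y) - E)\<^sup>2 \<partial>M1) = (\<integral>x. (g (x, y))\<^sup>2 \<partial>M1) + E\<^sup>2 - 2 * m y * E"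
        using elim by (simp add: power2_diff M1.prob_space m_def)
      \<comment> \<open>This square is exactly the gap between the two sides.\<close>
      moreover have "0 \<le> (m y - b)\<^sup>2" by simp
      ultimately show ?case by (simp add: power2_diff)
    qed
  qed
  also have "\<dots> = (\<integral>z. (g z - h z)\<^sup>2 \<partial>(M1 \<Otimes>\<^sub>M M2)) + (\<integral>y. (m y - E)\<^sup>2 \<partial>M2)"
    using fub2 i2 i3 by (simp add: case_prod_beta')
  finally show ?thesis unfolding Em unfolding m_def .
qed

text \<open>
  Integrating out one coordinate \<open>k\<close> splits the variance into a part bounded by the influence of
  \<open>k\<close> and the variance of the section mean; by Jensen's inequality the mean of \<open>h i\<close> is a valid
  competitor for the latter.
\<close>

lemma efron_stein_PiM:
  fixes g :: "('i \<Rightarrow> 'b) \<Rightarrow> real" and h :: "'i \<Rightarrow> ('i \<Rightarrow> 'b) \<Rightarrow> real"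
  assumes "finite I" and "\<And>i. i \<in> I \<Longrightarrow> prob_space (N i)"
    and "g \<in> borel_measurable (Pi\<^sub>M I N)" and "integrable (Pi\<^sub>M I N) (\<lambda>x. (g x)\<^sup>2)"
    and "\<And>i. i \<in> I \<Longrightarrow> h i \<in> borel_measurable (Pi\<^sub>M I N)"
    and "\<And>i. i \<in> I \<Longrightarrow> integrable (Pi\<^sub>M I N) (\<lambda>x. (h i x)\<^sup>2)"
    and "\<And>i x y. i \<in> I \<Longrightarrow> x \<in> space (Pi\<^sub>M I N) \<Longrightarrow> y \<in> space (N i) \<Longrightarrow> h i (x(i := y)) = h i x"
  shows "prob_space.variance (Pi\<^sub>M I N) g \<le> (\<Sum>i\<in>I. \<integral>x. (g x - h i x)\<^sup>2 \<partial>Pi\<^sub>M I N)"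
  using assms
proof (induction I arbitrary: g h rule: finite_induct)
  case empty
  have "space (Pi\<^sub>M {} N) = {\<lambda>_. undefined}" by (simp add: space_PiM)
  then have "(\<integral>x. f x \<partial>Pi\<^sub>M {} N) = f (\<lambda>_. undefined)" for f :: "('i \<Rightarrow> 'b) \<Rightarrow> real"
    by (simp add: PiM_empty lebesgue_integral_count_space_finite)
  then show ?case by simp
next
  case (insert k I)
  let ?K = "insert k I" and ?u = "\<lambda>(y, x). x(k := y)"
  let ?P = "N k \<Otimes>\<^sub>M Pi\<^sub>M I N"
  interpret Nk: prob_space "N k" using insert.prems by simp
  interpret PI: prob_space "Pi\<^sub>M I N" using insert.prems by (intro prob_space_PiM) simp
  interpret PK: prob_space "Pi\<^sub>M ?K N" using insert.prems by (intro prob_space_PiM) simp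
  interpret pair_prob_space "N k" "Pi\<^sub>M I N" ..
  have law: "Pi\<^sub>M ?K N = distr ?P (Pi\<^sub>M ?K N) ?u"
    using insert.prems by (intro distr_pair_PiM_eq_PiM[symmetric]) auto
  have u[measurable]: "?u \<in> measurable ?P (Pi\<^sub>M ?K N)" by measurable
  have E: "(\<integral>x. f x \<partial>Pi\<^sub>M ?K N) = (\<integral>z. f (?u z) \<partial>?P)" if "f \<in> borel_measurable (Pi\<^sub>M ?K N)" for f :: "_ \<Rightarrow> real"
    by (subst law) (rule integral_distr[OF u that])
  have int: "integrable (Pi\<^sub>M ?K N) f \<longleftrightarrow> integrable ?P (\<lambda>z. f (?u z))" if "f \<in> borel_measurable (Pi\<^sub>M ?K N)" for f :: "_ \<Rightarrow> real"
    by (subst law) (rule integrable_distr_eq[OF u that])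
  have g[measurable]: "g \<in> borel_measurable (Pi\<^sub>M ?K N)" by (rule insert.prems)
  have h[measurable]: "h i \<in> borel_measurable (Pi\<^sub>M ?K N)" if "i \<in> ?K" for i
    using insert.prems that by blast
  define G where "G z = g (?u z)" for z
  define Hh where "Hh i z = h i (?u z)" for i z
  have G[measurable]: "G \<in> borel_measurable ?P" unfolding G_def by measurable
  have H[measurable]: "Hh i \<in> borel_measurable ?P" if "i \<in> ?K" for i
    unfolding Hh_def using h[OF that] by measurable
  have G2: "integrable ?P (\<lambda>z. (G z)\<^sup>2)"
    unfolding G_def using insert.prems by (subst int[symmetric]) auto
  have H2: "integrable ?P (\<lambda>z. (Hh i z)\<^sup>2)" if "i \<in> ?K" for i
    unfolding Hh_def using insert.prems that by (subst int[symmetric, of "\<lambda>x. (h i x)\<^sup>2"]) auto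
  define m where "m x = (\<integral>y. G (y, x) \<partial>N k)" for x
  define mh where "mh i x = (\<integral>y. Hh i (y, x) \<partial>N k)" for i x
  have sp: "?u (y, x) \<in> space (Pi\<^sub>M ?K N)" if "y \<in> space (N k)" "x \<in> space (Pi\<^sub>M I N)" for x y
    using measurable_space[OF u, of "(y, x)"] that by (simp add: space_pair_measure)
  have step: "P.variance G \<le> (\<integral>z. (G z - Hh k z)\<^sup>2 \<partial>?P) + PI.variance m"
    unfolding m_def
  proof (rule variance_section_mean[OF G G2 H H2])
    fix y y' x assume *: "y \<in> space (N k)" "y' \<in> space (N k)" "x \<in> space (Pi\<^sub>M I N)"
    have "x(k := y) \<in> space (Pi\<^sub>M ?K N)" using sp[of y x] * by simp
    from insert.prems(6)[OF insertI1 this *(2)]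
    have "h k ((x(k := y))(k := y')) = h k (x(k := y))" .
    then show "Hh k (y, x) = Hh k (y', x)" by (simp add: Hh_def)
  qed simp_all
  have IH: "PI.variance m \<le> (\<Sum>i\<in>I. \<integral>x. (m x - mh i x)\<^sup>2 \<partial>Pi\<^sub>M I N)"
  proof (rule insert.IH)
    show "m \<in> borel_measurable (Pi\<^sub>M I N)" unfolding m_def by measurable
    show "integrable (Pi\<^sub>M I N) (\<lambda>x. (m x)\<^sup>2)"
      unfolding m_def by (rule section_mean_square(2)[OF G G2])
    fix i assume i: "i \<in> I"
    have [measurable]: "Hh i \<in> borel_measurable ?P" using H i by simp
    show "mh i \<in> borel_measurable (Pi\<^sub>M I N)" unfolding mh_def by measurable
    show "integrable (Pi\<^sub>M I N) (\<lambda>x. (mh i x)\<^sup>2)"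
      unfolding mh_def using i by (intro section_mean_square(2) H H2) auto
    fix x y assume x: "x \<in> space (Pi\<^sub>M I N)" "y \<in> space (N i)"
    have ik: "i \<noteq> k" using i insert.hyps by auto
    show "mh i (x(i := y)) = mh i x"
      unfolding mh_def
    proof (rule Bochner_Integration.integral_cong[OF refl])
      fix w assume w: "w \<in> space (N k)"
      have "x(k := w) \<in> space (Pi\<^sub>M ?K N)" using sp[of w x] w x by simp
      from insert.prems(6)[OF insertI2[OF i] this x(2)]
      have "h i ((x(k := w))(i := y)) = h i (x(k := w))" .
      then show "Hh i (w, x(i := y)) = Hh i (w, x)"
        using ik by (simp add: Hh_def fun_upd_twist)
    qed
  qed (use insert.prems in auto)
  have le: "(\<integral>x. (m x - mh i x)\<^sup>2 \<partial>Pi\<^sub>M I N) \<le> (\<integral>z. (G z - Hh i z)\<^sup>2 \<partial>?P)" if i: "i \<in> I" for i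
  proof -
    have [measurable]: "Hh i \<in> borel_measurable ?P" using H i by simp
    have Hi2: "integrable ?P (\<lambda>z. (Hh i z)\<^sup>2)" using H2 i by simp
    have d2: "integrable ?P (\<lambda>z. (G z - Hh i z)\<^sup>2)"
    proof (rule Bochner_Integration.integrable_bound)
      show "integrable ?P (\<lambda>z. 2 * (G z)\<^sup>2 + 2 * (Hh i z)\<^sup>2)" using G2 Hi2 by simp
      have "(a - b)\<^sup>2 \<le> 2 * a\<^sup>2 + 2 * b\<^sup>2" for a b :: real
        using zero_le_power2[of "a + b"] by (simp add: power2_diff power2_sum)
      then show "AE z in ?P. norm ((G z - Hh i z)\<^sup>2) \<le> norm (2 * (G z)\<^sup>2 + 2 * (Hh i z)\<^sup>2)"
        by (auto intro!: AE_I2)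
    qed simp
    have "(\<integral>x. (m x - mh i x)\<^sup>2 \<partial>Pi\<^sub>M I N) = (\<integral>x. (\<integral>y. G (y, x) - Hh i (y, x) \<partial>N k)\<^sup>2 \<partial>Pi\<^sub>M I N)"
    proof (rule integral_cong_AE)
      show "AE x in Pi\<^sub>M I N. (m x - mh i x)\<^sup>2 = (\<integral>y. G (y, x) - Hh i (y, x) \<partial>N k)\<^sup>2"
        using section_mean_square(1)[OF G G2] section_mean_square(1)[OF _ Hi2]
        by (auto simp: m_def mh_def)
    qed (unfold m_def mh_def, measurable)
    also have "\<dots> \<le> (\<integral>z. (G z - Hh i z)\<^sup>2 \<partial>?P)"
      using section_mean_square(3)[of "\<lambda>z. G z - Hh i z"] d2 by simp
    finally show ?thesis .
  qed
  have tr: "(\<integral>x. (g x - h i x)\<^sup>2 \<partial>Pi\<^sub>M ?K N) = (\<integral>z. (G z - Hh i z)\<^sup>2 \<partial>?P)" if "i \<in> ?K" for i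
    unfolding G_def Hh_def by (intro E borel_measurable_power borel_measurable_diff g h that)
  have "PK.variance g = P.variance G"
    unfolding G_def E[OF g] by (rule E) measurable
  also have "\<dots> \<le> (\<integral>z. (G z - Hh k z)\<^sup>2 \<partial>?P) + (\<Sum>i\<in>I. \<integral>z. (G z - Hh i z)\<^sup>2 \<partial>?P)"
    using step IH sum_mono[of I, OF le] by force
  also have "\<dots> = (\<Sum>i\<in>?K. \<integral>x. (g x - h i x)\<^sup>2 \<partial>Pi\<^sub>M ?K N)"
    using insert.hyps by (simp add: tr)
  finally show ?case .
qed

text \<open>By independence, the joint law of the family is the product of the marginal laws
  \<open>?N\<close>, which carry the same measurable sets as \<open>N\<close>; every integral is
  then transported along \<open>?Y\<close>. The empty index set is treated apart because the
  characterisation of independence by product laws is for nonempty families.\<close>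

lemma (in prob_space) efron_stein_indep_vars:
  fixes g :: "('i \<Rightarrow> 'b) \<Rightarrow> real" and h :: "'i \<Rightarrow> ('i \<Rightarrow> 'b) \<Rightarrow> real"
  assumes I: "finite I" and ind: "indep_vars N Y I"
    and g: "g \<in> borel_measurable (Pi\<^sub>M I N)"
    and g2: "integrable M (\<lambda>\<omega>. (g (\<lambda>i\<in>I. Y i \<omega>))\<^sup>2)"
    and h: "\<And>i. i \<in> I \<Longrightarrow> h i \<in> borel_measurable (Pi\<^sub>M I N)"
    and h2: "\<And>i. i \<in> I \<Longrightarrow> integrable M (\<lambda>\<omega>. (h i (\<lambda>i\<in>I. Y i \<omega>))\<^sup>2)"
    and const: "\<And>i x y. i \<in> I \<Longrightarrow> x \<in> space (Pi\<^sub>M I N) \<Longrightarrow> y \<in> space (N i) \<Longrightarrow> h i (x(i := y)) = h i x"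
  shows "variance (\<lambda>\<omega>. g (\<lambda>i\<in>I. Y i \<omega>)) \<le>
    (\<Sum>i\<in>I. expectation (\<lambda>\<omega>. (g (\<lambda>i\<in>I. Y i \<omega>) - h i (\<lambda>i\<in>I. Y i \<omega>))\<^sup>2))"
proof (cases "I = {}")
  case True
  then show ?thesis by (simp add: prob_space restrict_def)
next
  case False
  let ?Y = "\<lambda>\<omega>. \<lambda>i\<in>I. Y i \<omega>"
  let ?N = "\<lambda>i. distr M (N i) (Y i)"
  have Y: "Y i \<in> measurable M (N i)" if "i \<in> I" for i
    using ind that unfolding indep_vars_def by blast
  have Ym: "?Y \<in> measurable M (Pi\<^sub>M I N)"
    using Y by (intro measurable_restrict) auto
  have law: "distr M (Pi\<^sub>M I N) ?Y = Pi\<^sub>M I ?N"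
    using ind by (subst (asm) indep_vars_iff_distr_eq_PiM'[OF False Y])
  have s: "sets (Pi\<^sub>M I ?N) = sets (Pi\<^sub>M I N)" by (intro sets_PiM_cong) auto
  then have bm: "borel_measurable (Pi\<^sub>M I ?N) = (borel_measurable (Pi\<^sub>M I N) :: (_ \<Rightarrow> real) set)"
    by (intro measurable_cong_sets) auto
  have sp: "space (Pi\<^sub>M I ?N) = space (Pi\<^sub>M I N)" by (rule sets_eq_imp_space_eq[OF s])
  have E: "(\<integral>x. f x \<partial>Pi\<^sub>M I ?N) = expectation (\<lambda>\<omega>. f (?Y \<omega>))" if "f \<in> borel_measurable (Pi\<^sub>M I N)" for f :: "_ \<Rightarrow> real"
    unfolding law[symmetric] by (rule integral_distr[OF Ym that])
  have int: "integrable (Pi\<^sub>M I ?N) f \<longleftrightarrow> integrable M (\<lambda>\<omega>. f (?Y \<omega>))" if "f \<in> borel_measurable (Pi\<^sub>M I N)" for f :: "_ \<Rightarrow> real"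
    unfolding law[symmetric] by (rule integrable_distr_eq[OF Ym that])
  have "prob_space.variance (Pi\<^sub>M I ?N) g \<le> (\<Sum>i\<in>I. \<integral>x. (g x - h i x)\<^sup>2 \<partial>Pi\<^sub>M I ?N)"
  proof (rule efron_stein_PiM)
    show "prob_space (?N i)" if "i \<in> I" for i using prob_space_distr Y that by auto
    show "integrable (Pi\<^sub>M I ?N) (\<lambda>x. (g x)\<^sup>2)" using g g2 by (subst int) auto
    show "integrable (Pi\<^sub>M I ?N) (\<lambda>x. (h i x)\<^sup>2)" if "i \<in> I" for i
      using h h2 that by (subst int[of "\<lambda>x. (h i x)\<^sup>2"]) auto
  qed (use g h const sp bm I in auto)
  moreover have "prob_space.variance (Pi\<^sub>M I ?N) g = variance (\<lambda>\<omega>. g (?Y \<omega>))"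
    unfolding E[OF g] by (intro E borel_measurable_power borel_measurable_diff g) simp
  moreover have "(\<integral>x. (g x - h i x)\<^sup>2 \<partial>Pi\<^sub>M I ?N) = expectation (\<lambda>\<omega>. (g (?Y \<omega>) - h i (?Y \<omega>))\<^sup>2)"
    if "i \<in> I" for i
    using g h[OF that] by (intro E) measurable
  ultimately show ?thesis by simp
qed

section \<open>Forests and spanning trees\<close>

text \<open>
  Every edge is a bridge.  For sets of two-element edges this is the absence of a \<open>graph_cycle\<close>,
  but it is easier to maintain when edges are added.
\<close>

definition forest :: "'v set set \<Rightarrow> bool" where
  "forest T \<longleftrightarrow> (\<forall>u v. {u, v} \<in> T \<longrightarrow> (u, v) \<notin> (adjacency (T - {{u, v}}))\<^sup>*)"

lemma adjacency_mono: "E \<subseteq> E' \<Longrightarrow> adjacency E \<subseteq> adjacency E'"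
  by (auto simp: adjacency_def)

lemma rtrancl_adjacency_mono: "E \<subseteq> E' \<Longrightarrow> (adjacency E)\<^sup>* \<subseteq> (adjacency E')\<^sup>*"
  by (intro rtrancl_mono adjacency_mono)

lemma rtrancl_adjacency_sym: "(u, v) \<in> (adjacency E)\<^sup>* \<Longrightarrow> (v, u) \<in> (adjacency E)\<^sup>*"
proof -
  have "sym (adjacency E)" by (auto simp: sym_def adjacency_def insert_commute)
  then show "(u, v) \<in> (adjacency E)\<^sup>* \<Longrightarrow> (v, u) \<in> (adjacency E)\<^sup>*"
    using sym_rtrancl symD by metis
qed

text \<open>A path can be shortened so that it uses the new edge at most once, in one of its two
  directions. An undirected edge inserts two ordered pairs, so the rule for a single inserted pair
  is applied twice, and the cases that use both pairs collapse.\<close>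

lemma rtrancl_adjacency_insert:
  "(x, y) \<in> (adjacency (insert {u, v} E))\<^sup>* \<longleftrightarrow> (x, y) \<in> (adjacency E)\<^sup>* \<or>
    (x, u) \<in> (adjacency E)\<^sup>* \<and> (v, y) \<in> (adjacency E)\<^sup>* \<or>
    (x, v) \<in> (adjacency E)\<^sup>* \<and> (u, y) \<in> (adjacency E)\<^sup>*"
proof -
  let ?R = "(adjacency E)\<^sup>*"
  have "adjacency (insert {u, v} E) = insert (u, v) (insert (v, u) (adjacency E))"
    by (auto simp: adjacency_def doubleton_eq_iff)
  then have "(x, y) \<in> (adjacency (insert {u, v} E))\<^sup>* \<longleftrightarrow>
      (x, y) \<in> ?R \<or> (x, v) \<in> ?R \<and> (u, y) \<in> ?R \<or> (x, u) \<in> ?R \<and> (v, y) \<in> ?R \<or>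
      (x, u) \<in> ?R \<and> (v, v) \<in> ?R \<and> (u, y) \<in> ?R \<or> (x, v) \<in> ?R \<and> (u, u) \<in> ?R \<and> (v, y) \<in> ?R"
    using rtrancl_trans[of _ _ "adjacency E"]
    by (simp add: rtrancl_insert) (meson rtrancl_trans)
  then show ?thesis using rtrancl_trans[of _ _ "adjacency E"] by (meson rtrancl_trans)
qed

lemma forest_empty [simp]: "forest {}"
  by (simp add: forest_def)

lemma forest_subset:
  assumes "forest T" "T' \<subseteq> T"
  shows "forest T'"
  unfolding forest_def
proof (intro allI impI)
  fix u v assume "{u, v} \<in> T'"
  then have "(u, v) \<notin> (adjacency (T - {{u, v}}))\<^sup>*" using assms by (auto simp: forest_def)
  moreover have "(adjacency (T' - {{u, v}}))\<^sup>* \<subseteq> (adjacency (T - {{u, v}}))\<^sup>*"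
    using assms by (intro rtrancl_adjacency_mono) auto
  ultimately show "(u, v) \<notin> (adjacency (T' - {{u, v}}))\<^sup>*" by blast
qed

text \<open>If an old edge \<open>{a, b}\<close> stopped being a bridge, the detour from
  \<open>a\<close> to \<open>b\<close> would have to use the new edge. The remaining pieces of the
  detour, joined through \<open>{a, b}\<close> itself, would then connect \<open>u\<close> and
  \<open>v\<close> inside \<open>T\<close>.\<close>

lemma forest_insert:
  assumes T: "forest T" and uv: "(u, v) \<notin> (adjacency T)\<^sup>*"
  shows "forest (insert {u, v} T)"
  unfolding forest_def
proof (intro allI impI notI)
  fix a b assume ab: "{a, b} \<in> insert {u, v} T"
    and path: "(a, b) \<in> (adjacency (insert {u, v} T - {{a, b}}))\<^sup>*"
  have uvT: "{u, v} \<notin> T" using uv by (auto simp: adjacency_def)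
  show False
  proof (cases "{a, b} = {u, v}")
    case True
    then have "insert {u, v} T - {{a, b}} = T" using uvT by auto
    then have "(a, b) \<in> (adjacency T)\<^sup>*" using path by simp
    then have "(b, a) \<in> (adjacency T)\<^sup>*" by (rule rtrancl_adjacency_sym)
    moreover have "(a = u \<and> b = v) \<or> (a = v \<and> b = u)" using True by (simp only: doubleton_eq_iff)
    ultimately show False using uv \<open>(a, b) \<in> (adjacency T)\<^sup>*\<close> by blast
  next
    case False
    let ?T = "T - {{a, b}}"
    have abT: "{a, b} \<in> T" using ab False by auto
    then have n: "(a, b) \<notin> (adjacency ?T)\<^sup>*" using T by (auto simp: forest_def)
    have "insert {u, v} T - {{a, b}} = insert {u, v} ?T" using False by auto
    then have "(a, u) \<in> (adjacency ?T)\<^sup>* \<and> (v, b) \<in> (adjacency ?T)\<^sup>* \<or>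
        (a, v) \<in> (adjacency ?T)\<^sup>* \<and> (u, b) \<in> (adjacency ?T)\<^sup>*"
      using path n rtrancl_adjacency_insert[of a b u v ?T] by simp
    moreover have "(adjacency ?T)\<^sup>* \<subseteq> (adjacency T)\<^sup>*" by (intro rtrancl_adjacency_mono) auto
    moreover have "(a, b) \<in> (adjacency T)\<^sup>*" using abT by (auto simp: adjacency_def)
    ultimately have "(u, a) \<in> (adjacency T)\<^sup>* \<and> (b, v) \<in> (adjacency T)\<^sup>* \<or>
        (u, b) \<in> (adjacency T)\<^sup>* \<and> (a, v) \<in> (adjacency T)\<^sup>*" "(a, b) \<in> (adjacency T)\<^sup>*" "(b, a) \<in> (adjacency T)\<^sup>*"
      using rtrancl_adjacency_sym[of a u T] rtrancl_adjacency_sym[of v b T]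
        rtrancl_adjacency_sym[of a b T] by blast+
    then have "(u, v) \<in> (adjacency T)\<^sup>*"
      by (meson rtrancl_trans)
    then show False using uv by blast
  qed
qed

text \<open>Each further edge of a forest joins two different components, so the number of
  components drops whenever the number of edges grows. The component count stands in the statement
  to carry this induction.\<close>

lemma card_forest_le:
  assumes V: "finite V" and "finite T" and "forest T"
    and "\<And>h. h \<in> T \<Longrightarrow> \<exists>u v. h = {u, v} \<and> u \<in> V \<and> v \<in> V"
  shows "card T + card (graph_components V T) \<le> card V"
  using assms(2-)
proof (induction T rule: finite_induct)
  case empty
  have "graph_components V {} = (\<lambda>u. {v \<in> V. (u, v) \<in> (adjacency {})\<^sup>*}) ` V"
    by (auto simp: graph_components_def)
  then show ?case using card_image_le[OF V] by simp
next
  case (insert h T)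
  obtain u v where h: "h = {u, v}" "u \<in> V" "v \<in> V" using insert.prems(2)[of h] by auto
  define c where "c E x = {y \<in> V. (x, y) \<in> (adjacency E)\<^sup>*}" for E x
  have comps: "graph_components V E = c E ` V" for E by (auto simp: graph_components_def c_def)
  have "insert h T - {{u, v}} = T" using insert.hyps h(1) by auto
  moreover have "(u, v) \<notin> (adjacency (insert h T - {{u, v}}))\<^sup>*"
    using insert.prems(1) unfolding forest_def h(1) by blast
  ultimately have uv: "(u, v) \<notin> (adjacency T)\<^sup>*" by simp
  have sym: "(x, y) \<in> (adjacency T)\<^sup>* \<longleftrightarrow> (y, x) \<in> (adjacency T)\<^sup>*" for x y
    using rtrancl_adjacency_sym by metis
  have eq: "(x, z) \<in> (adjacency T)\<^sup>* \<longleftrightarrow> (y, z) \<in> (adjacency T)\<^sup>*"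
    if "(x, y) \<in> (adjacency T)\<^sup>*" for x y z
    using that sym rtrancl_trans by metis
  \<comment> \<open>\<open>\<Phi>\<close> sends the class of \<open>u\<close> to the merged class
    and fixes all others. Every new component is the image of an old one different from the class of
    \<open>v\<close>, whence the strict drop.\<close>
  define \<Phi> where "\<Phi> C = (if C = c T u then c T u \<union> c T v else C)" for C
  have "c (insert h T) x \<in> \<Phi> ` (c T ` V - {c T v})" if x: "x \<in> V" for x
  proof (cases "(x, u) \<in> (adjacency T)\<^sup>* \<or> (x, v) \<in> (adjacency T)\<^sup>*")
    case True
    have "(x, y) \<in> (adjacency (insert h T))\<^sup>* \<longleftrightarrow> (u, y) \<in> (adjacency T)\<^sup>* \<or> (v, y) \<in> (adjacency T)\<^sup>*" for y
      unfolding h(1) rtrancl_adjacency_insert using True eq[of x u y] eq[of x v y] by blast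
    then have "c (insert h T) x = c T u \<union> c T v" unfolding c_def by blast
    moreover have "c T u \<noteq> c T v"
    proof -
      have "v \<in> c T v" "v \<notin> c T u" using uv h(3) by (simp_all add: c_def)
      then show ?thesis by blast
    qed
    ultimately show ?thesis using h(2) by (intro image_eqI[of _ _ "c T u"]) (auto simp: \<Phi>_def)
  next
    case False
    then have "c (insert h T) x = c T x"
      unfolding c_def h(1) rtrancl_adjacency_insert by simp
    moreover have "c T x \<noteq> c T v"
    proof -
      have "v \<in> c T v" "v \<notin> c T x" using False h(3) by (simp_all add: c_def)
      then show ?thesis by blast
    qed
    moreover have "c T x \<noteq> c T u"
    proof -
      have "u \<in> c T u" "u \<notin> c T x" using False h(2) by (simp_all add: c_def)
      then show ?thesis by blast
    qed
    ultimately show ?thesis using x by (intro image_eqI[of _ _ "c T x"]) (auto simp: \<Phi>_def)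
  qed
  then have "graph_components V (insert h T) \<subseteq> \<Phi> ` (c T ` V - {c T v})"
    by (auto simp: comps)
  then have "card (graph_components V (insert h T)) \<le> card (c T ` V - {c T v})"
    using V by (meson card_image_le card_mono finite_Diff finite_imageI le_trans)
  also have "\<dots> < card (c T ` V)" using V h(3) by (intro card_Diff1_less) auto
  finally have "card (graph_components V (insert h T)) < card (graph_components V T)"
    by (simp add: comps)
  moreover have "card T + card (graph_components V T) \<le> card V"
    using insert.prems by (intro insert.IH forest_subset[OF insert.prems(1)]) auto
  ultimately show ?case using insert.hyps by simp
qed

text \<open>Prepending a vertex keeps the path simple unless the vertex already occurs; in that case
  cutting the path at this occurrence removes the loop.\<close>

lemma rtrancl_distinct_path:
  assumes "(u, v) \<in> R\<^sup>*"
  shows "\<exists>xs. xs \<noteq> [] \<and> hd xs = u \<and> last xs = v \<and> distinct xs \<and>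
    (\<forall>i. Suc i < length xs \<longrightarrow> (xs ! i, xs ! Suc i) \<in> R)"
  using assms
proof (induction rule: converse_rtrancl_induct)
  case base
  show ?case by (intro exI[of _ "[v]"]) auto
next
  case (step y z)
  from step.IH obtain xs where xs0: "xs \<noteq> [] \<and> hd xs = z \<and> last xs = v \<and> distinct xs \<and>
    (\<forall>i. Suc i < length xs \<longrightarrow> (xs ! i, xs ! Suc i) \<in> R)" ..
  then have xs: "xs \<noteq> []" "hd xs = z" "last xs = v" "distinct xs"
    "Suc i < length xs \<Longrightarrow> (xs ! i, xs ! Suc i) \<in> R" for i by auto
  show ?case
  proof (cases "y \<in> set xs")
    case True
    then obtain k where k: "k < length xs" "xs ! k = y" by (auto simp: in_set_conv_nth)
    have "(drop k xs ! i, drop k xs ! Suc i) \<in> R" if "Suc i < length (drop k xs)" for i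
      using xs(5)[of "k + i"] that by simp
    moreover have "drop k xs \<noteq> []" "hd (drop k xs) = y" "last (drop k xs) = v" "distinct (drop k xs)"
      using k xs(3,4) by (simp_all add: hd_drop_conv_nth last_drop)
    ultimately show ?thesis by (intro exI[of _ "drop k xs"] conjI allI impI)
  next
    case False
    have "((y # xs) ! i, (y # xs) ! Suc i) \<in> R" if "Suc i < length (y # xs)" for i
    proof (cases i)
      case 0
      then show ?thesis using xs(1,2) step.hyps(1) by (simp add: hd_conv_nth)
    next
      case (Suc j)
      then show ?thesis using xs(5)[of j] that by simp
    qed
    moreover have "y # xs \<noteq> []" "hd (y # xs) = y" "last (y # xs) = v" "distinct (y # xs)"
      using xs(1,3,4) False by simp_all
    ultimately show ?thesis by (intro exI[of _ "y # xs"] conjI allI impI)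
  qed
qed

text \<open>A simple path that joins the ends of an edge without using it closes up to a cycle. It
  has at least three vertices: with one the edge would be a loop, with two the path would be the
  excluded edge itself.\<close>

lemma acyclic_imp_forest:
  assumes T: "\<And>h. h \<in> T \<Longrightarrow> \<exists>u v. h = {u, v} \<and> u \<noteq> v"
    and ac: "\<nexists>vs. graph_cycle T vs"
  shows "forest T"
  unfolding forest_def
proof (intro allI impI notI)
  fix u v assume uv: "{u, v} \<in> T" and "(u, v) \<in> (adjacency (T - {{u, v}}))\<^sup>*"
  then obtain xs where xs: "xs \<noteq> []" "hd xs = u" "last xs = v" "distinct xs"
    "\<And>i. Suc i < length xs \<Longrightarrow> {xs ! i, xs ! Suc i} \<in> T - {{u, v}}"
    using rtrancl_distinct_path[of u v "adjacency (T - {{u, v}})"] by (auto simp: adjacency_def)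
  have "u \<noteq> v" using T[OF uv] by auto
  have h: "xs ! 0 = u" "xs ! (length xs - 1) = v" using xs by (auto simp: hd_conv_nth last_conv_nth)
  have "length xs \<noteq> 1" using h \<open>u \<noteq> v\<close> by auto
  moreover have "length xs \<noteq> 2" using xs(5)[of 0] h by (auto simp: numeral_2_eq_2)
  ultimately have l: "length xs \<ge> 3" using xs(1) by (cases "length xs") (auto simp: numeral_eq_Suc)
  have "{xs ! i, xs ! (Suc i mod length xs)} \<in> T" if "i < length xs" for i
  proof (cases "Suc i = length xs")
    case True
    then have "i = length xs - 1" by simp
    then have "xs ! i = v" "Suc i mod length xs = 0" using h(2) True by simp_all
    then show ?thesis using h uv by (simp add: insert_commute)
  next
    case False
    then show ?thesis using xs(5)[of i] that by auto
  qed
  then have "graph_cycle T xs" using l xs by (auto simp: graph_cycle_def)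
  then show False using ac by blast
qed

lemma forest_imp_acyclic:
  assumes "forest T"
  shows "\<nexists>vs. graph_cycle T vs"
proof (intro notI, elim exE)
  fix vs assume vs: "graph_cycle T vs"
  let ?k = "length vs"
  have k: "?k \<ge> 3" "distinct vs" and e: "\<And>i. i < ?k \<Longrightarrow> {vs ! i, vs ! (Suc i mod ?k)} \<in> T"
    using vs by (auto simp: graph_cycle_def)
  let ?u = "vs ! 0" and ?v = "vs ! (?k - 1)"
  have "Suc (?k - 1) = ?k" using k by simp
  then have "Suc (?k - 1) mod ?k = 0" by simp
  then have uv: "{?u, ?v} \<in> T" using e[of "?k - 1"] k by (simp add: insert_commute)
  have "i < ?k \<Longrightarrow> (?u, vs ! i) \<in> (adjacency (T - {{?u, ?v}}))\<^sup>*" for i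
  proof (induction i)
    case (Suc i)
    have "{vs ! i, vs ! Suc i} \<in> T" using e[of i] Suc.prems by simp
    \<comment> \<open>Only a list of length two could have its closing edge among its consecutive
      pairs, since the vertices are distinct.\<close>
    moreover have "{vs ! i, vs ! Suc i} \<noteq> {?u, ?v}"
    proof
      assume "{vs ! i, vs ! Suc i} = {?u, ?v}"
      then have "(vs ! i = ?u \<and> vs ! Suc i = ?v) \<or> (vs ! i = ?v \<and> vs ! Suc i = ?u)"
        by (simp only: doubleton_eq_iff)
      moreover have "i < ?k" "Suc i < ?k" "0 < ?k" "?k - 1 < ?k" using k(1) Suc.prems by linarith+
      ultimately have "(i = 0 \<and> Suc i = ?k - 1) \<or> (i = ?k - 1 \<and> Suc i = 0)"
        by (simp only: nth_eq_iff_index_eq[OF k(2)])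
      then show False using k by auto
    qed
    ultimately have "(vs ! i, vs ! Suc i) \<in> adjacency (T - {{?u, ?v}})"
      by (auto simp: adjacency_def)
    then show ?case using Suc by (auto intro: rtrancl.rtrancl_into_rtrancl)
  qed simp
  from this[of "?k - 1"] have "(?u, ?v) \<in> (adjacency (T - {{?u, ?v}}))\<^sup>*" using k by simp
  then show False using assms uv by (auto simp: forest_def)
qed

text \<open>A forest in \<open>E\<close> that is maximal above \<open>T\<close> connects whatever
  \<open>E\<close> connects, since otherwise \<open>forest_insert\<close> would add one more edge of
  \<open>E\<close> to it.\<close>

lemma forest_extends_to_connected:
  assumes "finite E" "T \<subseteq> E" "forest T" "graph_connected C E"
  shows "\<exists>T'. T \<subseteq> T' \<and> T' \<subseteq> E \<and> forest T' \<and> graph_connected C T'"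
proof -
  have "finite {S. S \<subseteq> E \<and> forest S}" using assms(1) by simp
  then obtain T' where T': "T' \<subseteq> E" "forest T'" "T \<subseteq> T'"
    and max: "\<And>S. S \<subseteq> E \<Longrightarrow> forest S \<Longrightarrow> T' \<subseteq> S \<Longrightarrow> T' = S"
    using finite_has_maximal2[of "{S. S \<subseteq> E \<and> forest S}" T] assms(2,3) by auto
  have "adjacency E \<subseteq> (adjacency T')\<^sup>*"
  proof safe
    fix u v assume uv: "(u, v) \<in> adjacency E"
    show "(u, v) \<in> (adjacency T')\<^sup>*"
    proof (rule ccontr)
      assume n: "(u, v) \<notin> (adjacency T')\<^sup>*"
      then have "T' = insert {u, v} T'"
        using uv T' forest_insert[OF T'(2) n] by (intro max) (auto simp: adjacency_def)
      then have "(u, v) \<in> adjacency T'" by (auto simp: adjacency_def)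
      then show False using n by blast
    qed
  qed
  then have "(adjacency E)\<^sup>* \<subseteq> (adjacency T')\<^sup>*" using rtrancl_subset_rtrancl by blast
  then have "graph_connected C T'" using assms(4) unfolding graph_connected_def by blast
  then show ?thesis using T' by blast
qed

text \<open>A path from the representative \<open>u\<close> never leaves its component, so it
  survives the restriction to edges inside \<open>C\<close>.\<close>

lemma graph_component_connected:
  assumes C: "C \<in> graph_components V E" and E: "\<And>h. h \<in> E \<Longrightarrow> h \<subseteq> V"
  shows "graph_connected C {h \<in> E. h \<subseteq> C}"
proof -
  let ?E = "{h \<in> E. h \<subseteq> C}"
  obtain u where u: "u \<in> V" and Cu: "C = {v \<in> V. (u, v) \<in> (adjacency E)\<^sup>*}"
    using C by (auto simp: graph_components_def)
  have "(u, v) \<in> (adjacency E)\<^sup>* \<Longrightarrow> (u, v) \<in> (adjacency ?E)\<^sup>*" for v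
  proof (induction rule: rtrancl_induct)
    case (step y z)
    have yz: "{y, z} \<in> E" using step.hyps by (simp add: adjacency_def)
    have "(u, z) \<in> (adjacency E)\<^sup>*" using step.hyps by (rule rtrancl.rtrancl_into_rtrancl)
    then have "{y, z} \<subseteq> C" using E[OF yz] step.hyps(1) unfolding Cu by blast
    then have "(y, z) \<in> adjacency ?E" using yz by (simp add: adjacency_def)
    with step.IH show ?case by (rule rtrancl.rtrancl_into_rtrancl)
  qed simp
  moreover have "(u, v) \<in> (adjacency E)\<^sup>*" if "v \<in> C" for v using that unfolding Cu by blast
  ultimately have reach: "(u, v) \<in> (adjacency ?E)\<^sup>*" if "v \<in> C" for v using that by blast
  have "(v, w) \<in> (adjacency ?E)\<^sup>*" if "v \<in> C" "w \<in> C" for v w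
    using rtrancl_trans[OF rtrancl_adjacency_sym[OF reach[OF that(1)]] reach[OF that(2)]] .
  moreover have "C \<noteq> {}" using u Cu by blast
  ultimately show ?thesis by (simp add: graph_connected_def)
qed

section \<open>Forests and spanning trees in the complete graph\<close>

lemma complete_edgesE:
  assumes "h \<in> complete_edges n"
  obtains u v where "h = {u, v}" "u \<in> {1..n}" "v \<in> {1..n}" "u < v"
proof -
  obtain u v where h: "h = {u, v}" "u \<in> {1..n}" "v \<in> {1..n}" "u \<noteq> v"
    using assms by (auto simp: complete_edges_def)
  have "h = {v, u}" using h(1) by blast
  then show ?thesis
    using that[OF h(1-3)] that[OF _ h(3,2)] h(4) by linarith
qed

lemma complete_edges_subset: "complete_edges n \<subseteq> Pow {1..n}"
  by (auto simp: complete_edges_def)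

lemma finite_complete_edges [simp]: "finite (complete_edges n)"
  using complete_edges_subset finite_subset by blast

definition forests :: "nat \<Rightarrow> nat set set set" where
  "forests n = {T. T \<subseteq> complete_edges n \<and> forest T}"

lemma finite_forests [simp]: "finite (forests n)"
  by (simp add: forests_def)

lemma empty_in_forests [simp]: "{} \<in> forests n"
  by (simp add: forests_def)

lemma card_forests_le:
  assumes "T \<in> forests n"
  shows "card T \<le> n"
proof -
  have "card T + card (graph_components {1..n} T) \<le> card {1..n}"
  proof (rule card_forest_le)
    show "finite T" using assms finite_subset[OF _ finite_complete_edges] by (auto simp: forests_def)
    fix h assume "h \<in> T"
    then have "h \<in> complete_edges n" using assms by (auto simp: forests_def)
    then show "\<exists>u v. h = {u, v} \<and> u \<in> {1..n} \<and> v \<in> {1..n}"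
      unfolding complete_edges_def by blast
  qed (use assms in \<open>simp_all add: forests_def\<close>)
  then show ?thesis by simp
qed

lemma spanning_trees_subset_forests:
  assumes "E \<subseteq> complete_edges n"
  shows "spanning_trees C E \<subseteq> forests n"
proof
  fix T assume T: "T \<in> spanning_trees C E"
  then have "T \<subseteq> complete_edges n" using assms by (auto simp: spanning_trees_def)
  moreover have "forest T"
  proof (rule acyclic_imp_forest)
    show "\<nexists>vs. graph_cycle T vs" using T by (simp add: spanning_trees_def)
    fix h assume "h \<in> T"
    then have "h \<in> complete_edges n" using \<open>T \<subseteq> complete_edges n\<close> by blast
    then show "\<exists>u v. h = {u, v} \<and> u \<noteq> v" unfolding complete_edges_def by blast
  qed
  ultimately show "T \<in> forests n" by (simp add: forests_def)
qed

text \<open>Applied to the empty forest this gives the existence of a spanning tree; applied to the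
  present edges of an optimal forest it compares the two maxima.\<close>

lemma forest_subset_spanning_tree:
  assumes E: "E \<subseteq> complete_edges n" and C: "C \<in> graph_components {1..n} E"
    and T: "T \<subseteq> {h \<in> E. h \<subseteq> C}" "forest T"
  shows "\<exists>T' \<in> spanning_trees C E. T \<subseteq> T'"
proof -
  have "graph_connected C {h \<in> E. h \<subseteq> C}"
  proof (rule graph_component_connected[OF C])
    show "h \<subseteq> {1..n}" if "h \<in> E" for h using E complete_edges_subset[of n] that by blast
  qed
  moreover have "finite {h \<in> E. h \<subseteq> C}" using finite_subset[OF E] by simp
  ultimately obtain T' where "T \<subseteq> T'" "T' \<subseteq> {h \<in> E. h \<subseteq> C}" "forest T'" "graph_connected C T'"
    using forest_extends_to_connected[OF _ T] by metis
  then have "T' \<in> spanning_trees C E"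
    using forest_imp_acyclic[of T'] by (simp add: spanning_trees_def)
  then show ?thesis using \<open>T \<subseteq> T'\<close> by (rule bexI[rotated])
qed

text \<open>The graph is encoded in the costs: an absent edge has cost 0. The maximum thus runs over
  one fixed finite family, which makes it monotone in the costs and measurable whenever the costs
  are.\<close>

definition max_forest_cost :: "nat \<Rightarrow> (nat set \<Rightarrow> real) \<Rightarrow> real" where
  "max_forest_cost n z = Max ((\<lambda>T. \<Sum>h\<in>T. z h) ` forests n)"

lemma max_forest_cost_ge: "T \<in> forests n \<Longrightarrow> (\<Sum>h\<in>T. z h) \<le> max_forest_cost n z"
  unfolding max_forest_cost_def by (intro Max_ge) auto

lemma max_forest_cost_attained:
  obtains T where "T \<in> forests n" "max_forest_cost n z = (\<Sum>h\<in>T. z h)"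
proof -
  have "max_forest_cost n z \<in> (\<lambda>T. \<Sum>h\<in>T. z h) ` forests n"
    unfolding max_forest_cost_def by (intro Max_in) (auto intro: empty_in_forests)
  then show ?thesis using that by auto
qed

lemma max_forest_cost_nonneg: "0 \<le> max_forest_cost n z"
  using max_forest_cost_ge[OF empty_in_forests, of z n] by simp

lemma max_forest_cost_mono:
  assumes "\<And>h. h \<in> complete_edges n \<Longrightarrow> z h \<le> z' h"
  shows "max_forest_cost n z \<le> max_forest_cost n z'"
proof -
  obtain T where T: "T \<in> forests n" "max_forest_cost n z = (\<Sum>h\<in>T. z h)"
    by (rule max_forest_cost_attained)
  then have "(\<Sum>h\<in>T. z h) \<le> (\<Sum>h\<in>T. z' h)" using assms by (intro sum_mono) (auto simp: forests_def)
  then show ?thesis using max_forest_cost_ge[OF T(1), of z'] T(2) by simp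
qed

lemma spanning_trees_nonempty:
  assumes "E \<subseteq> complete_edges n" "C \<in> graph_components {1..n} E"
  shows "spanning_trees C E \<noteq> {}"
  using forest_subset_spanning_tree[OF assms, of "{}"] by auto

lemma finite_spanning_trees:
  assumes "E \<subseteq> complete_edges n"
  shows "finite (spanning_trees C E)"
  using spanning_trees_subset_forests[OF assms] finite_subset finite_forests by blast

text \<open>The upper bound holds because a spanning tree is a forest. When \<open>C\<close> is the
  whole vertex set, dropping the absent edges of an optimal forest costs nothing, and the rest
  extends to a spanning tree by edges of nonnegative cost.\<close>

lemma max_spanning_tree_bounds:
  fixes c :: "nat set \<Rightarrow> real"
  assumes E: "E \<subseteq> complete_edges n" and C: "C \<in> graph_components {1..n} E"
    and c: "\<And>h. h \<in> complete_edges n \<Longrightarrow> 0 \<le> c h"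
  defines "x \<equiv> Max ((\<lambda>T. \<Sum>h\<in>T. c h) ` spanning_trees C E)"
  shows "0 \<le> x" and "x \<le> max_forest_cost n (\<lambda>h. if h \<in> E then c h else 0)"
    and "C = {1..n} \<Longrightarrow> x = max_forest_cost n (\<lambda>h. if h \<in> E then c h else 0)"
proof -
  let ?f = "\<lambda>T. \<Sum>h\<in>T. c h" and ?z = "\<lambda>h. if h \<in> E then c h else 0"
  have fin: "finite (?f ` spanning_trees C E)" using finite_spanning_trees[OF E] by simp
  then have "x \<in> ?f ` spanning_trees C E"
    unfolding x_def using spanning_trees_nonempty[OF E C] by (intro Max_in) auto
  then obtain T where T: "T \<in> spanning_trees C E" "x = ?f T" by auto
  have TE: "T \<subseteq> E" using T(1) by (auto simp: spanning_trees_def)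
  show "0 \<le> x" unfolding T(2) using TE E c by (intro sum_nonneg) auto
  have "x = (\<Sum>h\<in>T. ?z h)" unfolding T(2) using TE by (intro sum.cong) auto
  also have "\<dots> \<le> max_forest_cost n ?z"
    using T(1) spanning_trees_subset_forests[OF E] by (intro max_forest_cost_ge) auto
  finally show le: "x \<le> max_forest_cost n ?z" .
  assume Cn: "C = {1..n}"
  obtain S where S: "S \<in> forests n" "max_forest_cost n ?z = (\<Sum>h\<in>S. ?z h)"
    by (rule max_forest_cost_attained)
  have "S \<inter> E \<subseteq> {h \<in> E. h \<subseteq> C}" using E complete_edges_subset[of n] Cn by auto
  moreover have "forest (S \<inter> E)" using S by (auto simp: forests_def intro: forest_subset)
  ultimately obtain T' where T': "T' \<in> spanning_trees C E" "S \<inter> E \<subseteq> T'"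
    using forest_subset_spanning_tree[OF E C] by blast
  have T'E: "T' \<subseteq> E" using T'(1) by (auto simp: spanning_trees_def)
  have finS: "finite S" using S(1) finite_subset[OF _ finite_complete_edges] by (auto simp: forests_def)
  have "(\<Sum>h\<in>S. ?z h) = ?f (S \<inter> E)" using finS by (simp add: sum.inter_restrict)
  also have "\<dots> \<le> ?f T'"
    using T' T'E E c finite_subset[OF E] finite_subset[OF T'E] by (intro sum_mono2) auto
  also have "\<dots> \<le> x" unfolding x_def using T'(1) fin by (intro Max_ge) auto
  finally show "x = max_forest_cost n ?z" using le S(2) by simp
qed

lemma largest_component_connected:
  assumes "graph_connected V E" "largest_component V E C"
  shows "C = V"
  using assms by (auto simp: graph_connected_def largest_component_def graph_components_def)

text \<open>The set reachable from some vertex and its complement are both nonempty and without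
  edges between them; the smaller one is taken. Its complement then has at least half of the
  vertices, hence at least \<gamma>0 n, so that condition (i) bounds the degrees across the cut from
  below.\<close>

lemma not_connected_small_cut:
  assumes n: "n \<ge> 1" and nc: "\<not> graph_connected {1..n} E"
  shows "\<exists>S. S \<subseteq> {1..n} \<and> S \<noteq> {} \<and> 2 * card S \<le> n \<and> (\<forall>u\<in>S. \<forall>v\<in>{1..n} - S. {u, v} \<notin> E)"
proof -
  obtain u v where uv: "u \<in> {1..n}" "v \<in> {1..n}" "(u, v) \<notin> (adjacency E)\<^sup>*"
    using n nc by (auto simp: graph_connected_def)
  define A where "A = {w \<in> {1..n}. (u, w) \<in> (adjacency E)\<^sup>*}"
  have A: "A \<subseteq> {1..n}" "u \<in> A" "v \<in> {1..n} - A" using uv by (auto simp: A_def)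
  have cut: "{a, b} \<notin> E" if "a \<in> A" "b \<in> {1..n} - A" for a b
  proof
    assume "{a, b} \<in> E"
    then have "(a, b) \<in> adjacency E" by (simp add: adjacency_def)
    then show False using that by (auto simp: A_def intro: rtrancl.rtrancl_into_rtrancl)
  qed
  have card: "card ({1..n} - A) = n - card A" "card A \<le> n"
    using A card_mono[OF _ A(1)] by (auto simp: card_Diff_subset finite_subset)
  show ?thesis
  proof (cases "2 * card A \<le> n")
    case True
    then show ?thesis using A cut by (intro exI[of _ A]) auto
  next
    case False
    have "{1..n} - ({1..n} - A) = A" using A by auto
    moreover have "{a, b} \<notin> E" if "a \<in> {1..n} - A" "b \<in> A" for a b
      using cut[OF that(2,1)] by (simp add: insert_commute)
    ultimately show ?thesis using False A card by (intro exI[of _ "{1..n} - A"]) auto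
  qed
qed

text \<open>The optimal forest \<open>T\<close> remains a competitor after zeroing, and there it
  loses just the cost of its zeroed edges.\<close>

lemma max_forest_cost_zeroing:
  assumes z: "\<And>h. h \<in> complete_edges n \<Longrightarrow> 0 \<le> z h"
    and T: "T \<in> forests n" "max_forest_cost n z = (\<Sum>h\<in>T. z h)"
  shows "max_forest_cost n (\<lambda>h. if P h then 0 else z h) \<le> max_forest_cost n z"
    and "max_forest_cost n z - max_forest_cost n (\<lambda>h. if P h then 0 else z h) \<le> (\<Sum>h\<in>{h \<in> T. P h}. z h)"
proof -
  let ?z = "\<lambda>h. if P h then 0 else z h"
  show "max_forest_cost n ?z \<le> max_forest_cost n z"
    using z by (intro max_forest_cost_mono) auto
  have T': "T \<subseteq> complete_edges n" and fin: "finite T"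
    using T finite_subset[of T "complete_edges n"] by (auto simp: forests_def)
  have "(\<Sum>h\<in>T. z h) = (\<Sum>h\<in>T. (if P h then z h else 0) + ?z h)"
    by (intro sum.cong) auto
  also have "\<dots> = (\<Sum>h\<in>{h \<in> T. P h}. z h) + (\<Sum>h\<in>T. ?z h)"
    using fin by (simp add: sum.distrib sum.inter_filter)
  finally show "max_forest_cost n z - max_forest_cost n ?z \<le> (\<Sum>h\<in>{h \<in> T. P h}. z h)"
    using max_forest_cost_ge[OF T(1), of ?z] T(2) by simp
qed

text \<open>The handshake identity with weights on the edges.\<close>

lemma sum_over_endpoints:
  fixes f :: "nat set \<Rightarrow> real"
  assumes T: "T \<subseteq> complete_edges n"
  shows "(\<Sum>u\<in>{1..n}. \<Sum>h\<in>{h \<in> T. u \<in> h}. f h) = 2 * (\<Sum>h\<in>T. f h)"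
proof -
  have fin: "finite T" using finite_subset[OF T] by simp
  have "(\<Sum>u\<in>{1..n}. \<Sum>h\<in>{h \<in> T. u \<in> h}. f h) = (\<Sum>u\<in>{1..n}. \<Sum>h\<in>T. if u \<in> h then f h else 0)"
    using fin by (simp add: sum.inter_filter)
  also have "\<dots> = (\<Sum>h\<in>T. \<Sum>u\<in>{1..n}. if u \<in> h then f h else 0)" by (rule sum.swap)
  also have "\<dots> = (\<Sum>h\<in>T. 2 * f h)"
  proof (rule sum.cong[OF refl])
    fix h assume "h \<in> T"
    then obtain u v where h: "h = {u, v}" "u \<in> {1..n}" "v \<in> {1..n}" "u < v"
      using T by (blast elim: complete_edgesE)
    have "{u \<in> {1..n}. u \<in> h} = h" using h by auto
    moreover have "card h = 2" using h by simp
    ultimately show "(\<Sum>u\<in>{1..n}. if u \<in> h then f h else 0) = 2 * f h"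
      by (simp add: sum.inter_filter[symmetric])
  qed
  finally show ?thesis by (simp add: sum_distrib_left)
qed

text \<open>
  With \<open>t\<close> the degree in a forest, \<open>d\<close> the degree in the graph and \<open>m\<close> its mean: the squared forest
  degrees are controlled by the variances of the degrees, so no bound on the maximum degree is needed.
\<close>

lemma degree_square_bound:
  fixes t d m :: real
  assumes "0 \<le> t" "t \<le> d" "0 \<le> m"
  shows "t\<^sup>2 \<le> 2 * m * t + 4 * (d - m)\<^sup>2"
\<comment> \<open>If the degree is at most twice its mean, one factor \<open>t\<close> is bounded by
  \<open>2 * m\<close>; otherwise \<open>d < 2 * (d - m)\<close>, and the deviation alone controls
  \<open>t\<close>.\<close>
proof (cases "d \<le> 2 * m")
  case True
  then have "t * t \<le> (2 * m) * t" using assms by (intro mult_right_mono) auto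
  then show ?thesis using zero_le_power2[of "d - m"] unfolding power2_eq_square by linarith
next
  case False
  then have "t\<^sup>2 \<le> (2 * (d - m))\<^sup>2" using assms by (intro power_mono) auto
  moreover have "0 \<le> 2 * m * t" using assms by simp
  moreover have "(2 * (d - m))\<^sup>2 = 4 * (d - m)\<^sup>2" by (simp only: power_mult_distrib) simp
  ultimately show ?thesis by linarith
qed

lemma sum_squares_le_square_sum:
  fixes f :: "'b \<Rightarrow> real"
  assumes "finite A" "\<And>x. x \<in> A \<Longrightarrow> 0 \<le> f x"
  shows "(\<Sum>x\<in>A. (f x)\<^sup>2) \<le> (\<Sum>x\<in>A. f x)\<^sup>2"
  using assms
proof (induction A rule: finite_induct)
  case (insert x A)
  then have "0 \<le> 2 * f x * (\<Sum>x\<in>A. f x)" by (simp add: sum_nonneg)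
  then show ?case using insert by (simp add: power2_sum)
qed simp

section \<open>Independent coordinates and their influence on edge costs\<close>

datatype coord = State "nat set" | Weight "nat set" | Mark nat

definition coords :: "nat \<Rightarrow> coord set" where
  "coords n = State ` complete_edges n \<union> (Weight ` complete_edges n \<union> Mark ` {1..n})"

text \<open>A state or a weight touches one edge, a mark touches all edges at its vertex. This is
  how squared forest degrees enter the variance bound.\<close>

fun affects :: "coord \<Rightarrow> nat set \<Rightarrow> bool" where
  "affects (State h') h \<longleftrightarrow> h = h'"
| "affects (Weight h') h \<longleftrightarrow> h = h'"
| "affects (Mark u) h \<longleftrightarrow> u \<in> h"

lemma finite_coords [simp]: "finite (coords n)"
  by (simp add: coords_def)

lemma coords_iff [simp]:
  "State h \<in> coords n \<longleftrightarrow> h \<in> complete_edges n"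
  "Weight h \<in> coords n \<longleftrightarrow> h \<in> complete_edges n"
  "Mark u \<in> coords n \<longleftrightarrow> u \<in> {1..n}"
  by (auto simp: coords_def)

lemma sum_coords:
  fixes f :: "coord \<Rightarrow> 'b::comm_monoid_add"
  shows "(\<Sum>j\<in>coords n. f j) = (\<Sum>h\<in>complete_edges n. f (State h)) +
    ((\<Sum>h\<in>complete_edges n. f (Weight h)) + (\<Sum>u\<in>{1..n}. f (Mark u)))"
proof -
  have "(\<Sum>j\<in>coords n. f j) = (\<Sum>j\<in>State ` complete_edges n. f j) +
      ((\<Sum>j\<in>Weight ` complete_edges n. f j) + (\<Sum>j\<in>Mark ` {1..n}. f j))"
    unfolding coords_def by (subst sum.union_disjoint, simp, simp, blast)+ simp
  then show ?thesis by (simp add: sum.reindex inj_on_def)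
qed

lemma prod_coords:
  fixes f :: "coord \<Rightarrow> 'b::comm_monoid_mult"
  shows "(\<Prod>j\<in>coords n. f j) = (\<Prod>h\<in>complete_edges n. f (State h)) *
    ((\<Prod>h\<in>complete_edges n. f (Weight h)) * (\<Prod>u\<in>{1..n}. f (Mark u)))"
proof -
  have "(\<Prod>j\<in>coords n. f j) = (\<Prod>j\<in>State ` complete_edges n. f j) *
      ((\<Prod>j\<in>Weight ` complete_edges n. f j) * (\<Prod>j\<in>Mark ` {1..n}. f j))"
    unfolding coords_def by (subst prod.union_disjoint, simp, simp, blast)+ simp
  then show ?thesis by (simp add: prod.reindex inj_on_def)
qed

text \<open>
  Zeroing the costs of the edges affected by a coordinate changes the maximum by at most their total
  cost in one fixed optimal forest.  Edge coordinates contribute no more than the marks do.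
\<close>

lemma sum_square_influences_le:
  fixes z e :: "nat set \<Rightarrow> real" and m :: "nat \<Rightarrow> real" and A :: "nat set \<Rightarrow> bool"
  assumes z: "\<And>h. h \<in> complete_edges n \<Longrightarrow> 0 \<le> z h"
    and e: "\<And>h. h \<in> complete_edges n \<Longrightarrow> 0 \<le> e h"
    and ze: "\<And>h. h \<in> complete_edges n \<Longrightarrow> z h \<le> L * of_bool (A h) + e h"
    and L: "0 \<le> L"
    and m: "\<And>u. u \<in> {1..n} \<Longrightarrow> 0 \<le> m u \<and> m u \<le> \<beta>"
  defines "K u \<equiv> {h \<in> complete_edges n. u \<in> h}"
  shows "(\<Sum>j\<in>coords n. (max_forest_cost n z - max_forest_cost n (\<lambda>h. if affects j h then 0 else z h))\<^sup>2)
    \<le> 16 * \<beta> * n * L\<^sup>2 + 16 * L\<^sup>2 * (\<Sum>u\<in>{1..n}. ((\<Sum>h\<in>K u. of_bool (A h)) - m u)\<^sup>2)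
      + 4 * (\<Sum>u\<in>{1..n}. (\<Sum>h\<in>K u. e h)\<^sup>2)"
proof -
  obtain T where T: "T \<in> forests n" "max_forest_cost n z = (\<Sum>h\<in>T. z h)"
    by (rule max_forest_cost_attained)
  have TK: "T \<subseteq> complete_edges n" using T by (simp add: forests_def)
  have fin: "finite T" using finite_subset[OF TK] by simp
  have zT: "0 \<le> z h" if "h \<in> T" for h using z TK that by blast
  define \<Delta> where "\<Delta> j = max_forest_cost n z - max_forest_cost n (\<lambda>h. if affects j h then 0 else z h)" for j
  have \<Delta>: "(\<Delta> j)\<^sup>2 \<le> (\<Sum>h\<in>{h \<in> T. affects j h}. z h)\<^sup>2" for j
    using max_forest_cost_zeroing[OF z T, of "affects j"] unfolding \<Delta>_def
    by (intro power_mono) auto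
  define V where "V u = (\<Sum>h\<in>{h \<in> T. u \<in> h}. z h)" for u
  have edge: "(\<Sum>h\<in>complete_edges n. (\<Sum>h'\<in>{h' \<in> T. h' = h}. z h')\<^sup>2) = (\<Sum>h\<in>T. (z h)\<^sup>2)"
  proof -
    have "(\<Sum>h'\<in>{h' \<in> T. h' = h}. z h')\<^sup>2 = (if h \<in> T then (z h)\<^sup>2 else 0)" for h
    proof -
      have "{h' \<in> T. h' = h} = (if h \<in> T then {h} else {})" by auto
      then show ?thesis by simp
    qed
    moreover have "{h \<in> complete_edges n. h \<in> T} = T" using TK by auto
    ultimately show ?thesis by (simp add: sum.inter_filter[symmetric])
  qed
  \<comment> \<open>States and weights each contribute the sum of squared values over
    \<open>T\<close>. By the handshake identity, both together are dominated by the squared star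
    sums \<open>V u\<close> that come from the marks.\<close>
  have "2 * (\<Sum>h\<in>T. (z h)\<^sup>2) = (\<Sum>u\<in>{1..n}. \<Sum>h\<in>{h \<in> T. u \<in> h}. (z h)\<^sup>2)"
    by (rule sum_over_endpoints[OF TK, symmetric])
  also have "\<dots> \<le> (\<Sum>u\<in>{1..n}. (V u)\<^sup>2)"
    unfolding V_def using fin zT by (intro sum_mono sum_squares_le_square_sum) auto
  finally have sq: "2 * (\<Sum>h\<in>T. (z h)\<^sup>2) \<le> (\<Sum>u\<in>{1..n}. (V u)\<^sup>2)" .
  have "(\<Sum>j\<in>coords n. (\<Delta> j)\<^sup>2) \<le> (\<Sum>j\<in>coords n. (\<Sum>h\<in>{h \<in> T. affects j h}. z h)\<^sup>2)"
    by (intro sum_mono \<Delta>)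
  also have "\<dots> = 2 * (\<Sum>h\<in>T. (z h)\<^sup>2) + (\<Sum>u\<in>{1..n}. (V u)\<^sup>2)"
    using edge by (simp add: sum_coords V_def)
  also have "\<dots> \<le> 2 * (\<Sum>u\<in>{1..n}. (V u)\<^sup>2)" using sq by simp
  finally have main: "(\<Sum>j\<in>coords n. (\<Delta> j)\<^sup>2) \<le> 2 * (\<Sum>u\<in>{1..n}. (V u)\<^sup>2)" .
  define t where "t u = (\<Sum>h\<in>{h \<in> T. u \<in> h}. of_bool (A h) :: real)" for u
  define d where "d u = (\<Sum>h\<in>K u. of_bool (A h) :: real)" for u
  have sub: "{h \<in> T. u \<in> h} \<subseteq> K u" "finite (K u)" for u using TK by (auto simp: K_def)
  have Vu: "(V u)\<^sup>2 \<le> 2 * L\<^sup>2 * (2 * \<beta> * t u + 4 * (d u - m u)\<^sup>2) + 2 * (\<Sum>h\<in>K u. e h)\<^sup>2" if u: "u \<in> {1..n}" for u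
  proof -
    have t: "0 \<le> t u" "t u \<le> d u"
      unfolding t_def d_def using sub[of u] by (intro sum_nonneg sum_mono2; simp)+
    have "V u \<le> (\<Sum>h\<in>{h \<in> T. u \<in> h}. L * of_bool (A h) + e h)"
      unfolding V_def using TK by (intro sum_mono ze) auto
    also have "\<dots> = L * t u + (\<Sum>h\<in>{h \<in> T. u \<in> h}. e h)"
      by (simp add: sum.distrib sum_distrib_left t_def)
    also have "\<dots> \<le> L * t u + (\<Sum>h\<in>K u. e h)"
      using sub e by (intro add_left_mono sum_mono2) (auto simp: K_def)
    finally have "V u \<le> L * t u + (\<Sum>h\<in>K u. e h)" .
    moreover have "0 \<le> V u" unfolding V_def using zT by (intro sum_nonneg) auto
    ultimately have "(V u)\<^sup>2 \<le> (L * t u + (\<Sum>h\<in>K u. e h))\<^sup>2" by (intro power_mono) auto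
    also have "\<dots> \<le> 2 * (L * t u)\<^sup>2 + 2 * (\<Sum>h\<in>K u. e h)\<^sup>2"
      using sum_squares_bound[of "L * t u" "\<Sum>h\<in>K u. e h"] by (simp add: power2_sum)
    also have "(L * t u)\<^sup>2 \<le> L\<^sup>2 * (2 * m u * t u + 4 * (d u - m u)\<^sup>2)"
      unfolding power_mult_distrib using t m[OF u] by (intro mult_left_mono degree_square_bound) auto
    also have "\<dots> \<le> L\<^sup>2 * (2 * \<beta> * t u + 4 * (d u - m u)\<^sup>2)"
      using t m[OF u] by (intro mult_left_mono add_right_mono mult_right_mono) auto
    finally show ?thesis by simp
  qed
  \<comment> \<open>A forest has at most \<open>n\<close> edges, so the terms linear in
    \<open>t u\<close> add up to order \<open>\<beta> * n\<close>; with graph degrees in place of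
    forest degrees the order would be \<open>\<beta>\<^sup>2 * n\<close>.\<close>
  have tn: "(\<Sum>u\<in>{1..n}. t u) \<le> 2 * n"
  proof -
    have "(\<Sum>u\<in>{1..n}. t u) = 2 * (\<Sum>h\<in>T. of_bool (A h))"
      unfolding t_def by (rule sum_over_endpoints[OF TK])
    also have "(\<Sum>h\<in>T. of_bool (A h) :: real) \<le> card T"
      using sum_mono[of T "\<lambda>h. of_bool (A h) :: real" "\<lambda>_. 1"] by simp
    also have "real (card T) \<le> n" using card_forests_le[OF T(1)] by simp
    finally show ?thesis by simp
  qed
  have tn': "L\<^sup>2 * (\<beta> * (\<Sum>u\<in>{1..n}. t u)) \<le> L\<^sup>2 * (\<beta> * (2 * n))"
  \<comment> \<open>Nonnegativity of \<open>\<beta>\<close> is read off at vertex 1, which must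
    exist.\<close>
  proof (cases "n = 0")
    case False
    then have "0 \<le> \<beta>" using m[of 1] by auto
    then show ?thesis using tn by (intro mult_left_mono) auto
  qed simp
  have "2 * (\<Sum>u\<in>{1..n}. (V u)\<^sup>2) \<le>
      2 * (\<Sum>u\<in>{1..n}. 2 * L\<^sup>2 * (2 * \<beta> * t u + 4 * (d u - m u)\<^sup>2) + 2 * (\<Sum>h\<in>K u. e h)\<^sup>2)"
    by (intro mult_left_mono sum_mono Vu) auto
  also have "\<dots> = 8 * (L\<^sup>2 * (\<beta> * (\<Sum>u\<in>{1..n}. t u))) + 16 * L\<^sup>2 * (\<Sum>u\<in>{1..n}. (d u - m u)\<^sup>2)
      + 4 * (\<Sum>u\<in>{1..n}. (\<Sum>h\<in>K u. e h)\<^sup>2)"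
    by (simp add: sum.distrib sum_distrib_left distrib_left mult.assoc)
  also have "\<dots> \<le> 8 * (L\<^sup>2 * (\<beta> * (2 * n))) + 16 * L\<^sup>2 * (\<Sum>u\<in>{1..n}. (d u - m u)\<^sup>2)
      + 4 * (\<Sum>u\<in>{1..n}. (\<Sum>h\<in>K u. e h)\<^sup>2)"
    using tn' by linarith
  finally show ?thesis using main unfolding \<Delta>_def d_def by (simp add: mult_ac)
qed

section \<open>Independent coordinates\<close>

text \<open>The assumption \<open>families_indep\<close> speaks of the \<sigma>-algebra generated by
  a whole family. Events of a single member have to be recognised as elements of it.\<close>

lemma sets_vimage_algebra_component:
  assumes i: "i \<in> I" and Y: "\<And>i. i \<in> I \<Longrightarrow> Y i \<in> measurable M (N i)"
    and A: "A \<in> sets (vimage_algebra (space M) (Y i) (N i))"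
  shows "A \<in> sets (vimage_algebra (space M) (\<lambda>\<omega>. \<lambda>i\<in>I. Y i \<omega>) (Pi\<^sub>M I N))"
proof -
  let ?Y = "\<lambda>\<omega>. \<lambda>i\<in>I. Y i \<omega>"
  have Yi: "Y i \<in> space M \<rightarrow> space (N i)" if "i \<in> I" for i
    using measurable_space[OF Y[OF that]] by auto
  obtain B where B: "B \<in> sets (N i)" "A = Y i -` B \<inter> space M"
    using A sets_vimage_algebra2[OF Yi[OF i]] by auto
  have Ym: "?Y \<in> measurable M (Pi\<^sub>M I N)" using Y by (intro measurable_restrict) auto
  have sp: "?Y \<omega> \<in> space (Pi\<^sub>M I N)" if "\<omega> \<in> space M" for \<omega>
    by (rule measurable_space[OF Ym that])
  have "(\<lambda>x. x i) -` B \<inter> space (Pi\<^sub>M I N) \<in> sets (Pi\<^sub>M I N)"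
    using B(1) i by (intro measurable_sets[OF measurable_component_singleton]) auto
  then have "?Y -` ((\<lambda>x. x i) -` B \<inter> space (Pi\<^sub>M I N)) \<inter> space M \<in>
      sets (vimage_algebra (space M) ?Y (Pi\<^sub>M I N))"
    by (rule in_vimage_algebra)
  also have "?Y -` ((\<lambda>x. x i) -` B \<inter> space (Pi\<^sub>M I N)) \<inter> space M = A"
    using sp i unfolding B(2) by auto
  finally show ?thesis .
qed

lemma (in prob_space) indep_sets_vimage_algebra:
  assumes "indep_vars N Y I"
  shows "indep_sets (\<lambda>i. sets (vimage_algebra (space M) (Y i) (N i))) I"
proof -
  have "sets (vimage_algebra (space M) (Y i) (N i)) = {Y i -` A \<inter> space M | A. A \<in> sets (N i)}" if "i \<in> I" for i
    using assms that by (intro sets_vimage_algebra2) (auto simp: indep_vars_def2 dest: measurable_space)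
  then show ?thesis using assms by (simp add: indep_vars_def2 cong: indep_sets_cong)
qed

context weighted_random_graph
begin

abbreviation K :: "nat set set" where "K \<equiv> complete_edges n"

text \<open>
  All coordinates take values in the sample space itself, equipped with the \<open>\<sigma>\<close>-algebra generated
  by one edge state, weight or mark; this puts random variables of different types into one product.
\<close>

fun coord_algebra :: "coord \<Rightarrow> 'a measure" where
  "coord_algebra (State h) = vimage_algebra (space M) (Z h) (count_space UNIV)"
| "coord_algebra (Weight h) = vimage_algebra (space M) (W h) borel"
| "coord_algebra (Mark u) = vimage_algebra (space M) (X u) mk"

lemma space_coord_algebra [simp]: "space (coord_algebra j) = space M"
  by (cases j) auto

lemma Z_measurable: "h \<in> K \<Longrightarrow> Z h \<in> measurable M (count_space UNIV)"
  using Z_indep by (auto simp: indep_vars_def)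

lemma W_measurable: "h \<in> K \<Longrightarrow> W h \<in> borel_measurable M"
  using W_indep by (auto simp: indep_vars_def)

lemma X_measurable: "u \<in> {1..n} \<Longrightarrow> X u \<in> measurable M mk"
  using X_indep by (auto simp: indep_vars_def)

lemma K_nonempty: "n \<ge> 2 \<Longrightarrow> K \<noteq> {}"
proof -
  assume "n \<ge> 2"
  then have "{1, 2} \<in> K" unfolding complete_edges_def by force
  then show "K \<noteq> {}" by blast
qed

lemma coord_algebra_subset: "j \<in> coords n \<Longrightarrow> sets (coord_algebra j) \<subseteq> events"
proof -
  have *: "sets (vimage_algebra (space M) f N) \<subseteq> events" if "f \<in> measurable M N" for f and N :: "'z measure"
    using that by (subst sets_vimage_algebra2) (auto dest: measurable_space measurable_sets)
  show "j \<in> coords n \<Longrightarrow> sets (coord_algebra j) \<subseteq> events"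
    by (cases j) (auto simp del: coords_iff(3) intro!: * Z_measurable W_measurable X_measurable simp: coords_iff)
qed

text \<open>The probability of an intersection over all coordinates first splits into three factors,
  one per family, by \<open>families_indep\<close>; each factor then splits by the independence
  inside its family. The bound on \<open>n\<close> makes all index sets nonempty. The coordinate
  variables are identity maps because the \<sigma>-algebras already live on the sample
  space.\<close>

lemma indep_coords:
  assumes n: "n \<ge> 2"
  shows "indep_vars coord_algebra (\<lambda>_ \<omega>. \<omega>) (coords n)"
proof -
  let ?s = "\<lambda>j. sets (coord_algebra j)"
  have "indep_sets ?s (coords n)"
  proof (subst indep_sets_finite)
    show "coords n \<noteq> {}" using K_nonempty[OF n] by (auto simp: coords_def)
    show "space M \<in> ?s j" for j using sets.top[of "coord_algebra j"] by simp
    show "\<forall>A\<in>Pi (coords n) ?s. prob (\<Inter>j\<in>coords n. A j) = (\<Prod>j\<in>coords n. prob (A j))"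
    proof
      fix A assume A: "A \<in> Pi (coords n) ?s"
      let ?I = "{1..n}"
      \<comment> \<open>One event per family: the intersection of the given events over the
        coordinates of that family.\<close>
      define B where "B s = (case s of Edge_states \<Rightarrow> \<Inter>h\<in>K. A (State h) | Weights \<Rightarrow> \<Inter>h\<in>K. A (Weight h)
        | Marks \<Rightarrow> \<Inter>u\<in>?I. A (Mark u))" for s
      have AS: "A (State h) \<in> ?s (State h)" "A (Weight h) \<in> ?s (Weight h)" if "h \<in> K" for h
        using Pi_mem[OF A, of "State h"] Pi_mem[OF A, of "Weight h"] that by simp_all
      have AM: "A (Mark u) \<in> ?s (Mark u)" if "u \<in> ?I" for u
        using Pi_mem[OF A, of "Mark u"] that by simp
      note ne = K_nonempty[OF n]
      have In: "?I \<noteq> {}" using n by auto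
      have UN: "(UNIV :: source set) = {Edge_states, Weights, Marks}"
        using source.exhaust by auto
      have "prob (\<Inter>s\<in>UNIV. B s) = (\<Prod>s\<in>UNIV. prob (B s))"
      proof (rule indep_setsD[OF families_indep])
        have "(\<Inter>h\<in>K. A (State h)) \<in> sets (vimage_algebra (space M) (\<lambda>\<omega>. \<lambda>h\<in>K. Z h \<omega>) (Pi\<^sub>M K (\<lambda>_. count_space UNIV)))"
          using ne AS by (intro sets.finite_INT sets_vimage_algebra_component Z_measurable) auto
        moreover have "(\<Inter>h\<in>K. A (Weight h)) \<in> sets (vimage_algebra (space M) (\<lambda>\<omega>. \<lambda>h\<in>K. W h \<omega>) (Pi\<^sub>M K (\<lambda>_. borel)))"
          using ne AS by (intro sets.finite_INT sets_vimage_algebra_component W_measurable) auto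
        moreover have "(\<Inter>u\<in>?I. A (Mark u)) \<in> sets (vimage_algebra (space M) (\<lambda>\<omega>. \<lambda>u\<in>?I. X u \<omega>) (Pi\<^sub>M ?I (\<lambda>_. mk)))"
          using In AM by (intro sets.finite_INT sets_vimage_algebra_component X_measurable) auto
        ultimately show "\<forall>j\<in>UNIV. B j \<in> (case j of
         Edge_states \<Rightarrow> sets (vimage_algebra (space M) (\<lambda>\<omega>. \<lambda>h\<in>complete_edges n. Z h \<omega>)
                          (Pi\<^sub>M (complete_edges n) (\<lambda>_. count_space UNIV)))
       | Weights \<Rightarrow> sets (vimage_algebra (space M) (\<lambda>\<omega>. \<lambda>h\<in>complete_edges n. W h \<omega>)
                          (Pi\<^sub>M (complete_edges n) (\<lambda>_. borel)))
       | Marks \<Rightarrow> sets (vimage_algebra (space M) (\<lambda>\<omega>. \<lambda>u\<in>{1..n}. X u \<omega>)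
                          (Pi\<^sub>M {1..n} (\<lambda>_. mk))))"
          by (auto simp: UN B_def)
      qed (auto simp: UN)
      also have "(\<Inter>s\<in>UNIV. B s) = (\<Inter>j\<in>coords n. A j)"
        by (simp add: UN B_def coords_def INT_Un)
      also have "(\<Prod>s\<in>UNIV. prob (B s)) = prob (\<Inter>h\<in>K. A (State h)) * (prob (\<Inter>h\<in>K. A (Weight h)) * prob (\<Inter>u\<in>?I. A (Mark u)))"
        by (simp add: UN B_def)
      also have "prob (\<Inter>h\<in>K. A (State h)) = (\<Prod>h\<in>K. prob (A (State h)))"
        using indep_sets_vimage_algebra[OF Z_indep] AS(1) ne by (intro indep_setsD) auto
      also have "prob (\<Inter>h\<in>K. A (Weight h)) = (\<Prod>h\<in>K. prob (A (Weight h)))"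
        using indep_sets_vimage_algebra[OF W_indep] AS(2) ne by (intro indep_setsD) auto
      also have "prob (\<Inter>u\<in>?I. A (Mark u)) = (\<Prod>u\<in>?I. prob (A (Mark u)))"
        using indep_sets_vimage_algebra[OF X_indep] AM In by (intro indep_setsD) auto
      finally show "prob (\<Inter>j\<in>coords n. A j) = (\<Prod>j\<in>coords n. prob (A j))"
        by (simp add: prod_coords)
    qed
  qed (use coord_algebra_subset in auto)
  moreover have "{(\<lambda>\<omega>. \<omega>) -` A \<inter> space M | A. A \<in> sets (coord_algebra j)} = ?s j" for j
    using sets.sets_into_space[of _ "coord_algebra j"] by (auto simp: Int_absorb2)
  moreover have "(\<lambda>\<omega>. \<omega>) \<in> measurable M (coord_algebra j)" if "j \<in> coords n" for j
    using coord_algebra_subset[OF that] sets.sets_into_space[of _ "coord_algebra j"]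
    by (intro measurableI) (auto simp: Int_absorb2)
  ultimately show ?thesis by (simp add: indep_vars_def2)
qed

lemma coord_maps:
  "Z h \<in> measurable (coord_algebra (State h)) (count_space UNIV)"
  "W h \<in> borel_measurable (coord_algebra (Weight h))"
  "u \<in> {1..n} \<Longrightarrow> X u \<in> measurable (coord_algebra (Mark u)) mk"
  using X_measurable[of u] by (auto intro!: measurable_vimage_algebra1 dest: measurable_space)

lemma edge_endpoints:
  assumes "h \<in> K"
  shows "Min h \<in> {1..n}" "Max h \<in> {1..n}" "Min h \<noteq> Max h" "h = {Min h, Max h}"
proof -
  obtain u v where h: "h = {u, v}" "u \<in> {1..n}" "v \<in> {1..n}" "u < v"
    using assms by (rule complete_edgesE)
  then have "Min h = u" "Max h = v" by (simp_all add: min_def max_def)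
  then show "Min h \<in> {1..n}" "Max h \<in> {1..n}" "Min h \<noteq> Max h" "h = {Min h, Max h}" using h by auto
qed

text \<open>Each weight and mark reads its own copy of the sample point. At a point with all
  coordinates equal to \<omega> this is \<open>edge_cost\<close> at \<omega>.\<close>

definition coord_cost :: "nat set \<Rightarrow> (coord \<Rightarrow> 'a) \<Rightarrow> real" where
  "coord_cost h x = r (X (Min h) (x (Mark (Min h)))) (X (Max h) (x (Mark (Max h)))) * W h (x (Weight h))"

definition coord_edge :: "nat set \<Rightarrow> (coord \<Rightarrow> 'a) \<Rightarrow> real" where
  "coord_edge h x = (if Z h (x (State h)) then coord_cost h x else 0)"

lemma component_measurable:
  assumes "j \<in> J" "f \<in> measurable (coord_algebra j) N"
  shows "(\<lambda>x. f (x j)) \<in> measurable (Pi\<^sub>M J coord_algebra) N"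
  using measurable_compose[OF measurable_component_singleton[OF assms(1), of coord_algebra] assms(2)] .

lemma coord_cost_measurable:
  assumes h: "h \<in> K" and J: "Weight h \<in> J" "Mark (Min h) \<in> J" "Mark (Max h) \<in> J"
  shows "coord_cost h \<in> borel_measurable (Pi\<^sub>M J coord_algebra)"
proof -
  have "(\<lambda>x. (X (Min h) (x (Mark (Min h))), X (Max h) (x (Mark (Max h))))) \<in>
      measurable (Pi\<^sub>M J coord_algebra) (mk \<Otimes>\<^sub>M mk)"
    using edge_endpoints[OF h] J by (intro measurable_Pair component_measurable coord_maps) auto
  from measurable_compose[OF this r_measurable]
  have "(\<lambda>x. r (X (Min h) (x (Mark (Min h)))) (X (Max h) (x (Mark (Max h))))) \<in>
      borel_measurable (Pi\<^sub>M J coord_algebra)" by simp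
  moreover have "(\<lambda>x. W h (x (Weight h))) \<in> borel_measurable (Pi\<^sub>M J coord_algebra)"
    using J by (intro component_measurable coord_maps)
  ultimately show ?thesis unfolding coord_cost_def by (rule borel_measurable_times)
qed

lemma coord_edge_measurable:
  assumes h: "h \<in> K"
  shows "coord_edge h \<in> borel_measurable (Pi\<^sub>M (coords n) coord_algebra)"
proof -
  have "(\<lambda>x. Z h (x (State h))) \<in> measurable (Pi\<^sub>M (coords n) coord_algebra) (count_space UNIV)"
    using h by (intro component_measurable coord_maps) auto
  then show ?thesis unfolding coord_edge_def using h edge_endpoints[OF h]
    by (intro measurable_If coord_cost_measurable) (auto simp: pred_def)
qed

lemma edge_cost_pos: "h \<in> K \<Longrightarrow> \<omega> \<in> space M \<Longrightarrow> 0 < edge_cost r X W h \<omega>"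
  unfolding edge_cost_def using edge_endpoints[of h]
  by (intro mult_pos_pos r_pos W_pos measurable_space[OF X_measurable]) auto

lemma edge_cost_measurable: "h \<in> K \<Longrightarrow> edge_cost r X W h \<in> borel_measurable M"
proof -
  assume h: "h \<in> K"
  have "(\<lambda>\<omega>. (X (Min h) \<omega>, X (Max h) \<omega>)) \<in> measurable M (mk \<Otimes>\<^sub>M mk)"
    using edge_endpoints[OF h] by (intro measurable_Pair X_measurable) auto
  from measurable_compose[OF this r_measurable] W_measurable[OF h]
  show ?thesis unfolding edge_cost_def by simp
qed

lemma random_edges_measurable:
  "random_edges n Z \<in> measurable M (count_space (Pow K))"
proof -
  have "random_edges n Z -` {E} \<inter> space M \<in> events" if "E \<in> Pow K" for E
  proof -
    have "random_edges n Z \<omega> = E \<longleftrightarrow> (\<forall>h\<in>K. Z h \<omega> \<longleftrightarrow> h \<in> E)" for \<omega>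
      using that unfolding random_edges_def set_eq_iff by blast
    then have "random_edges n Z -` {E} \<inter> space M = {\<omega> \<in> space M. \<forall>h\<in>K. Z h \<omega> \<longleftrightarrow> h \<in> E}"
      by (simp add: vimage_def Int_def conj_commute)
    also have "\<dots> \<in> events"
    proof (intro sets.sets_Collect_finite_All)
      fix h assume "h \<in> K"
      have "Z h -` {h \<in> E} \<inter> space M \<in> events" by (rule measurable_sets[OF Z_measurable[OF \<open>h \<in> K\<close>]]) simp
      moreover have "Z h -` {h \<in> E} \<inter> space M = {\<omega> \<in> space M. Z h \<omega> = (h \<in> E)}" by auto
      ultimately show "{\<omega> \<in> space M. Z h \<omega> = (h \<in> E)} \<in> events" by simp
    qed simp
    finally show ?thesis .
  qed
  then show ?thesis
    by (subst measurable_count_space_eq2) (auto simp: random_edges_def)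
qed

lemma random_edges_integrable:
  fixes \<phi> :: "nat set set \<Rightarrow> real"
  shows "integrable M (\<lambda>\<omega>. \<phi> (random_edges n Z \<omega>))"
proof (rule integrable_const_bound)
  show "AE \<omega> in M. norm (\<phi> (random_edges n Z \<omega>)) \<le> Max ((\<lambda>E. \<bar>\<phi> E\<bar>) ` Pow K)"
    by (intro AE_I2) (auto intro!: Max_ge simp: random_edges_def)
  show "(\<lambda>\<omega>. \<phi> (random_edges n Z \<omega>)) \<in> borel_measurable M"
    by (rule measurable_compose[OF random_edges_measurable]) simp
qed

text \<open>The graph is a function of the state coordinates, and \<open>\<psi>\<close> sees only
  the disjoint block of weights and marks. \<open>\<phi>\<close> is an arbitrary functional of the
  graph so that it can stand for the presence of one or two edges as well as for
  disconnection.\<close>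

lemma random_edges_indep_costs:
  fixes \<phi> :: "nat set set \<Rightarrow> real"
  assumes n: "n \<ge> 2"
  defines "J \<equiv> Weight ` K \<union> Mark ` {1..n}"
  assumes \<psi>: "\<psi> \<in> borel_measurable (Pi\<^sub>M J coord_algebra)"
    and int: "integrable M (\<lambda>\<omega>. \<psi> (\<lambda>j\<in>J. \<omega>) :: real)"
  shows "integrable M (\<lambda>\<omega>. \<phi> (random_edges n Z \<omega>) * \<psi> (\<lambda>j\<in>J. \<omega>))"
    and "expectation (\<lambda>\<omega>. \<phi> (random_edges n Z \<omega>) * \<psi> (\<lambda>j\<in>J. \<omega>)) =
      expectation (\<lambda>\<omega>. \<phi> (random_edges n Z \<omega>)) * expectation (\<lambda>\<omega>. \<psi> (\<lambda>j\<in>J. \<omega>))"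
proof -
  let ?S = "State ` K"
  have sub: "?S \<subseteq> coords n" "J \<subseteq> coords n" "?S \<inter> J = {}" by (auto simp: coords_def J_def)
  define E where "E x = {h \<in> K. Z h (x (State h))}" for x
  have E: "E \<in> measurable (Pi\<^sub>M ?S coord_algebra) (count_space (Pow K))"
  proof -
    have "E -` {A} \<inter> space (Pi\<^sub>M ?S coord_algebra) \<in> sets (Pi\<^sub>M ?S coord_algebra)" if "A \<in> Pow K" for A
    proof -
      have "E x = A \<longleftrightarrow> (\<forall>h\<in>K. Z h (x (State h)) \<longleftrightarrow> h \<in> A)" for x
        using that unfolding E_def set_eq_iff by blast
      then have "E -` {A} \<inter> space (Pi\<^sub>M ?S coord_algebra) =
          {x \<in> space (Pi\<^sub>M ?S coord_algebra). \<forall>h\<in>K. Z h (x (State h)) \<longleftrightarrow> h \<in> A}"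
        by (simp add: vimage_def Int_def conj_commute)
      also have "\<dots> \<in> sets (Pi\<^sub>M ?S coord_algebra)"
      proof (intro sets.sets_Collect_finite_All)
        fix h assume "h \<in> K"
        then have "(\<lambda>x. Z h (x (State h))) \<in> measurable (Pi\<^sub>M ?S coord_algebra) (count_space UNIV)"
          by (intro component_measurable coord_maps) auto
        then have "(\<lambda>x. Z h (x (State h))) -` {h \<in> A} \<inter> space (Pi\<^sub>M ?S coord_algebra) \<in> sets (Pi\<^sub>M ?S coord_algebra)"
          by (rule measurable_sets) simp
        moreover have "(\<lambda>x. Z h (x (State h))) -` {h \<in> A} \<inter> space (Pi\<^sub>M ?S coord_algebra) =
            {x \<in> space (Pi\<^sub>M ?S coord_algebra). Z h (x (State h)) = (h \<in> A)}" by auto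
        ultimately show "{x \<in> space (Pi\<^sub>M ?S coord_algebra). Z h (x (State h)) = (h \<in> A)} \<in> sets (Pi\<^sub>M ?S coord_algebra)"
          by simp
      qed simp
      finally show ?thesis .
    qed
    then show ?thesis
      by (subst measurable_count_space_eq2) (auto simp: E_def)
  qed
  have E': "E (\<lambda>j\<in>?S. \<omega>) = random_edges n Z \<omega>" for \<omega>
    unfolding E_def random_edges_def by (rule Collect_cong) auto
  have i: "indep_var (Pi\<^sub>M ?S coord_algebra) (\<lambda>\<omega>. \<lambda>j\<in>?S. \<omega>) (Pi\<^sub>M J coord_algebra) (\<lambda>\<omega>. \<lambda>j\<in>J. \<omega>)"
    using indep_var_restrict[OF indep_coords[OF n] sub(3,1,2)] .
  have \<phi>: "(\<lambda>x. \<phi> (E x)) \<in> borel_measurable (Pi\<^sub>M ?S coord_algebra)"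
    by (rule measurable_compose[OF E]) simp
  have ind: "indep_var borel (\<lambda>\<omega>. \<phi> (random_edges n Z \<omega>)) borel (\<lambda>\<omega>. \<psi> (\<lambda>j\<in>J. \<omega>))"
    using indep_var_compose[OF i \<phi> \<psi>] by (simp only: comp_def E')
  note i\<phi> = random_edges_integrable[of \<phi>]
  show "integrable M (\<lambda>\<omega>. \<phi> (random_edges n Z \<omega>) * \<psi> (\<lambda>j\<in>J. \<omega>))"
    by (rule indep_var_integrable[OF ind i\<phi> int])
  show "expectation (\<lambda>\<omega>. \<phi> (random_edges n Z \<omega>) * \<psi> (\<lambda>j\<in>J. \<omega>)) =
      expectation (\<lambda>\<omega>. \<phi> (random_edges n Z \<omega>)) * expectation (\<lambda>\<omega>. \<psi> (\<lambda>j\<in>J. \<omega>))"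
    by (rule indep_var_lebesgue_integral[OF ind i\<phi> int])
qed

end

section \<open>Moments of the maximum forest cost\<close>

lemma max_forest_cost_cong:
  assumes "\<And>h. h \<in> complete_edges n \<Longrightarrow> z h = z' h"
  shows "max_forest_cost n z = max_forest_cost n z'"
  using assms by (intro antisym max_forest_cost_mono) auto

lemma max_forest_cost_measurable:
  assumes "\<And>h. h \<in> complete_edges n \<Longrightarrow> (\<lambda>x. z x h) \<in> borel_measurable N"
  shows "(\<lambda>x. max_forest_cost n (z x)) \<in> borel_measurable N"
  unfolding max_forest_cost_def using assms
  by (intro borel_measurable_Max borel_measurable_sum) (auto simp: forests_def)

lemma card_complete_edges_le: "card (complete_edges n) \<le> n\<^sup>2"
proof -
  have "complete_edges n \<subseteq> (\<lambda>(u, v). {u, v}) ` ({1..n} \<times> {1..n})"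
    by (auto simp: complete_edges_def)
  then have "card (complete_edges n) \<le> card ({1..n} \<times> {1..n})"
    by (meson card_image_le card_mono finite_SigmaI finite_atLeastAtMost finite_imageI le_trans)
  then show ?thesis by (simp add: power2_eq_square)
qed

section \<open>Edge states, degrees and costs above the truncation level\<close>

context weighted_random_graph
begin

text \<open>Above \<open>L\<close> the whole cost is kept rather than the overshoot. A nonzero
  excess is thus larger than \<open>L\<close> and at most its square divided by \<open>L\<close>, so
  second moments also control first moments.\<close>

definition excess :: "real \<Rightarrow> nat set \<Rightarrow> 'a \<Rightarrow> real" where
  "excess L h \<omega> = (if edge_cost r X W h \<omega> > L then edge_cost r X W h \<omega> else 0)"

definition edge_value :: "'a \<Rightarrow> nat set \<Rightarrow> real" where
  "edge_value \<omega> h = (if Z h \<omega> then edge_cost r X W h \<omega> else 0)"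

definition forest_cost :: "'a \<Rightarrow> real" where
  "forest_cost \<omega> = max_forest_cost n (edge_value \<omega>)"

lemma excess_measurable: "h \<in> K \<Longrightarrow> excess L h \<in> borel_measurable M"
  using edge_cost_measurable[of h] unfolding excess_def by measurable

lemma excess_nonneg: "h \<in> K \<Longrightarrow> \<omega> \<in> space M \<Longrightarrow> 0 \<le> excess L h \<omega>"
  using edge_cost_pos[of h \<omega>] by (simp add: excess_def)

lemma edge_value_nonneg: "h \<in> K \<Longrightarrow> \<omega> \<in> space M \<Longrightarrow> 0 \<le> edge_value \<omega> h"
  using edge_cost_pos[of h \<omega>] by (simp add: edge_value_def)

lemma edge_value_le: "h \<in> K \<Longrightarrow> \<omega> \<in> space M \<Longrightarrow> 0 \<le> L \<Longrightarrow>
  edge_value \<omega> h \<le> L * of_bool (Z h \<omega>) + of_bool (Z h \<omega>) * excess L h \<omega>"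
  using edge_cost_pos[of h \<omega>] by (simp add: edge_value_def excess_def)

lemma edge_value_measurable: "h \<in> K \<Longrightarrow> (\<lambda>\<omega>. edge_value \<omega> h) \<in> borel_measurable M"
  unfolding edge_value_def using edge_cost_measurable[of h] Z_measurable[of h]
  by (intro measurable_If) (auto simp: pred_def)

lemma forest_cost_measurable: "forest_cost \<in> borel_measurable M"
  unfolding forest_cost_def by (intro max_forest_cost_measurable edge_value_measurable)

lemma expectation_prod_states:
  fixes f :: "nat set \<Rightarrow> bool \<Rightarrow> real"
  assumes "A \<subseteq> K"
  shows "expectation (\<lambda>\<omega>. \<Prod>h\<in>A. f h (Z h \<omega>)) = (\<Prod>h\<in>A. expectation (\<lambda>\<omega>. f h (Z h \<omega>)))"
proof (rule indep_vars_lebesgue_integral)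
  show "finite A" using finite_subset[OF assms] by simp
  have "indep_vars (\<lambda>_. borel) (\<lambda>h \<omega>. f h (Z h \<omega>)) K"
    by (rule indep_vars_compose2[OF Z_indep]) simp
  then show "indep_vars (\<lambda>_. borel) (\<lambda>h \<omega>. f h (Z h \<omega>)) A"
    using assms by (rule indep_vars_subset)
  fix h assume "h \<in> A"
  show "integrable M (\<lambda>\<omega>. f h (Z h \<omega>))"
  proof (rule integrable_const_bound)
    show "AE \<omega> in M. norm (f h (Z h \<omega>)) \<le> \<bar>f h True\<bar> + \<bar>f h False\<bar>"
      by (rule AE_I2) (rule bool.induct[of "\<lambda>b. norm (f h b) \<le> \<bar>f h True\<bar> + \<bar>f h False\<bar>"]; simp)
    show "(\<lambda>\<omega>. f h (Z h \<omega>)) \<in> borel_measurable M"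
      using Z_measurable[of h] assms \<open>h \<in> A\<close> by (intro measurable_compose[OF Z_measurable]) auto
  qed
qed

lemma state_in_random_edges: "h \<in> K \<Longrightarrow> Z h \<omega> \<longleftrightarrow> h \<in> random_edges n Z \<omega>"
  by (simp add: random_edges_def)

lemma expectation_state:
  assumes "h \<in> K"
  shows "expectation (\<lambda>\<omega>. of_bool (Z h \<omega>)) = q h"
proof -
  have "expectation (\<lambda>\<omega>. of_bool (Z h \<omega>)) = expectation (indicat_real {\<omega> \<in> space M. Z h \<omega>})"
    by (intro Bochner_Integration.integral_cong) (auto simp: indicator_def)
  also have "\<dots> = prob {\<omega> \<in> space M. Z h \<omega>}"
    by (simp add: Int_absorb2)
  finally show ?thesis using Z_bernoulli[OF assms] by simp
qed

lemma state_products: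
  fixes f g :: "bool \<Rightarrow> real"
  assumes "h \<in> K" "h' \<in> K" "h \<noteq> h'"
  shows "expectation (\<lambda>\<omega>. f (Z h \<omega>) * g (Z h' \<omega>)) =
    expectation (\<lambda>\<omega>. f (Z h \<omega>)) * expectation (\<lambda>\<omega>. g (Z h' \<omega>))"
  using expectation_prod_states[of "{h, h'}" "\<lambda>k. if k = h then f else g"] assms by simp

lemma states_integrable:
  fixes f g :: "bool \<Rightarrow> real"
  assumes "h \<in> K" "h' \<in> K"
  shows "integrable M (\<lambda>\<omega>. f (Z h \<omega>) * g (Z h' \<omega>))"
  using random_edges_integrable[of "\<lambda>E. f (h \<in> E) * g (h' \<in> E)"] assms
  by (simp add: state_in_random_edges[symmetric])

lemma q_bounds: "h \<in> K \<Longrightarrow> 0 \<le> q h \<and> q h \<le> 1"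
  using edge_prob[of h] by simp

text \<open>Distinct edge states are uncorrelated, so only the Bernoulli variances q(1 - q) \<le> q
  remain.\<close>

lemma degree_variance_le:
  assumes A: "A \<subseteq> K"
  shows "integrable M (\<lambda>\<omega>. ((\<Sum>h\<in>A. of_bool (Z h \<omega>)) - (\<Sum>h\<in>A. q h))\<^sup>2 :: real)"
    and "expectation (\<lambda>\<omega>. ((\<Sum>h\<in>A. of_bool (Z h \<omega>)) - (\<Sum>h\<in>A. q h))\<^sup>2) \<le> (\<Sum>h\<in>A. q h)"
proof -
  have fin: "finite A" using finite_subset[OF A] by simp
  define y where "y h b = of_bool b - q h" for h b
  have e: "((\<Sum>h\<in>A. of_bool (Z h \<omega>)) - (\<Sum>h\<in>A. q h))\<^sup>2 = (\<Sum>h\<in>A. \<Sum>h'\<in>A. y h (Z h \<omega>) * y h' (Z h' \<omega>))" for \<omega>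
    by (simp add: y_def sum_subtractf[symmetric] power2_eq_square sum_product)
  have int: "integrable M (\<lambda>\<omega>. y h (Z h \<omega>) * y h' (Z h' \<omega>))" if "h \<in> A" "h' \<in> A" for h h'
    using that A by (intro states_integrable) auto
  show "integrable M (\<lambda>\<omega>. ((\<Sum>h\<in>A. of_bool (Z h \<omega>)) - (\<Sum>h\<in>A. q h))\<^sup>2 :: real)"
    unfolding e by (intro Bochner_Integration.integrable_sum int)
  have yE: "expectation (\<lambda>\<omega>. y h (Z h \<omega>)) = 0" if "h \<in> A" for h
  proof -
    have h: "h \<in> K" using that A by blast
    have "integrable M (\<lambda>\<omega>. of_bool (Z h \<omega>) :: real)"
      using states_integrable[OF h h, of of_bool "\<lambda>_. 1"] by simp
    then show ?thesis using expectation_state[OF h] by (simp add: y_def prob_space)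
  qed
  have yy: "expectation (\<lambda>\<omega>. y h (Z h \<omega>) * y h' (Z h' \<omega>)) \<le> (if h = h' then q h else 0)"
    if "h \<in> A" "h' \<in> A" for h h'
  proof (cases "h = h'")
    case True
    have h: "h \<in> K" using that A by blast
    have i: "integrable M (\<lambda>\<omega>. of_bool (Z h \<omega>) :: real)"
      using states_integrable[OF h h, of of_bool "\<lambda>_. 1"] by simp
    have "expectation (\<lambda>\<omega>. y h (Z h \<omega>) * y h (Z h \<omega>)) =
        expectation (\<lambda>\<omega>. (1 - 2 * q h) * of_bool (Z h \<omega>) + (q h)\<^sup>2)"
      by (intro Bochner_Integration.integral_cong) (auto simp: y_def power2_eq_square algebra_simps)
    also have "\<dots> = (1 - 2 * q h) * q h + (q h)\<^sup>2"
      using i expectation_state[OF h] by (simp add: prob_space)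
    also have "\<dots> \<le> q h" using zero_le_power2[of "q h"] by (simp add: power2_eq_square algebra_simps)
    finally show ?thesis using True by simp
  next
    case False
    then have "expectation (\<lambda>\<omega>. y h (Z h \<omega>) * y h' (Z h' \<omega>)) = 0"
      using state_products[of h h' "y h" "y h'"] that A yE by auto
    then show ?thesis using False by simp
  qed
  have "expectation (\<lambda>\<omega>. ((\<Sum>h\<in>A. of_bool (Z h \<omega>)) - (\<Sum>h\<in>A. q h))\<^sup>2) =
      (\<Sum>h\<in>A. \<Sum>h'\<in>A. expectation (\<lambda>\<omega>. y h (Z h \<omega>) * y h' (Z h' \<omega>)))"
    unfolding e by (subst Bochner_Integration.integral_sum; intro sum.cong refl Bochner_Integration.integral_sum Bochner_Integration.integrable_sum int)
  also have "\<dots> \<le> (\<Sum>h\<in>A. \<Sum>h'\<in>A. if h = h' then q h else 0)"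
    by (intro sum_mono yy)
  also have "\<dots> = (\<Sum>h\<in>A. q h)" using fin by simp
  finally show "expectation (\<lambda>\<omega>. ((\<Sum>h\<in>A. of_bool (Z h \<omega>)) - (\<Sum>h\<in>A. q h))\<^sup>2) \<le> (\<Sum>h\<in>A. q h)" .
qed

text \<open>The excesses of two edges with a common vertex are dependent through its mark. Only the
  factor that depends on the states splits off, and the joint moment is kept;
  \<open>excess_product\<close> bounds it by the inequality between arithmetic and geometric
  mean.\<close>

lemma states_indep_excess:
  fixes \<phi> :: "nat set set \<Rightarrow> real"
  assumes n: "n \<ge> 2" and h: "h \<in> K" "h' \<in> K"
    and int: "integrable M (\<lambda>\<omega>. excess L h \<omega> * excess L h' \<omega>)"
  shows "integrable M (\<lambda>\<omega>. \<phi> (random_edges n Z \<omega>) * (excess L h \<omega> * excess L h' \<omega>))"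
    and "expectation (\<lambda>\<omega>. \<phi> (random_edges n Z \<omega>) * (excess L h \<omega> * excess L h' \<omega>)) =
      expectation (\<lambda>\<omega>. \<phi> (random_edges n Z \<omega>)) * expectation (\<lambda>\<omega>. excess L h \<omega> * excess L h' \<omega>)"
proof -
  let ?J = "Weight ` K \<union> Mark ` {1..n}"
  define e where "e k x = (if coord_cost k x > L then coord_cost k x else 0)" for k x
  have J: "Weight k \<in> ?J" "Mark (Min k) \<in> ?J" "Mark (Max k) \<in> ?J" if "k \<in> K" for k
    using that edge_endpoints[OF that] by auto
  have "e k \<in> borel_measurable (Pi\<^sub>M ?J coord_algebra)" if "k \<in> K" for k
    using coord_cost_measurable[OF that J[OF that]] unfolding e_def by measurable
  then have m: "(\<lambda>x. e h x * e h' x) \<in> borel_measurable (Pi\<^sub>M ?J coord_algebra)"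
    using h by (intro borel_measurable_times) auto
  have ek: "e k (\<lambda>j\<in>?J. \<omega>) = excess L k \<omega>" if "k \<in> K" for k \<omega>
    using J[OF that] by (simp add: e_def excess_def coord_cost_def edge_cost_def del: Un_iff)
  show "integrable M (\<lambda>\<omega>. \<phi> (random_edges n Z \<omega>) * (excess L h \<omega> * excess L h' \<omega>))"
    "expectation (\<lambda>\<omega>. \<phi> (random_edges n Z \<omega>) * (excess L h \<omega> * excess L h' \<omega>)) =
      expectation (\<lambda>\<omega>. \<phi> (random_edges n Z \<omega>)) * expectation (\<lambda>\<omega>. excess L h \<omega> * excess L h' \<omega>)"
    by (fact random_edges_indep_costs[OF n m, of \<phi>, unfolded ek[OF h(1)] ek[OF h(2)], OF int])+
qed

end

text \<open>In the application \<open>L\<close> is a constant times H(np), \<open>\<beta>\<close> is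
  of order np and \<open>\<tau>\<close> of order L^2/(np), so that \<open>\<beta> * \<tau>\<close>
  is of order L^2.\<close>

locale truncated_random_graph = weighted_random_graph +
  fixes L \<tau> \<beta> :: real
  assumes n: "n \<ge> 2" and L: "0 < L"
    and excess_square_integrable: "h \<in> K \<Longrightarrow> integrable M (\<lambda>\<omega>. (excess L h \<omega>)\<^sup>2)"
    and excess_square_le: "h \<in> K \<Longrightarrow> expectation (\<lambda>\<omega>. (excess L h \<omega>)\<^sup>2) \<le> \<tau>"
    and expected_degree_le: "u \<in> {1..n} \<Longrightarrow> (\<Sum>h\<in>{h \<in> K. u \<in> h}. q h) \<le> \<beta>"
begin

lemma tau_nonneg: "0 \<le> \<tau>"
proof -
  obtain h where h: "h \<in> K" using K_nonempty[OF n] by blast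
  have "0 \<le> expectation (\<lambda>\<omega>. (excess L h \<omega>)\<^sup>2)" by (intro integral_nonneg_AE) auto
  then show ?thesis using excess_square_le[OF h] by (rule order.trans)
qed

lemma beta_nonneg: "0 \<le> \<beta>"
proof -
  have "0 \<le> (\<Sum>h\<in>{h \<in> K. 1 \<in> h}. q h)" using q_bounds by (intro sum_nonneg) auto
  then show ?thesis using expected_degree_le[of 1] n by simp
qed

lemma excess_product:
  assumes h: "h \<in> K" "h' \<in> K"
  shows "integrable M (\<lambda>\<omega>. excess L h \<omega> * excess L h' \<omega>)"
    and "0 \<le> expectation (\<lambda>\<omega>. excess L h \<omega> * excess L h' \<omega>)"
    and "expectation (\<lambda>\<omega>. excess L h \<omega> * excess L h' \<omega>) \<le> \<tau>"
proof -
  let ?b = "\<lambda>\<omega>. ((excess L h \<omega>)\<^sup>2 + (excess L h' \<omega>)\<^sup>2) / 2"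
  have b: "integrable M ?b" using excess_square_integrable[OF h(1)] excess_square_integrable[OF h(2)] by simp
  have le: "excess L h \<omega> * excess L h' \<omega> \<le> ?b \<omega>" for \<omega>
    using sum_squares_bound[of "excess L h \<omega>" "excess L h' \<omega>"] by simp
  have nn: "0 \<le> excess L h \<omega> * excess L h' \<omega>" if "\<omega> \<in> space M" for \<omega>
    using excess_nonneg h that by simp
  show i: "integrable M (\<lambda>\<omega>. excess L h \<omega> * excess L h' \<omega>)"
  proof (rule Bochner_Integration.integrable_bound[OF b])
    show "AE \<omega> in M. norm (excess L h \<omega> * excess L h' \<omega>) \<le> norm (?b \<omega>)"
    proof (rule AE_I2)
      fix \<omega> assume "\<omega> \<in> space M"
      then show "norm (excess L h \<omega> * excess L h' \<omega>) \<le> norm (?b \<omega>)"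
        using le[of \<omega>] nn[of \<omega>] unfolding real_norm_def by linarith
    qed
  qed (intro borel_measurable_times excess_measurable h)
  show "0 \<le> expectation (\<lambda>\<omega>. excess L h \<omega> * excess L h' \<omega>)"
    using nn by (intro integral_nonneg_AE AE_I2)
  have "expectation (\<lambda>\<omega>. excess L h \<omega> * excess L h' \<omega>) \<le> expectation ?b"
    by (intro integral_mono i b le)
  also have "\<dots> \<le> \<tau>"
    using excess_square_integrable h excess_square_le[OF h(1)] excess_square_le[OF h(2)] by simp
  finally show "expectation (\<lambda>\<omega>. excess L h \<omega> * excess L h' \<omega>) \<le> \<tau>" .
qed

text \<open>In the expanded square, the diagonal contributes at most \<open>\<tau> * m\<close>. Off
  the diagonal both edges are present with probability \<open>q h * q h'\<close>, which sums to at
  most \<open>m\<^sup>2\<close>.\<close>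

lemma present_excess_square:
  assumes A: "A \<subseteq> K"
  defines "m \<equiv> \<Sum>h\<in>A. q h"
  shows "integrable M (\<lambda>\<omega>. (\<Sum>h\<in>A. of_bool (Z h \<omega>) * excess L h \<omega>)\<^sup>2)"
    and "expectation (\<lambda>\<omega>. (\<Sum>h\<in>A. of_bool (Z h \<omega>) * excess L h \<omega>)\<^sup>2) \<le> \<tau> * (m + m\<^sup>2)"
proof -
  have fin: "finite A" using finite_subset[OF A] by simp
  let ?\<phi> = "\<lambda>h h' E. of_bool (h \<in> E) * of_bool (h' \<in> E) :: real"
  let ?t = "\<lambda>h h' \<omega>. ?\<phi> h h' (random_edges n Z \<omega>) * (excess L h \<omega> * excess L h' \<omega>)"
  have e: "(\<Sum>h\<in>A. of_bool (Z h \<omega>) * excess L h \<omega>)\<^sup>2 = (\<Sum>h\<in>A. \<Sum>h'\<in>A. ?t h h' \<omega>)" for \<omega>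
    unfolding power2_eq_square sum_product
    using A by (intro sum.cong refl) (auto simp: random_edges_def)
  have int: "integrable M (?t h h')" if "h \<in> A" "h' \<in> A" for h h'
    using that A by (intro states_indep_excess(1)[OF n] excess_product) auto
  show "integrable M (\<lambda>\<omega>. (\<Sum>h\<in>A. of_bool (Z h \<omega>) * excess L h \<omega>)\<^sup>2)"
    unfolding e by (intro Bochner_Integration.integrable_sum int)
  have le: "expectation (?t h h') \<le> \<tau> * ((if h = h' then q h else 0) + q h * q h')" if "h \<in> A" "h' \<in> A" for h h'
  proof -
    have h: "h \<in> K" "h' \<in> K" using that A by auto
    have "expectation (\<lambda>\<omega>. ?\<phi> h h' (random_edges n Z \<omega>)) = expectation (\<lambda>\<omega>. of_bool (Z h \<omega>) * of_bool (Z h' \<omega>))"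
      by (simp only: state_in_random_edges[OF h(1)] state_in_random_edges[OF h(2)])
    also have "\<dots> = (if h = h' then q h else q h * q h')"
    proof (cases "h = h'")
      case True
      then have "(\<lambda>\<omega>. of_bool (Z h \<omega>) * of_bool (Z h' \<omega>)) = (\<lambda>\<omega>. of_bool (Z h \<omega>) :: real)" by auto
      then show ?thesis using True expectation_state[OF h(1)] by simp
    next
      case False
      then show ?thesis using state_products[OF h False, of of_bool of_bool] by (simp add: expectation_state h)
    qed
    finally have \<phi>: "expectation (\<lambda>\<omega>. ?\<phi> h h' (random_edges n Z \<omega>)) = (if h = h' then q h else q h * q h')" .
    have "expectation (?t h h') = (if h = h' then q h else q h * q h') * expectation (\<lambda>\<omega>. excess L h \<omega> * excess L h' \<omega>)"
      using states_indep_excess(2)[OF n h excess_product(1)[OF h], of "?\<phi> h h'"] unfolding \<phi> .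
    also have "\<dots> \<le> (if h = h' then q h else q h * q h') * \<tau>"
      using q_bounds[OF h(1)] q_bounds[OF h(2)] excess_product(3)[OF h] by (intro mult_left_mono) auto
    \<comment> \<open>Adding the product on the diagonal too only enlarges the bound and lets the
      double sum factor.\<close>
    also have "\<dots> \<le> ((if h = h' then q h else 0) + q h * q h') * \<tau>"
      using q_bounds[OF h(1)] q_bounds[OF h(2)] tau_nonneg by (intro mult_right_mono) auto
    finally show ?thesis by (simp add: mult.commute)
  qed
  have "expectation (\<lambda>\<omega>. (\<Sum>h\<in>A. of_bool (Z h \<omega>) * excess L h \<omega>)\<^sup>2) = (\<Sum>h\<in>A. \<Sum>h'\<in>A. expectation (?t h h'))"
    unfolding e by (subst Bochner_Integration.integral_sum; intro sum.cong refl Bochner_Integration.integral_sum Bochner_Integration.integrable_sum int)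
  also have "\<dots> \<le> (\<Sum>h\<in>A. \<Sum>h'\<in>A. \<tau> * ((if h = h' then q h else 0) + q h * q h'))"
    by (intro sum_mono le)
  also have "\<dots> = \<tau> * (\<Sum>h\<in>A. \<Sum>h'\<in>A. (if h = h' then q h else 0) + q h * q h')"
    by (simp only: sum_distrib_left)
  also have "(\<Sum>h\<in>A. \<Sum>h'\<in>A. (if h = h' then q h else 0) + q h * q h') = m + m\<^sup>2"
    using fin by (simp add: sum.distrib m_def power2_eq_square sum_product)
  finally show "expectation (\<lambda>\<omega>. (\<Sum>h\<in>A. of_bool (Z h \<omega>) * excess L h \<omega>)\<^sup>2) \<le> \<tau> * (m + m\<^sup>2)" .
qed

lemma forest_cost_nonneg: "0 \<le> forest_cost \<omega>"
  unfolding forest_cost_def by (rule max_forest_cost_nonneg)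

lemma forest_cost_le_present:
  assumes \<omega>: "\<omega> \<in> space M"
  shows "forest_cost \<omega> \<le> n * L + (\<Sum>h\<in>K. of_bool (Z h \<omega>) * excess L h \<omega>)"
proof -
  obtain T where T: "T \<in> forests n" "forest_cost \<omega> = (\<Sum>h\<in>T. edge_value \<omega> h)"
    unfolding forest_cost_def by (rule max_forest_cost_attained)
  have TK: "T \<subseteq> K" using T by (simp add: forests_def)
  have "(\<Sum>h\<in>T. edge_value \<omega> h) \<le> (\<Sum>h\<in>T. L + of_bool (Z h \<omega>) * excess L h \<omega>)"
  proof (rule sum_mono)
    fix h assume "h \<in> T"
    then have "h \<in> K" using TK by blast
    have "L * of_bool (Z h \<omega>) \<le> L" using L by simp
    then show "edge_value \<omega> h \<le> L + of_bool (Z h \<omega>) * excess L h \<omega>"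
      using edge_value_le[OF \<open>h \<in> K\<close> \<omega>, of L] L by linarith
  qed
  also have "\<dots> = card T * L + (\<Sum>h\<in>T. of_bool (Z h \<omega>) * excess L h \<omega>)" by (simp add: sum.distrib)
  also have "\<dots> \<le> n * L + (\<Sum>h\<in>K. of_bool (Z h \<omega>) * excess L h \<omega>)"
    using card_forests_le[OF T(1)] L TK excess_nonneg[OF _ \<omega>]
    by (intro add_mono mult_right_mono sum_mono2) auto
  finally show ?thesis using T(2) by simp
qed

lemma forest_cost_le:
  assumes \<omega>: "\<omega> \<in> space M"
  shows "forest_cost \<omega> \<le> n * L + (\<Sum>h\<in>K. excess L h \<omega>)"
proof -
  have "(\<Sum>h\<in>K. of_bool (Z h \<omega>) * excess L h \<omega>) \<le> (\<Sum>h\<in>K. excess L h \<omega>)"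
    using excess_nonneg[OF _ \<omega>] by (intro sum_mono) auto
  then show ?thesis using forest_cost_le_present[OF \<omega>] by linarith
qed

text \<open>Cauchy-Schwarz over the at most n^2 edges. The bound is crude, but it serves for
  integrability and on the event of disconnection, whose small probability absorbs the loss.\<close>

lemma forest_cost_square_le:
  assumes \<omega>: "\<omega> \<in> space M"
  shows "(forest_cost \<omega>)\<^sup>2 \<le> 2 * n\<^sup>2 * L\<^sup>2 + 2 * n\<^sup>2 * (\<Sum>h\<in>K. (excess L h \<omega>)\<^sup>2)"
proof -
  let ?S = "\<Sum>h\<in>K. excess L h \<omega>"
  have "(forest_cost \<omega>)\<^sup>2 \<le> (n * L + ?S)\<^sup>2"
    using forest_cost_le[OF \<omega>] forest_cost_nonneg by (intro power_mono)
  also have "\<dots> \<le> 2 * (n * L)\<^sup>2 + 2 * ?S\<^sup>2"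
    using sum_squares_bound[of "n * L" ?S] by (simp add: power2_sum)
  also have "?S\<^sup>2 \<le> (\<Sum>h\<in>K. (excess L h \<omega>)\<^sup>2) * card K"
    by (rule sum_squared_le_sum_of_squares)
  also have "\<dots> \<le> (\<Sum>h\<in>K. (excess L h \<omega>)\<^sup>2) * real (n\<^sup>2)"
    using card_complete_edges_le[of n] by (intro mult_left_mono sum_nonneg) (auto simp del: of_nat_power)
  finally show ?thesis by (simp add: power_mult_distrib mult_ac)
qed

lemma forest_cost_square_integrable: "integrable M (\<lambda>\<omega>. (forest_cost \<omega>)\<^sup>2)"
proof (rule Bochner_Integration.integrable_bound)
  show "integrable M (\<lambda>\<omega>. 2 * n\<^sup>2 * L\<^sup>2 + 2 * n\<^sup>2 * (\<Sum>h\<in>K. (excess L h \<omega>)\<^sup>2))"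
    using excess_square_integrable by auto
  show "AE \<omega> in M. norm ((forest_cost \<omega>)\<^sup>2) \<le> norm (2 * n\<^sup>2 * L\<^sup>2 + 2 * n\<^sup>2 * (\<Sum>h\<in>K. (excess L h \<omega>)\<^sup>2))"
    using forest_cost_square_le by (intro AE_I2) (simp add: order.trans[OF _ abs_ge_self])
qed (use forest_cost_measurable in measurable)

lemma forest_cost_integrable: "integrable M forest_cost"
  by (rule square_integrable_imp_integrable[OF forest_cost_measurable forest_cost_square_integrable])

lemma sum_q_le: "(\<Sum>h\<in>K. q h) \<le> n * \<beta>"
proof -
  have "2 * (\<Sum>h\<in>K. q h) = (\<Sum>u\<in>{1..n}. \<Sum>h\<in>{h \<in> K. u \<in> h}. q h)"
    by (rule sum_over_endpoints[symmetric]) simp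
  also have "\<dots> \<le> (\<Sum>u\<in>{1..n}. \<beta>)" by (intro sum_mono expected_degree_le)
  finally have "2 * (\<Sum>h\<in>K. q h) \<le> n * \<beta>" by simp
  moreover have "0 \<le> (\<Sum>h\<in>K. q h)" using q_bounds by (intro sum_nonneg) auto
  ultimately show ?thesis by linarith
qed

end

text \<open>With \<open>x = exp (- \<alpha>)\<close> this sums the bounds for empty cuts over all
  vertex sets.\<close>

lemma sum_Pow_power_card:
  fixes x :: real
  assumes "finite A"
  shows "(\<Sum>S\<in>Pow A. x ^ card S) = (1 + x) ^ card A"
proof -
  have "(1 + x) ^ card A = (\<Prod>a\<in>A. x + 1)" by (simp add: add.commute)
  also have "\<dots> = (\<Sum>S\<in>Pow A. (\<Prod>a\<in>S. x) * (\<Prod>a\<in>A - S. 1))"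
    by (rule prod_add[OF assms])
  finally show ?thesis by simp
qed

section \<open>Mean and variance of the maximum forest cost\<close>

context truncated_random_graph
begin

lemma expectation_forest_cost_le: "expectation forest_cost \<le> n * L + n * \<beta> * \<tau> / L"
proof -
  define b where "b h \<omega> = of_bool (Z h \<omega>) * (excess L h \<omega> * excess L h \<omega>)" for h \<omega>
  have int: "integrable M (b h)" and E: "expectation (b h) \<le> q h * \<tau>" if h: "h \<in> K" for h
  proof -
    note i = states_indep_excess[OF n h h excess_product(1)[OF h h], of "\<lambda>E. of_bool (h \<in> E)",
        unfolded state_in_random_edges[OF h, symmetric] expectation_state[OF h]]
    show "integrable M (b h)" unfolding b_def by (rule i(1))
    show "expectation (b h) \<le> q h * \<tau>"
      unfolding b_def i(2) using q_bounds[OF h] excess_product(3)[OF h h] by (intro mult_left_mono) auto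
  qed
  have "expectation forest_cost \<le> expectation (\<lambda>\<omega>. n * L + (\<Sum>h\<in>K. b h \<omega>) / L)"
  proof (rule integral_mono)
    show "integrable M (\<lambda>\<omega>. n * L + (\<Sum>h\<in>K. b h \<omega>) / L)" using int by auto
    fix \<omega> assume \<omega>: "\<omega> \<in> space M"
    have "of_bool (Z h \<omega>) * excess L h \<omega> \<le> b h \<omega> / L" for h
      using L by (auto simp: b_def excess_def field_simps)
    then have "(\<Sum>h\<in>K. of_bool (Z h \<omega>) * excess L h \<omega>) \<le> (\<Sum>h\<in>K. b h \<omega>) / L"
      unfolding sum_divide_distrib by (intro sum_mono)
    then show "forest_cost \<omega> \<le> n * L + (\<Sum>h\<in>K. b h \<omega>) / L"
      using forest_cost_le_present[OF \<omega>] by linarith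
  qed (rule forest_cost_integrable)
  also have "\<dots> = n * L + (\<Sum>h\<in>K. expectation (b h)) / L"
    using int by (simp add: prob_space)
  also have "\<dots> \<le> n * L + (\<Sum>h\<in>K. q h * \<tau>) / L"
    using L by (intro add_left_mono divide_right_mono sum_mono E) auto
  also have "(\<Sum>h\<in>K. q h * \<tau>) = (\<Sum>h\<in>K. q h) * \<tau>" by (simp add: sum_distrib_right)
  also have "n * L + (\<Sum>h\<in>K. q h) * \<tau> / L \<le> n * L + n * \<beta> * \<tau> / L"
    using L sum_q_le tau_nonneg by (intro add_left_mono divide_right_mono mult_right_mono) auto
  finally show ?thesis .
qed

text \<open>An edge reads only the marks at its two ends. Hence zeroing the affected edges gives a
  function that ignores the coordinate, as the Efron-Stein inequality demands of its
  competitors.\<close>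

lemma coord_edge_unaffected:
  assumes "h \<in> K" "\<not> affects i h"
  shows "coord_edge h (x(i := y)) = coord_edge h x"
proof (cases i)
  case (Mark u)
  have "finite h" "h \<noteq> {}" using complete_edgesE[OF assms(1)] by auto
  then have "Min h \<in> h" "Max h \<in> h" by simp_all
  then have "u \<noteq> Min h" "u \<noteq> Max h" using assms(2) Mark by auto
  then show ?thesis using Mark by (simp add: coord_edge_def coord_cost_def)
qed (use assms in \<open>auto simp: coord_edge_def coord_cost_def\<close>)

text \<open>Half of the first term comes from the linear part of the degree bound and half from the
  variances of the degrees, each at most \<open>\<beta>\<close>. The second term collects the
  squared excess sums over stars.\<close>

lemma variance_forest_cost_le:
  "variance forest_cost \<le> 32 * \<beta> * n * L\<^sup>2 + 4 * n * \<tau> * (\<beta> + \<beta>\<^sup>2)"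
proof -
  let ?J = "coords n"
  let ?d = "\<lambda>\<omega>. \<lambda>j\<in>?J. \<omega>"
  define g where "g x = max_forest_cost n (\<lambda>h. coord_edge h x)" for x
  define g' where "g' j x = max_forest_cost n (\<lambda>h. if affects j h then 0 else coord_edge h x)" for j x
  define f' where "f' j \<omega> = max_forest_cost n (\<lambda>h. if affects j h then 0 else edge_value \<omega> h)" for j \<omega>
  have ev: "coord_edge h (?d \<omega>) = edge_value \<omega> h" if "h \<in> K" for h \<omega>
    using edge_endpoints[OF that] that
    by (simp add: coord_edge_def coord_cost_def edge_value_def edge_cost_def)
  have g: "g (?d \<omega>) = forest_cost \<omega>" for \<omega>
    unfolding g_def forest_cost_def by (intro max_forest_cost_cong ev)
  have g': "g' j (?d \<omega>) = f' j \<omega>" for j \<omega>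
    unfolding g'_def f'_def by (intro max_forest_cost_cong) (simp add: ev)
  have f'm: "f' j \<in> borel_measurable M" for j
    unfolding f'_def using edge_value_measurable by (intro max_forest_cost_measurable) auto
  have f'_nonneg: "0 \<le> f' j \<omega>" for j \<omega> unfolding f'_def by (rule max_forest_cost_nonneg)
  have f'_le: "f' j \<omega> \<le> forest_cost \<omega>" if "\<omega> \<in> space M" for j \<omega>
    unfolding f'_def forest_cost_def using edge_value_nonneg that by (intro max_forest_cost_mono) auto
  have f'2: "integrable M (\<lambda>\<omega>. (f' j \<omega>)\<^sup>2)" for j
  proof (rule Bochner_Integration.integrable_bound[OF forest_cost_square_integrable])
    show "AE \<omega> in M. norm ((f' j \<omega>)\<^sup>2) \<le> norm ((forest_cost \<omega>)\<^sup>2)"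
      using f'_le f'_nonneg by (intro AE_I2) (auto intro!: power_mono)
  qed (use f'm in measurable)
  have d2: "integrable M (\<lambda>\<omega>. (forest_cost \<omega> - f' j \<omega>)\<^sup>2)" for j
  proof (rule Bochner_Integration.integrable_bound[OF forest_cost_square_integrable])
    show "AE \<omega> in M. norm ((forest_cost \<omega> - f' j \<omega>)\<^sup>2) \<le> norm ((forest_cost \<omega>)\<^sup>2)"
      using f'_le f'_nonneg by (intro AE_I2) (auto intro!: power_mono)
  qed (use f'm forest_cost_measurable in measurable)
  have "variance (\<lambda>\<omega>. g (?d \<omega>)) \<le> (\<Sum>j\<in>?J. expectation (\<lambda>\<omega>. (g (?d \<omega>) - g' j (?d \<omega>))\<^sup>2))"
  proof (rule efron_stein_indep_vars[OF finite_coords indep_coords[OF n]])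
    show "g \<in> borel_measurable (Pi\<^sub>M ?J coord_algebra)"
      unfolding g_def by (intro max_forest_cost_measurable coord_edge_measurable)
    show "integrable M (\<lambda>\<omega>. (g (?d \<omega>))\<^sup>2)"
      unfolding g by (rule forest_cost_square_integrable)
    fix j
    show "integrable M (\<lambda>\<omega>. (g' j (?d \<omega>))\<^sup>2)" unfolding g' by (rule f'2)
    show "g' j \<in> borel_measurable (Pi\<^sub>M ?J coord_algebra)"
      unfolding g'_def
    proof (intro max_forest_cost_measurable)
      fix h assume "h \<in> K"
      then show "(\<lambda>x. if affects j h then 0 else coord_edge h x) \<in> borel_measurable (Pi\<^sub>M ?J coord_algebra)"
        using coord_edge_measurable by (cases "affects j h") auto
    qed
    fix x y
    show "g' j (x(j := y)) = g' j x"
      unfolding g'_def by (intro max_forest_cost_cong) (simp add: coord_edge_unaffected)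
  qed
  then have "variance forest_cost \<le> (\<Sum>j\<in>?J. expectation (\<lambda>\<omega>. (forest_cost \<omega> - f' j \<omega>)\<^sup>2))"
    unfolding g g' .
  \<comment> \<open>The sum goes inside the expectation because the optimal forest varies with
    \<omega>, and for fixed \<omega> only the total influence is bounded.\<close>
  also have "\<dots> = expectation (\<lambda>\<omega>. \<Sum>j\<in>?J. (forest_cost \<omega> - f' j \<omega>)\<^sup>2)"
    using d2 by (intro Bochner_Integration.integral_sum[symmetric])
  finally have 1: "variance forest_cost \<le> expectation (\<lambda>\<omega>. \<Sum>j\<in>?J. (forest_cost \<omega> - f' j \<omega>)\<^sup>2)" .
  define N where "N u = {h \<in> K. u \<in> h}" for u
  define m where "m u = (\<Sum>h\<in>N u. q h)" for u
  have NK: "N u \<subseteq> K" for u by (auto simp: N_def)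
  have m: "0 \<le> m u \<and> m u \<le> \<beta>" if "u \<in> {1..n}" for u
    using expected_degree_le[OF that] q_bounds unfolding m_def N_def by (auto intro: sum_nonneg)
  let ?A = "\<lambda>u \<omega>. ((\<Sum>h\<in>N u. of_bool (Z h \<omega>)) - m u)\<^sup>2"
  let ?B = "\<lambda>u \<omega>. (\<Sum>h\<in>N u. of_bool (Z h \<omega>) * excess L h \<omega>)\<^sup>2"
  have A: "integrable M (?A u)" "expectation (?A u) \<le> m u" for u
    using degree_variance_le[OF NK[of u]] unfolding m_def by auto
  have B: "integrable M (?B u)" "expectation (?B u) \<le> \<tau> * (m u + (m u)\<^sup>2)" for u
    using present_excess_square[OF NK[of u]] unfolding m_def by auto
  have "expectation (\<lambda>\<omega>. \<Sum>j\<in>?J. (forest_cost \<omega> - f' j \<omega>)\<^sup>2) \<le>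
      expectation (\<lambda>\<omega>. 16 * \<beta> * n * L\<^sup>2 + 16 * L\<^sup>2 * (\<Sum>u\<in>{1..n}. ?A u \<omega>) + 4 * (\<Sum>u\<in>{1..n}. ?B u \<omega>))"
  proof (rule integral_mono)
    show "integrable M (\<lambda>\<omega>. \<Sum>j\<in>?J. (forest_cost \<omega> - f' j \<omega>)\<^sup>2)" using d2 by auto
    show "integrable M (\<lambda>\<omega>. 16 * \<beta> * n * L\<^sup>2 + 16 * L\<^sup>2 * (\<Sum>u\<in>{1..n}. ?A u \<omega>) + 4 * (\<Sum>u\<in>{1..n}. ?B u \<omega>))"
      using A(1) B(1) by auto
    fix \<omega> assume \<omega>: "\<omega> \<in> space M"
    show "(\<Sum>j\<in>?J. (forest_cost \<omega> - f' j \<omega>)\<^sup>2) \<le>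
        16 * \<beta> * n * L\<^sup>2 + 16 * L\<^sup>2 * (\<Sum>u\<in>{1..n}. ?A u \<omega>) + 4 * (\<Sum>u\<in>{1..n}. ?B u \<omega>)"
      unfolding forest_cost_def f'_def N_def
    proof (rule sum_square_influences_le)
      show "0 \<le> edge_value \<omega> h" if "h \<in> K" for h using edge_value_nonneg[OF that \<omega>] .
      show "0 \<le> of_bool (Z h \<omega>) * excess L h \<omega>" if "h \<in> K" for h using excess_nonneg[OF that \<omega>] by simp
      show "edge_value \<omega> h \<le> L * of_bool (Z h \<omega>) + of_bool (Z h \<omega>) * excess L h \<omega>" if "h \<in> K" for h
        using edge_value_le[OF that \<omega>] L by simp
    qed (use m L in auto)
  qed
  also have "\<dots> = 16 * \<beta> * n * L\<^sup>2 + 16 * L\<^sup>2 * (\<Sum>u\<in>{1..n}. expectation (?A u)) + 4 * (\<Sum>u\<in>{1..n}. expectation (?B u))"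
    using A(1) B(1) by (simp add: prob_space)
  also have "\<dots> \<le> 16 * \<beta> * n * L\<^sup>2 + 16 * L\<^sup>2 * (\<Sum>u\<in>{1..n}. \<beta>) + 4 * (\<Sum>u\<in>{1..n}. \<tau> * (\<beta> + \<beta>\<^sup>2))"
  proof (intro add_mono mult_left_mono sum_mono order.refl)
    fix u assume u: "u \<in> {1..n}"
    show "expectation (?A u) \<le> \<beta>" using A(2)[of u] m[OF u] by linarith
    have "\<tau> * (m u + (m u)\<^sup>2) \<le> \<tau> * (\<beta> + \<beta>\<^sup>2)"
      using m[OF u] tau_nonneg by (intro mult_left_mono add_mono power_mono) auto
    then show "expectation (?B u) \<le> \<tau> * (\<beta> + \<beta>\<^sup>2)" using B(2)[of u] by linarith
  qed (use beta_nonneg in auto)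
  finally show ?thesis using 1 by (simp add: algebra_simps)
qed

text \<open>The bound on the squared forest cost involves the excesses of all edges, present or not,
  so it is independent of the graph and the expectation of \<open>\<phi>\<close> factors out.
  Cauchy-Schwarz would ask for fourth moments instead, which the tail condition does not
  guarantee.\<close>

lemma forest_cost_square_on_states:
  fixes \<phi> :: "nat set set \<Rightarrow> real"
  assumes \<phi>: "\<And>E. 0 \<le> \<phi> E"
  shows "integrable M (\<lambda>\<omega>. \<phi> (random_edges n Z \<omega>) * (forest_cost \<omega>)\<^sup>2)"
    and "expectation (\<lambda>\<omega>. \<phi> (random_edges n Z \<omega>) * (forest_cost \<omega>)\<^sup>2) \<le>
      expectation (\<lambda>\<omega>. \<phi> (random_edges n Z \<omega>)) * (2 * n\<^sup>2 * L\<^sup>2 + 2 * n ^ 4 * \<tau>)"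
proof -
  let ?p = "\<lambda>\<omega>. \<phi> (random_edges n Z \<omega>)"
  let ?t = "\<lambda>h \<omega>. ?p \<omega> * (excess L h \<omega> * excess L h \<omega>)"
  let ?u = "\<lambda>\<omega>. 2 * n\<^sup>2 * L\<^sup>2 * ?p \<omega> + 2 * n\<^sup>2 * (\<Sum>h\<in>K. ?t h \<omega>)"
  have int: "integrable M (?t h)" and E: "expectation (?t h) \<le> expectation ?p * \<tau>" if h: "h \<in> K" for h
  proof -
    note i = states_indep_excess[OF n h h excess_product(1)[OF h h], of \<phi>]
    show "integrable M (?t h)" by (rule i(1))
    show "expectation (?t h) \<le> expectation ?p * \<tau>"
      unfolding i(2) using \<phi> excess_product(3)[OF h h] by (intro mult_left_mono integral_nonneg_AE AE_I2) auto
  qed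
  have p: "integrable M ?p" by (rule random_edges_integrable)
  have u: "integrable M ?u" using int p by auto
  have le: "?p \<omega> * (forest_cost \<omega>)\<^sup>2 \<le> ?u \<omega>" if "\<omega> \<in> space M" for \<omega>
  proof -
    have "?p \<omega> * (forest_cost \<omega>)\<^sup>2 \<le> ?p \<omega> * (2 * n\<^sup>2 * L\<^sup>2 + 2 * n\<^sup>2 * (\<Sum>h\<in>K. (excess L h \<omega>)\<^sup>2))"
      by (intro mult_left_mono forest_cost_square_le that \<phi>)
    also have "\<dots> = ?u \<omega>"
      by (simp add: algebra_simps sum_distrib_left power2_eq_square)
    finally show ?thesis .
  qed
  show i: "integrable M (\<lambda>\<omega>. ?p \<omega> * (forest_cost \<omega>)\<^sup>2)"
  proof (rule Bochner_Integration.integrable_bound[OF u])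
    show "AE \<omega> in M. norm (?p \<omega> * (forest_cost \<omega>)\<^sup>2) \<le> norm (?u \<omega>)"
    proof (rule AE_I2)
      fix \<omega> assume "\<omega> \<in> space M"
      moreover have "0 \<le> ?p \<omega> * (forest_cost \<omega>)\<^sup>2" using \<phi> by simp
      ultimately show "norm (?p \<omega> * (forest_cost \<omega>)\<^sup>2) \<le> norm (?u \<omega>)"
        using le[of \<omega>] unfolding real_norm_def by linarith
    qed
    show "(\<lambda>\<omega>. ?p \<omega> * (forest_cost \<omega>)\<^sup>2) \<in> borel_measurable M"
      using p forest_cost_measurable by measurable
  qed
  have "expectation (\<lambda>\<omega>. ?p \<omega> * (forest_cost \<omega>)\<^sup>2) \<le> expectation ?u"
    by (intro integral_mono i u le)
  also have "\<dots> = 2 * n\<^sup>2 * L\<^sup>2 * expectation ?p + 2 * n\<^sup>2 * (\<Sum>h\<in>K. expectation (?t h))"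
    using int p by simp
  also have "\<dots> \<le> 2 * n\<^sup>2 * L\<^sup>2 * expectation ?p + 2 * n\<^sup>2 * (\<Sum>h\<in>K. expectation ?p * \<tau>)"
    by (intro add_left_mono mult_left_mono sum_mono E) auto
  also have "\<dots> \<le> 2 * n\<^sup>2 * L\<^sup>2 * expectation ?p + 2 * n\<^sup>2 * (real (n\<^sup>2) * (expectation ?p * \<tau>))"
  proof (intro add_left_mono mult_left_mono)
    show "(\<Sum>h\<in>K. expectation ?p * \<tau>) \<le> real (n\<^sup>2) * (expectation ?p * \<tau>)"
      unfolding sum_constant using card_complete_edges_le[of n] \<phi> tau_nonneg
      by (intro mult_right_mono mult_nonneg_nonneg integral_nonneg_AE AE_I2) (auto simp del: of_nat_power)
  qed simp
  finally show "expectation (\<lambda>\<omega>. ?p \<omega> * (forest_cost \<omega>)\<^sup>2) \<le> expectation ?p * (2 * n\<^sup>2 * L\<^sup>2 + 2 * n ^ 4 * \<tau>)"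
    by (simp add: algebra_simps power4_eq_xxxx power2_eq_square)
qed

end

section \<open>Probability that the graph is disconnected\<close>

context weighted_random_graph
begin

text \<open>Edges across the cut are independent and absent with probability 1 - q \<le> exp(-q),
  and every vertex of \<open>S\<close> contributes at least \<open>\<alpha>\<close> to the
  exponent.\<close>

lemma prob_empty_cut_le:
  assumes S: "S \<subseteq> {1..n}"
    and deg: "\<And>u. u \<in> S \<Longrightarrow> \<alpha> \<le> (\<Sum>v\<in>{1..n} - S. q {u, v})"
  shows "{\<omega> \<in> space M. \<forall>u\<in>S. \<forall>v\<in>{1..n} - S. {u, v} \<notin> random_edges n Z \<omega>} \<in> events"
    and "prob {\<omega> \<in> space M. \<forall>u\<in>S. \<forall>v\<in>{1..n} - S. {u, v} \<notin> random_edges n Z \<omega>} \<le> exp (- \<alpha>) ^ card S"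
proof -
  let ?T = "{1..n} - S"
  let ?P = "\<lambda>\<omega>. \<forall>u\<in>S. \<forall>v\<in>?T. {u, v} \<notin> random_edges n Z \<omega>"
  define B where "B = (\<lambda>(u, v). {u, v}) ` (S \<times> ?T)"
  have mem: "{u, v} \<in> K" if "u \<in> S" "v \<in> ?T" for u v
    unfolding complete_edges_def mem_Collect_eq using that S by (intro exI[of _ u] exI[of _ v]) auto
  have ball: "(\<forall>h\<in>B. R h) \<longleftrightarrow> (\<forall>u\<in>S. \<forall>v\<in>?T. R {u, v})" for R
    unfolding B_def by auto
  have BK: "B \<subseteq> K" using mem ball[of "\<lambda>h. h \<in> K"] by blast
  then have fin: "finite B" by (rule finite_subset) simp
  \<comment> \<open>One end lies in \<open>S\<close> and the other outside, so a cut edge determines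
    its ordered pair and the sum over \<open>B\<close> is a double sum.\<close>
  have inj: "inj_on (\<lambda>(u, v). {u, v}) (S \<times> ?T)"
  proof (rule inj_onI, clarify)
    fix u v u' v' assume *: "u \<in> S" "v \<in> {1..n}" "v \<notin> S" "u' \<in> S" "v' \<in> {1..n}" "v' \<notin> S" "{u, v} = {u', v'}"
    from *(7) consider "u = u' \<and> v = v'" | "u = v' \<and> v = u'" unfolding doubleton_eq_iff by blast
    then show "u = u' \<and> v = v'" using *(1,6) by cases simp_all
  qed
  have P: "?P \<omega> \<longleftrightarrow> (\<forall>h\<in>B. \<not> Z h \<omega>)" for \<omega>
    unfolding ball using mem by (simp add: random_edges_def)
  have "random_edges n Z -` {E \<in> Pow K. \<forall>u\<in>S. \<forall>v\<in>?T. {u, v} \<notin> E} \<inter> space M \<in> events"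
    by (rule measurable_sets[OF random_edges_measurable]) auto
  moreover have "random_edges n Z \<omega> \<in> Pow K" for \<omega> by (auto simp: random_edges_def)
  then have "random_edges n Z -` {E \<in> Pow K. \<forall>u\<in>S. \<forall>v\<in>?T. {u, v} \<notin> E} \<inter> space M = {\<omega> \<in> space M. ?P \<omega>}"
    unfolding vimage_def Int_def by blast
  ultimately show ev: "{\<omega> \<in> space M. ?P \<omega>} \<in> events" by (simp only:)
  have q: "expectation (\<lambda>\<omega>. 1 - of_bool (Z h \<omega>)) = 1 - q h" if "h \<in> K" for h
  proof -
    have "integrable M (\<lambda>\<omega>. of_bool (Z h \<omega>) :: real)"
      using states_integrable[OF that that, of of_bool "\<lambda>_. 1"] by simp
    then show ?thesis using expectation_state[OF that] by (simp add: prob_space)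
  qed
  have "prob {\<omega> \<in> space M. ?P \<omega>} = expectation (indicat_real {\<omega> \<in> space M. ?P \<omega>})"
    using ev by (simp add: Int_absorb2)
  also have "\<dots> = expectation (\<lambda>\<omega>. \<Prod>h\<in>B. 1 - of_bool (Z h \<omega>))"
  proof (rule Bochner_Integration.integral_cong[OF refl])
    fix \<omega> assume "\<omega> \<in> space M"
    then have "indicat_real {\<omega> \<in> space M. ?P \<omega>} \<omega> = of_bool (\<forall>h\<in>B. \<not> Z h \<omega>)"
      unfolding P by (simp add: indicator_def)
    also have "\<dots> = (\<Prod>h\<in>B. 1 - of_bool (Z h \<omega>))"
      using fin by (induction B rule: finite_induct) auto
    finally show "indicat_real {\<omega> \<in> space M. ?P \<omega>} \<omega> = (\<Prod>h\<in>B. 1 - of_bool (Z h \<omega>))" .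
  qed
  also have "\<dots> = (\<Prod>h\<in>B. expectation (\<lambda>\<omega>. 1 - of_bool (Z h \<omega>)))"
    by (rule expectation_prod_states[OF BK, of "\<lambda>_ b. 1 - of_bool b"])
  also have "\<dots> = (\<Prod>h\<in>B. 1 - q h)"
    using BK q by (intro prod.cong) auto
  also have "\<dots> \<le> (\<Prod>h\<in>B. exp (- q h))"
    using BK q_bounds exp_ge_add_one_self[of "- q _"] by (intro prod_mono) auto
  also have "\<dots> = exp (- (\<Sum>h\<in>B. q h))" using fin by (simp add: exp_sum sum_negf[symmetric])
  also have "(\<Sum>h\<in>B. q h) = (\<Sum>u\<in>S. \<Sum>v\<in>?T. q {u, v})"
    unfolding B_def using inj by (simp add: sum.reindex sum.cartesian_product case_prod_beta')
  also have "exp (- (\<Sum>u\<in>S. \<Sum>v\<in>?T. q {u, v})) \<le> exp (- (\<Sum>u\<in>S. \<alpha>))"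
    using sum_mono[OF deg, of S "\<lambda>u. u"] by simp
  also have "\<dots> = exp (- \<alpha>) ^ card S" by (simp add: exp_of_nat_mult[symmetric])
  finally show "prob {\<omega> \<in> space M. ?P \<omega>} \<le> exp (- \<alpha>) ^ card S" .
qed

text \<open>A union bound over the small sides of cuts. Extending the sum to all nonempty vertex
  sets gives the closed form.\<close>

lemma prob_not_connected_le:
  assumes n: "n \<ge> 1"
    and deg: "\<And>S u. S \<subseteq> {1..n} \<Longrightarrow> 2 * card S \<le> n \<Longrightarrow> u \<in> S \<Longrightarrow> \<alpha> \<le> (\<Sum>v\<in>{1..n} - S. q {u, v})"
  shows "prob {\<omega> \<in> space M. \<not> graph_connected {1..n} (random_edges n Z \<omega>)} \<le> (1 + exp (- \<alpha>)) ^ n - 1"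
proof -
  let ?V = "{1..n}"
  let ?A = "\<lambda>S. {\<omega> \<in> space M. \<forall>u\<in>S. \<forall>v\<in>?V - S. {u, v} \<notin> random_edges n Z \<omega>}"
  let ?S = "{S. S \<subseteq> ?V \<and> S \<noteq> {} \<and> 2 * card S \<le> n}"
  have finS: "finite ?S" by simp
  have ev: "?A S \<in> events" and le: "prob (?A S) \<le> exp (- \<alpha>) ^ card S" if "S \<in> ?S" for S
  proof -
    have S: "S \<subseteq> ?V" "2 * card S \<le> n" using that by auto
    show "?A S \<in> events" by (rule prob_empty_cut_le(1)[OF S(1) deg[OF S]])
    show "prob (?A S) \<le> exp (- \<alpha>) ^ card S" by (rule prob_empty_cut_le(2)[OF S(1) deg[OF S]])
  qed
  have "{\<omega> \<in> space M. \<not> graph_connected ?V (random_edges n Z \<omega>)} \<subseteq> (\<Union>S\<in>?S. ?A S)"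
  proof
    fix \<omega> assume \<omega>: "\<omega> \<in> {\<omega> \<in> space M. \<not> graph_connected ?V (random_edges n Z \<omega>)}"
    then have "\<not> graph_connected ?V (random_edges n Z \<omega>)" by simp
    from not_connected_small_cut[OF n this] obtain S where S: "S \<subseteq> ?V \<and> S \<noteq> {} \<and> 2 * card S \<le> n \<and>
      (\<forall>u\<in>S. \<forall>v\<in>?V - S. {u, v} \<notin> random_edges n Z \<omega>)" ..
    have "S \<in> ?S" "\<omega> \<in> ?A S" using \<omega> S by simp_all
    then show "\<omega> \<in> (\<Union>S\<in>?S. ?A S)" by blast
  qed
  then have "prob {\<omega> \<in> space M. \<not> graph_connected ?V (random_edges n Z \<omega>)} \<le> prob (\<Union>S\<in>?S. ?A S)"
    using ev finS by (intro finite_measure_mono sets.finite_UN) auto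
  also have "\<dots> \<le> (\<Sum>S\<in>?S. prob (?A S))"
    using finS ev by (intro finite_measure_subadditive_finite) auto
  also have "\<dots> \<le> (\<Sum>S\<in>?S. exp (- \<alpha>) ^ card S)" by (intro sum_mono le)
  also have "\<dots> \<le> (\<Sum>S\<in>Pow ?V - {{}}. exp (- \<alpha>) ^ card S)" by (intro sum_mono2) auto
  also have "\<dots> = (1 + exp (- \<alpha>)) ^ n - 1"
    by (simp add: sum_diff sum_Pow_power_card)
  finally show ?thesis .
qed

end

section \<open>The maximum spanning tree\<close>

text \<open>This allows the tree cost to be centred at the mean of the forest cost.\<close>

lemma (in prob_space) variance_le_square_deviation:
  fixes f :: "'a \<Rightarrow> real"
  assumes "integrable M f" "integrable M (\<lambda>x. (f x)\<^sup>2)"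
  shows "variance f \<le> expectation (\<lambda>x. (f x - a)\<^sup>2)"
proof -
  have "expectation (\<lambda>x. (f x - a)\<^sup>2) = expectation (\<lambda>x. (f x)\<^sup>2) + a\<^sup>2 - 2 * expectation f * a"
    using assms by (simp add: power2_diff prob_space)
  moreover have "variance f = expectation (\<lambda>x. (f x)\<^sup>2) - (expectation f)\<^sup>2"
    using assms by (simp add: variance_eq)
  moreover have "0 \<le> (expectation f - a)\<^sup>2" by simp
  ultimately show ?thesis by (simp add: power2_diff)
qed

text \<open>Dyadic summation: \<open>c \<le> 2 ^ (k + 1) * L\<close> for the last \<open>k\<close> with \<open>c > 2 ^ k * L\<close>.\<close>

lemma (in prob_space) excess_square_from_tail:
  fixes c :: "'a \<Rightarrow> real"
  assumes c: "c \<in> borel_measurable M" and L: "0 < L"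
    and tail: "\<And>k :: nat. prob {\<omega> \<in> space M. c \<omega> > 2 ^ k * L} \<le> A / 8 ^ k"
  shows "integrable M (\<lambda>\<omega>. (if c \<omega> > L then c \<omega> else 0)\<^sup>2)"
    and "expectation (\<lambda>\<omega>. (if c \<omega> > L then c \<omega> else 0)\<^sup>2) \<le> 8 * A * L\<^sup>2"
proof -
  let ?e = "\<lambda>\<omega>. (if c \<omega> > L then c \<omega> else 0)\<^sup>2"
  let ?S = "\<lambda>k :: nat. {\<omega> \<in> space M. c \<omega> > 2 ^ k * L}"
  have A: "0 \<le> A" using order.trans[OF measure_nonneg tail[of 0]] by simp
  have S: "?S k \<in> events" for k using c by measurable
  have pt: "ennreal (?e \<omega>) \<le> (\<Sum>k. ennreal (4 ^ Suc k * L\<^sup>2) * indicator (?S k) \<omega>)" if \<omega>: "\<omega> \<in> space M" for \<omega>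
  proof (cases "c \<omega> > L")
    case True
    obtain N where N: "c \<omega> / L < 2 ^ N" using real_arch_pow[of 2 "c \<omega> / L"] by auto
    define k where "k = (LEAST k. c \<omega> \<le> 2 ^ k * L)"
    have "c \<omega> \<le> 2 ^ N * L" using N L by (simp add: field_simps)
    then have k: "c \<omega> \<le> 2 ^ k * L" unfolding k_def by (rule LeastI)
    then have "k \<noteq> 0" using True by (cases k) auto
    then obtain j where j: "k = Suc j" by (cases k) auto
    have "\<not> c \<omega> \<le> 2 ^ j * L" using not_less_Least[of j "\<lambda>k. c \<omega> \<le> 2 ^ k * L"] j unfolding k_def by auto
    then have j': "\<omega> \<in> ?S j" using \<omega> by simp
    have "?e \<omega> \<le> (2 ^ Suc j * L)\<^sup>2" using True k L unfolding j by (auto intro!: power_mono)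
    also have "\<dots> = 4 ^ Suc j * L\<^sup>2"
      by (simp add: power_mult_distrib power_even_eq[symmetric] power2_eq_square)
        (simp add: power_mult_distrib[symmetric])
    finally have "ennreal (?e \<omega>) \<le> ennreal (4 ^ Suc j * L\<^sup>2) * indicator (?S j) \<omega>"
      using j' by (simp add: ennreal_leI)
    also have "\<dots> = (\<Sum>k\<in>{j}. ennreal (4 ^ Suc k * L\<^sup>2) * indicator (?S k) \<omega>)"
      by (simp only: sum.insert finite.emptyI empty_iff not_False_eq_True sum.empty add_0_right)
    also have "\<dots> \<le> (\<Sum>k. ennreal (4 ^ Suc k * L\<^sup>2) * indicator (?S k) \<omega>)"
      by (rule sum_le_suminf) auto
    finally show ?thesis .
  qed simp
  have "(\<integral>\<^sup>+\<omega>. ennreal (?e \<omega>) \<partial>M) \<le> (\<integral>\<^sup>+\<omega>. (\<Sum>k. ennreal (4 ^ Suc k * L\<^sup>2) * indicator (?S k) \<omega>) \<partial>M)"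
    by (intro nn_integral_mono pt)
  also have "\<dots> = (\<Sum>k. ennreal (4 ^ Suc k * L\<^sup>2) * emeasure M (?S k))"
    using S by (simp add: nn_integral_suminf nn_integral_cmult)
  \<comment> \<open>The decay \<open>8 ^ k\<close> of the tail beats the growth \<open>4 ^ k\<close>
    of the squares. A geometric series of ratio 1/2 remains, whose sum 2 turns the constant 4 into
    8.\<close>
  also have "\<dots> \<le> (\<Sum>k. ennreal (4 * A * L\<^sup>2 * (1 / 2) ^ k))"
  proof (intro suminf_le)
    fix k
    have "ennreal (4 ^ Suc k * L\<^sup>2) * emeasure M (?S k) = ennreal (4 ^ Suc k * L\<^sup>2 * prob (?S k))"
      by (simp add: emeasure_eq_measure ennreal_mult)
    also have "\<dots> \<le> ennreal (4 ^ Suc k * L\<^sup>2 * (A / 8 ^ k))"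
      by (intro ennreal_leI mult_left_mono tail) auto
    also have "4 ^ Suc k * L\<^sup>2 * (A / 8 ^ k) = 4 * A * L\<^sup>2 * (4 ^ k / 8 ^ k)" by simp
    also have "(4 ^ k / 8 ^ k :: real) = (1 / 2) ^ k" by (simp add: power_divide[symmetric])
    finally show "ennreal (4 ^ Suc k * L\<^sup>2) * emeasure M (?S k) \<le> ennreal (4 * A * L\<^sup>2 * (1 / 2) ^ k)" .
  qed auto
  also have "\<dots> = ennreal (8 * A * L\<^sup>2)"
  proof (rule suminf_ennreal_eq)
    show "(\<lambda>k. 4 * A * L\<^sup>2 * (1 / 2) ^ k) sums (8 * A * L\<^sup>2)"
      using sums_mult[OF geometric_sums[of "1 / 2 :: real"], of "4 * A * L\<^sup>2"] by (simp add: mult.assoc)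
  qed (use A in auto)
  finally have le: "(\<integral>\<^sup>+\<omega>. ennreal (?e \<omega>) \<partial>M) \<le> ennreal (8 * A * L\<^sup>2)" .
  have m: "?e \<in> borel_measurable M" using c by measurable
  show "integrable M ?e"
    using le by (intro integrableI_bounded m) (auto simp: order.strict_trans1[OF _ ennreal_less_top])
  show "expectation ?e \<le> 8 * A * L\<^sup>2"
    using le A m by (subst integral_eq_nn_integral) (auto intro: enn2real_leI)
qed

section \<open>From the forest cost to the spanning tree cost\<close>

context truncated_random_graph
begin

text \<open>Tree cost w and forest cost f agree on connected graphs, and 0 \<le> f - w \<le> f
  always. With a = E f this gives (w - a)^2 \<le> 2(f - a)^2 + 2 f^2 1[disconnected], and the last
  term is bounded by \<open>forest_cost_square_on_states\<close>.\<close>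

lemma
  assumes sel: "\<And>E. E \<subseteq> K \<Longrightarrow> largest_component {1..n} E (sel E)"
    and deg: "\<And>S u. S \<subseteq> {1..n} \<Longrightarrow> 2 * card S \<le> n \<Longrightarrow> u \<in> S \<Longrightarrow> \<alpha> \<le> (\<Sum>v\<in>{1..n} - S. q {u, v})"
  defines "w \<equiv> max_tree_cost n sel Z (edge_cost r X W)"
  shows tree_cost_integrable: "integrable M w"
    and tree_cost_square_integrable: "integrable M (\<lambda>\<omega>. (w \<omega>)\<^sup>2)"
    and expectation_tree_cost_le: "expectation w \<le> n * L + n * \<beta> * \<tau> / L"
    and variance_tree_cost_le: "variance w \<le> 2 * (32 * \<beta> * n * L\<^sup>2 + 4 * n * \<tau> * (\<beta> + \<beta>\<^sup>2)) +
      2 * (((1 + exp (- \<alpha>)) ^ n - 1) * (2 * n\<^sup>2 * L\<^sup>2 + 2 * n ^ 4 * \<tau>))"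
proof -
  let ?E = "random_edges n Z"
  let ?conn = "\<lambda>E. graph_connected {1..n} E"
  define \<phi> :: "nat set set \<Rightarrow> real" where "\<phi> E = of_bool (\<not> ?conn E)" for E
  have EK: "?E \<omega> \<subseteq> K" for \<omega> by (auto simp: random_edges_def)
  have comp: "sel E \<in> graph_components {1..n} E" if "E \<subseteq> K" for E
    using sel[OF that] by (simp add: largest_component_def)
  have fc: "max_forest_cost n (\<lambda>h. if h \<in> ?E \<omega> then edge_cost r X W h \<omega> else 0) = forest_cost \<omega>" for \<omega>
    unfolding forest_cost_def
    by (intro max_forest_cost_cong) (simp add: edge_value_def random_edges_def)
  have pos: "0 \<le> edge_cost r X W h \<omega>" if "\<omega> \<in> space M" "h \<in> K" for h \<omega>
    using edge_cost_pos[OF that(2,1)] by simp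
  have nonneg: "0 \<le> w \<omega>" and le: "w \<omega> \<le> forest_cost \<omega>"
    and full: "sel (?E \<omega>) = {1..n} \<Longrightarrow> w \<omega> = forest_cost \<omega>" if "\<omega> \<in> space M" for \<omega>
  proof -
    note b = max_spanning_tree_bounds[OF EK[of \<omega>] comp[OF EK[of \<omega>]],
        of "\<lambda>h. edge_cost r X W h \<omega>", OF pos[OF that], unfolded fc[of \<omega>]]
    show "0 \<le> w \<omega>" unfolding w_def max_tree_cost_def by (rule b(1))
    show "w \<omega> \<le> forest_cost \<omega>" unfolding w_def max_tree_cost_def by (rule b(2))
    show "w \<omega> = forest_cost \<omega>" if "sel (?E \<omega>) = {1..n}"
      unfolding w_def max_tree_cost_def by (rule b(3)[OF _ that])
  qed
  have eq: "w \<omega> = forest_cost \<omega>" if "\<omega> \<in> space M" "?conn (?E \<omega>)" for \<omega>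
    by (rule full[OF that(1) largest_component_connected[OF that(2) sel[OF EK]]])
  have meas: "w \<in> borel_measurable M"
    unfolding w_def max_tree_cost_def
  \<comment> \<open>The selected component depends on \<omega> only through the graph, which takes
    finitely many values; for a fixed graph the cost is a maximum of finitely many sums.\<close>
  proof (rule measurable_compose_countable'[OF _ random_edges_measurable])
    fix E assume "E \<in> Pow K"
    then have E: "E \<subseteq> K" by simp
    show "(\<lambda>\<omega>. Max ((\<lambda>T. \<Sum>h\<in>T. edge_cost r X W h \<omega>) ` spanning_trees (sel E) E)) \<in> borel_measurable M"
    proof (intro borel_measurable_Max finite_spanning_trees[OF E] borel_measurable_sum edge_cost_measurable)
      fix T h assume "T \<in> spanning_trees (sel E) E" "h \<in> T"
      then show "h \<in> K" using spanning_trees_subset_forests[OF E, of "sel E"] by (auto simp: forests_def)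
    qed
  qed (simp add: countable_finite)
  show int: "integrable M w"
    by (rule Bochner_Integration.integrable_bound[OF forest_cost_integrable meas], rule AE_I2)
      (use nonneg le in fastforce)
  show int2: "integrable M (\<lambda>\<omega>. (w \<omega>)\<^sup>2)"
  proof (rule Bochner_Integration.integrable_bound[OF forest_cost_square_integrable])
    show "AE \<omega> in M. norm ((w \<omega>)\<^sup>2) \<le> norm ((forest_cost \<omega>)\<^sup>2)"
      using nonneg le by (intro AE_I2) (auto intro!: power_mono)
  qed (use meas in measurable)
  have "expectation w \<le> expectation forest_cost"
    by (intro integral_mono int forest_cost_integrable le)
  then show "expectation w \<le> n * L + n * \<beta> * \<tau> / L" using expectation_forest_cost_le by linarith
  define a where "a = expectation forest_cost"
  have fa: "integrable M (\<lambda>\<omega>. (forest_cost \<omega> - a)\<^sup>2)"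
    using forest_cost_integrable forest_cost_square_integrable by (simp add: power2_diff)
  have \<phi>: "0 \<le> \<phi> E" for E by (simp add: \<phi>_def)
  have "variance w \<le> expectation (\<lambda>\<omega>. (w \<omega> - a)\<^sup>2)"
    by (rule variance_le_square_deviation[OF int int2])
  also have "\<dots> \<le> expectation (\<lambda>\<omega>. 2 * (forest_cost \<omega> - a)\<^sup>2 + 2 * (\<phi> (?E \<omega>) * (forest_cost \<omega>)\<^sup>2))"
  proof (rule integral_mono)
    show "integrable M (\<lambda>\<omega>. (w \<omega> - a)\<^sup>2)" using int int2 by (simp add: power2_diff)
    show "integrable M (\<lambda>\<omega>. 2 * (forest_cost \<omega> - a)\<^sup>2 + 2 * (\<phi> (?E \<omega>) * (forest_cost \<omega>)\<^sup>2))"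
      using fa forest_cost_square_on_states(1)[of \<phi>, OF \<phi>] by simp
    fix \<omega> assume \<omega>: "\<omega> \<in> space M"
    show "(w \<omega> - a)\<^sup>2 \<le> 2 * (forest_cost \<omega> - a)\<^sup>2 + 2 * (\<phi> (?E \<omega>) * (forest_cost \<omega>)\<^sup>2)"
    proof (cases "?conn (?E \<omega>)")
      case True
      then show ?thesis using eq[OF \<omega>] \<phi> by simp
    next
      case False
      have "(w \<omega> - a)\<^sup>2 = ((forest_cost \<omega> - a) - (forest_cost \<omega> - w \<omega>))\<^sup>2" by simp
      also have "\<dots> \<le> 2 * (forest_cost \<omega> - a)\<^sup>2 + 2 * (forest_cost \<omega> - w \<omega>)\<^sup>2"
      proof -
        have "(x - y)\<^sup>2 \<le> 2 * x\<^sup>2 + 2 * y\<^sup>2" for x y :: real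
          using zero_le_power2[of "x + y"] unfolding power2_sum power2_diff by linarith
        then show ?thesis .
      qed
      also have "(forest_cost \<omega> - w \<omega>)\<^sup>2 \<le> (forest_cost \<omega>)\<^sup>2"
        using nonneg[OF \<omega>] le[OF \<omega>] by (intro power_mono) auto
      finally show ?thesis using False by (simp add: \<phi>_def)
    qed
  qed
  also have "\<dots> = 2 * variance forest_cost + 2 * expectation (\<lambda>\<omega>. \<phi> (?E \<omega>) * (forest_cost \<omega>)\<^sup>2)"
    using fa forest_cost_square_on_states(1)[of \<phi>, OF \<phi>] by (simp add: a_def)
  also have "\<dots> \<le> 2 * (32 * \<beta> * n * L\<^sup>2 + 4 * n * \<tau> * (\<beta> + \<beta>\<^sup>2)) +
      2 * (((1 + exp (- \<alpha>)) ^ n - 1) * (2 * n\<^sup>2 * L\<^sup>2 + 2 * n ^ 4 * \<tau>))"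
  proof (intro add_mono mult_left_mono variance_forest_cost_le)
    have "expectation (\<lambda>\<omega>. \<phi> (?E \<omega>)) = expectation (indicat_real {\<omega> \<in> space M. \<not> ?conn (?E \<omega>)})"
      by (intro Bochner_Integration.integral_cong) (auto simp: \<phi>_def indicator_def)
    also have "\<dots> = prob {\<omega> \<in> space M. \<not> ?conn (?E \<omega>)}" by (simp add: Int_absorb2)
    also have "\<dots> \<le> (1 + exp (- \<alpha>)) ^ n - 1" using n by (intro prob_not_connected_le deg) auto
    finally have P: "expectation (\<lambda>\<omega>. \<phi> (?E \<omega>)) \<le> (1 + exp (- \<alpha>)) ^ n - 1" .
    have "expectation (\<lambda>\<omega>. \<phi> (?E \<omega>) * (forest_cost \<omega>)\<^sup>2) \<le>
        expectation (\<lambda>\<omega>. \<phi> (?E \<omega>)) * (2 * n\<^sup>2 * L\<^sup>2 + 2 * n ^ 4 * \<tau>)"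
      by (rule forest_cost_square_on_states(2)[of \<phi>, OF \<phi>])
    also have "\<dots> \<le> ((1 + exp (- \<alpha>)) ^ n - 1) * (2 * n\<^sup>2 * L\<^sup>2 + 2 * n ^ 4 * \<tau>)"
      using P tau_nonneg by (intro mult_right_mono) auto
    finally show "expectation (\<lambda>\<omega>. \<phi> (?E \<omega>) * (forest_cost \<omega>)\<^sup>2) \<le>
      ((1 + exp (- \<alpha>)) ^ n - 1) * (2 * n\<^sup>2 * L\<^sup>2 + 2 * n ^ 4 * \<tau>)" .
  qed auto
  finally show "variance w \<le> 2 * (32 * \<beta> * n * L\<^sup>2 + 4 * n * \<tau> * (\<beta> + \<beta>\<^sup>2)) +
      2 * (((1 + exp (- \<alpha>)) ^ n - 1) * (2 * n\<^sup>2 * L\<^sup>2 + 2 * n ^ 4 * \<tau>))" .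
qed

end

text \<open>\<open>\<kappa>\<close> shows that the set under the supremum is nonempty, and the limit
  of \<open>F\<close> that it is bounded. The lower bound \<open>\<kappa>\<close> later keeps H(np)
  away from 0.\<close>

lemma inv_ccdf_bounds:
  fixes F :: "real \<Rightarrow> real"
  assumes mono: "\<And>x y. x \<le> y \<Longrightarrow> F y \<le> F x" and lim: "\<And>e. 0 < e \<Longrightarrow> \<exists>b. F b < e"
    and \<kappa>: "0 < \<kappa>" "1 / y \<le> F \<kappa>" and y: "0 < y"
  shows "\<kappa> \<le> inv_ccdf F y" and "inv_ccdf F y < x \<Longrightarrow> F x < 1 / y"
proof -
  let ?S = "{x. x > 0 \<and> F x \<ge> 1 / y}"
  obtain b where b: "F b < 1 / y" using lim[of "1 / y"] y by auto
  have bdd: "bdd_above ?S"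
  proof (rule bdd_aboveI[of _ b])
    fix x assume "x \<in> ?S"
    then show "x \<le> b" using mono[of b x] b by (cases "x \<le> b") auto
  qed
  show le: "\<kappa> \<le> inv_ccdf F y"
    unfolding inv_ccdf_def using \<kappa> by (intro cSup_upper bdd) auto
  assume x: "inv_ccdf F y < x"
  show "F x < 1 / y"
  proof (rule ccontr)
    assume "\<not> F x < 1 / y"
    then have "x \<in> ?S" using x le \<kappa> by auto
    then have "x \<le> inv_ccdf F y" unfolding inv_ccdf_def by (intro cSup_upper bdd)
    then show False using x by simp
  qed
qed

text \<open>The factor 5 makes n exp(-\<alpha>) at most n^(-4), which compensates the factor n^4 in
  \<open>forest_cost_square_on_states\<close>.\<close>

lemma power_one_plus_exp_le:
  assumes n: "n \<ge> 2" and \<alpha>: "5 * ln (real n) \<le> \<alpha>"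
  shows "(1 + exp (- \<alpha>)) ^ n - 1 \<le> 2 / real n ^ 4"
proof -
  let ?x = "exp (- \<alpha>)" and ?t = "1 / real n ^ 4"
  have "exp (5 * ln (real n)) = real n ^ 5" using n by (simp add: exp_of_nat_mult[of 5, simplified])
  moreover have "?x \<le> exp (- (5 * ln (real n)))" using \<alpha> by simp
  ultimately have x: "?x \<le> 1 / real n ^ 5" by (simp add: exp_minus inverse_eq_divide)
  have nx: "n * ?x \<le> ?t"
  proof -
    have "n * ?x \<le> n * (1 / real n ^ 5)" using x by (intro mult_left_mono) auto
    also have "\<dots> = ?t" using n by (simp add: field_simps power_Suc[symmetric] del: power_Suc)
    finally show ?thesis .
  qed
  have t: "0 \<le> ?t" "?t \<le> 1" using n by (auto simp: divide_le_eq_1 one_le_power)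
  have "(1 + ?x) ^ n \<le> exp ?x ^ n" by (intro power_mono exp_ge_add_one_self) (auto simp: add_nonneg_nonneg)
  also have "\<dots> = exp (n * ?x)" by (simp add: exp_of_nat_mult)
  also have "\<dots> \<le> exp ?t" using nx by simp
  also have "\<dots> \<le> 1 + ?t + ?t\<^sup>2" using exp_bound[OF t] .
  also have "?t\<^sup>2 \<le> ?t" unfolding power2_eq_square using mult_right_mono[OF t(2,1)] by simp
  finally show ?thesis by simp
qed

text \<open>Here \<open>m\<close> is np, \<open>\<beta> = b * m\<close> and
  \<open>\<tau> = B * L\<^sup>2 / m\<close>. The factor 1/m in \<open>\<tau>\<close> cancels one
  power of \<open>m\<close> in \<open>\<beta>\<^sup>2\<close>, so every term is at most a constant
  times \<open>n * m * L\<^sup>2\<close>.\<close>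

lemma variance_constant:
  fixes m L b B P :: real and n :: nat
  assumes m: "1 \<le> m" and n: "1 \<le> n" and b: "0 \<le> b" and B: "0 \<le> B" and P: "P \<le> 2 / real n ^ 4"
  shows "2 * (32 * (b * m) * real n * L\<^sup>2 + 4 * real n * (B * L\<^sup>2 / m) * (b * m + (b * m)\<^sup>2)) +
      2 * (P * (2 * (real n)\<^sup>2 * L\<^sup>2 + 2 * real n ^ 4 * (B * L\<^sup>2 / m))) \<le>
    (64 * b + 8 * B * b + 8 * B * b\<^sup>2 + 8 + 8 * B) * (real n * m * L\<^sup>2)"
proof -
  have nm: "L\<^sup>2 \<le> n * m * L\<^sup>2" "L\<^sup>2 \<le> n * L\<^sup>2"
  proof -
    have "1 * 1 \<le> real n * m" using m n by (intro mult_mono) auto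
    then show "L\<^sup>2 \<le> n * m * L\<^sup>2" using mult_right_mono[of 1 "n * m" "L\<^sup>2"] by simp
    show "L\<^sup>2 \<le> n * L\<^sup>2" using n mult_right_mono[of 1 n "L\<^sup>2"] by simp
  qed
  have n1: "n * L\<^sup>2 \<le> n * m * L\<^sup>2" using m n mult_left_mono[of 1 m "n * L\<^sup>2"] by (simp add: mult_ac)
  have e1: "4 * real n * (B * L\<^sup>2 / m) * (b * m + (b * m)\<^sup>2) = 4 * B * b * (real n * L\<^sup>2) + 4 * B * b\<^sup>2 * (real n * m * L\<^sup>2)"
    using m by (simp add: field_simps power2_eq_square)
  have e2: "4 * B * b * (real n * L\<^sup>2) \<le> 4 * B * b * (real n * m * L\<^sup>2)"
    using n1 B b by (intro mult_left_mono) auto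
  have "P * (2 * (real n)\<^sup>2 * L\<^sup>2 + 2 * real n ^ 4 * (B * L\<^sup>2 / m)) \<le>
      2 / real n ^ 4 * (2 * (real n)\<^sup>2 * L\<^sup>2 + 2 * real n ^ 4 * (B * L\<^sup>2 / m))"
    using P B m by (intro mult_right_mono) auto
  also have "\<dots> = 4 * (L\<^sup>2 / (real n)\<^sup>2) + 4 * B * (L\<^sup>2 / m)"
    using n m by (simp add: field_simps power2_eq_square power4_eq_xxxx)
  also have "L\<^sup>2 / (real n)\<^sup>2 \<le> L\<^sup>2" using n by (simp add: divide_le_eq mult_left_le one_le_power mult_ac)
      (simp add: mult_right_le_one_le mult_le_cancel_left1 one_le_power)
  also have "4 * B * (L\<^sup>2 / m) \<le> 4 * B * L\<^sup>2"
    using m B by (intro mult_left_mono) (auto simp: divide_le_eq mult_le_cancel_left1)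
  finally have "P * (2 * (real n)\<^sup>2 * L\<^sup>2 + 2 * real n ^ 4 * (B * L\<^sup>2 / m)) \<le> (4 + 4 * B) * L\<^sup>2"
    by (simp add: algebra_simps)
  also have "\<dots> \<le> (4 + 4 * B) * (real n * m * L\<^sup>2)" using nm B by (intro mult_left_mono) auto
  finally have e3: "P * (2 * (real n)\<^sup>2 * L\<^sup>2 + 2 * real n ^ 4 * (B * L\<^sup>2 / m)) \<le> (4 + 4 * B) * (real n * m * L\<^sup>2)" .
  have e4: "32 * (b * m) * real n * L\<^sup>2 = 32 * b * (real n * m * L\<^sup>2)" by simp
  have "2 * (32 * b * x + (4 * B * b * y + 4 * B * b\<^sup>2 * x)) + 2 * R \<le>
      (64 * b + 8 * B * b + 8 * B * b\<^sup>2 + 8 + 8 * B) * x"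
    if "4 * B * b * y \<le> 4 * B * b * x" "R \<le> (4 + 4 * B) * x" for x y R :: real
  proof -
    have "(64 * b + 8 * B * b + 8 * B * b\<^sup>2 + 8 + 8 * B) * x =
        2 * (32 * b * x + (4 * B * b * x + 4 * B * b\<^sup>2 * x)) + 2 * ((4 + 4 * B) * x)"
      by (simp add: algebra_simps)
    moreover have "2 * (c + (u + w)) + 2 * R \<le> 2 * (c + (v + w)) + 2 * R'" if "u \<le> v" "R \<le> R'" for c u v w R R' :: real
      by (intro add_mono mult_left_mono that order.refl) simp_all
    ultimately show ?thesis using that by metis
  qed
  from this[OF e2 e3] show ?thesis unfolding e1 e4 .
qed

text \<open>With \<open>m\<close> for np, the factor 1/m in the tail bound at level \<open>L\<close>
  yields \<open>\<tau> = 8 * A * L\<^sup>2 / m\<close> by dyadic summation, matched to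
  \<open>\<beta> = b * m\<close>.\<close>

lemma (in weighted_random_graph) tree_cost_moments:
  fixes m L b A :: real
  assumes n: "n \<ge> 2" and m: "1 \<le> m" and b: "0 \<le> b" and A: "0 \<le> A" and L: "0 < L"
    and sel: "\<And>E. E \<subseteq> K \<Longrightarrow> largest_component {1..n} E (sel E)"
    and up: "\<And>u. u \<in> {1..n} \<Longrightarrow> (\<Sum>v\<in>{1..n} - {u}. q {u, v}) \<le> b * m"
    and low: "\<And>S u. S \<subseteq> {1..n} \<Longrightarrow> 2 * card S \<le> n \<Longrightarrow> u \<in> S \<Longrightarrow> 5 * ln n \<le> (\<Sum>v\<in>{1..n} - S. q {u, v})"
    and tail: "\<And>h k. h \<in> K \<Longrightarrow> prob {\<omega> \<in> space M. edge_cost r X W h \<omega> > 2 ^ k * L} \<le> A / m / 8 ^ k"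
  defines "w \<equiv> max_tree_cost n sel Z (edge_cost r X W)"
  shows "integrable M w" and "integrable M (\<lambda>\<omega>. (w \<omega>)\<^sup>2)"
    and "expectation w \<le> (1 + 8 * A * b) * (real n * L)"
    and "variance w \<le> (64 * b + 8 * (8 * A) * b + 8 * (8 * A) * b\<^sup>2 + 8 + 8 * (8 * A)) * (real n * m * L\<^sup>2)"
proof -
  interpret truncated_random_graph M n q Z W D mk X r L "8 * A * L\<^sup>2 / m" "b * m"
  proof unfold_locales
    fix h assume h: "h \<in> K"
    note t = excess_square_from_tail[OF edge_cost_measurable[OF h] L tail[OF h]]
    show "integrable M (\<lambda>\<omega>. (excess L h \<omega>)\<^sup>2)" unfolding excess_def by (rule t(1))
    show "expectation (\<lambda>\<omega>. (excess L h \<omega>)\<^sup>2) \<le> 8 * A * L\<^sup>2 / m"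
      using t(2) unfolding excess_def by simp
  next
    fix u assume u: "u \<in> {1..n}"
    have "{h \<in> K. u \<in> h} = (\<lambda>v. {u, v}) ` ({1..n} - {u})"
    proof (intro equalityI subsetI)
      fix h assume "h \<in> {h \<in> K. u \<in> h}"
      then have h: "h \<in> K" "u \<in> h" by auto
      obtain a b where ab: "h = {a, b}" "a \<in> {1..n}" "b \<in> {1..n}" "a < b"
        using h(1) by (rule complete_edgesE)
      then have "h = {u, b} \<and> b \<noteq> u \<or> h = {u, a} \<and> a \<noteq> u" using h(2) by auto
      then show "h \<in> (\<lambda>v. {u, v}) ` ({1..n} - {u})" using ab(2,3) by blast
    next
      fix h assume "h \<in> (\<lambda>v. {u, v}) ` ({1..n} - {u})"
      then obtain v where v: "h = {u, v}" "v \<in> {1..n}" "v \<noteq> u" by blast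
      then have "h \<in> K" unfolding complete_edges_def mem_Collect_eq
        using u by (intro exI[of _ u] exI[of _ v]) auto
      then show "h \<in> {h \<in> K. u \<in> h}" using v(1) by blast
    qed
    moreover have "inj_on (\<lambda>v. {u, v}) ({1..n} - {u})" by (auto simp: inj_on_def doubleton_eq_iff)
    ultimately show "(\<Sum>h\<in>{h \<in> K. u \<in> h}. q h) \<le> b * m" using up[OF u] by (simp add: sum.reindex)
  qed (use n L in auto)
  note t = tree_cost_integrable[OF sel low] tree_cost_square_integrable[OF sel low]
    expectation_tree_cost_le[OF sel low] variance_tree_cost_le[OF sel low]
  show "integrable M w" "integrable M (\<lambda>\<omega>. (w \<omega>)\<^sup>2)" unfolding w_def using t(1,2) by blast+
  have "expectation w \<le> n * L + n * (b * m) * (8 * A * L\<^sup>2 / m) / L"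
    unfolding w_def using t(3) by blast
  also have "\<dots> = (1 + 8 * A * b) * (real n * L)"
    using m L by (simp add: field_simps power2_eq_square)
  finally show "expectation w \<le> (1 + 8 * A * b) * (real n * L)" .
  have "variance w \<le> 2 * (32 * (b * m) * real n * L\<^sup>2 + real (4 * n) * (8 * A * L\<^sup>2 / m) * (b * m + (b * m)\<^sup>2)) +
      2 * (((1 + exp (- (5 * ln n))) ^ n - 1) * (real (2 * n\<^sup>2) * L\<^sup>2 + real (2 * n ^ 4) * (8 * A * L\<^sup>2 / m)))"
    unfolding w_def using t(4) by blast
  also have "real (4 * n) = 4 * real n" by simp
  also have "real (2 * n\<^sup>2) = 2 * (real n)\<^sup>2" by simp
  also have "real (2 * n ^ 4) = 2 * real n ^ 4" by simp
  also have "2 * (32 * (b * m) * real n * L\<^sup>2 + 4 * real n * (8 * A * L\<^sup>2 / m) * (b * m + (b * m)\<^sup>2)) +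
      2 * (((1 + exp (- (5 * ln n))) ^ n - 1) * (2 * (real n)\<^sup>2 * L\<^sup>2 + 2 * real n ^ 4 * (8 * A * L\<^sup>2 / m)))
    \<le> (64 * b + 8 * (8 * A) * b + 8 * (8 * A) * b\<^sup>2 + 8 + 8 * (8 * A)) * (real n * m * L\<^sup>2)"
    using m n b A power_one_plus_exp_le[OF n order.refl] by (intro variance_constant) auto
  finally show "variance w \<le> (64 * b + 8 * (8 * A) * b + 8 * (8 * A) * b\<^sup>2 + 8 + 8 * (8 * A)) * (real n * m * L\<^sup>2)" .
qed

theorem theorem2:
  fixes M :: "nat \<Rightarrow> 'a measure"
    and q :: "nat \<Rightarrow> nat set \<Rightarrow> real"
    and Z :: "nat \<Rightarrow> nat set \<Rightarrow> 'a \<Rightarrow> bool"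
    and W :: "nat \<Rightarrow> nat set \<Rightarrow> 'a \<Rightarrow> real"
    and D :: "real measure"
    and mk :: "'m measure"
    and X :: "nat \<Rightarrow> nat \<Rightarrow> 'a \<Rightarrow> 'm"
    and r :: "nat \<Rightarrow> 'm \<Rightarrow> 'm \<Rightarrow> real"
    and sel :: "nat \<Rightarrow> nat set set \<Rightarrow> nat set"
    and p :: "nat \<Rightarrow> real"
    and a0 b0 \<gamma>0 \<delta>low \<delta>up C0 x0 s c1 c2 :: real
    and F H :: "real \<Rightarrow> real"
    and c :: "nat \<Rightarrow> nat set \<Rightarrow> 'a \<Rightarrow> real"
    and chi :: "nat \<Rightarrow> 'a \<Rightarrow> real"
  defines "F \<equiv> ccdf D"
    and "H \<equiv> inv_ccdf F"
    and "c \<equiv> \<lambda>n. edge_cost (r n) (X n) (W n)"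
    and "chi \<equiv> \<lambda>n. max_tree_cost n (sel n) (Z n) (c n)"
  assumes model: "\<And>n. n \<ge> 2 \<Longrightarrow>
      weighted_random_graph (M n) n (q n) (Z n) (W n) D mk (X n) (r n)"
    and sel: "\<And>n E. n \<ge> 2 \<Longrightarrow> E \<subseteq> complete_edges n \<Longrightarrow> largest_component {1..n} E (sel n E)"
    and const_i: "a0 > 0" "b0 > 0" "0 < \<gamma>0" "\<gamma>0 < 1 / 2"
    and p: "\<And>n. n \<ge> 2 \<Longrightarrow> 0 < p n \<and> p n < 1"
    and cond_i: "\<forall>\<^sub>F n in sequentially. \<forall>u \<in> {1..n}. \<forall>S. S \<subseteq> {1..n} \<longrightarrow> real (card S) \<ge> \<gamma>0 * real n \<longrightarrow>
        a0 * real n * p n \<le> (\<Sum>v \<in> S - {u}. q n {u, v}) \<and>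
        (\<Sum>v \<in> S - {u}. q n {u, v}) \<le> (\<Sum>v \<in> {1..n} - {u}. q n {u, v}) \<and>
        (\<Sum>v \<in> {1..n} - {u}. q n {u, v}) \<le> b0 * real n * p n"
    and const_ii: "\<delta>low > 0" "\<delta>up > 0"
    and cont: "\<forall>\<^sub>F x in at_top. isCont F x"
    and r_moments: "\<And>n. n \<ge> 2 \<Longrightarrow>
        \<delta>low \<le> (\<integral>\<omega>. r n (X n 1 \<omega>) (X n 2 \<omega>) \<partial>M n)\<^sup>2 \<and>
        (\<integral>\<omega>. r n (X n 1 \<omega>) (X n 2 \<omega>) \<partial>M n)\<^sup>2 \<le> (\<integral>\<omega>. (r n (X n 1 \<omega>) (X n 2 \<omega>))\<^sup>2 \<partial>M n) \<and>
        (\<integral>\<omega>. (r n (X n 1 \<omega>) (X n 2 \<omega>))\<^sup>2 \<partial>M n) \<le> \<delta>up"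
    and const_a: "C0 > 0" "x0 > 0" "s > 3"
    and cond_a: "\<And>a x. a > 1 \<Longrightarrow> x > x0 \<Longrightarrow> F (a * x) \<le> C0 / a powr s * F x"
    and const_b: "c1 > 0" "c2 > 0"
    and cond_b: "\<And>n h x. n \<ge> 2 \<Longrightarrow> h \<in> complete_edges n \<Longrightarrow> x > 0 \<Longrightarrow>
        F x \<ge> c1 * \<P>(\<omega> in M n. c n h \<omega> > c2 * x)"
  shows "\<exists>\<theta>>0. \<forall>n\<ge>2. p n \<ge> \<theta> * ln (real n) / real n \<longrightarrow>
      \<P>(\<omega> in M n. chi n \<omega> \<le> \<theta> * real n * H (real n * p n)) \<ge> 1 - inverse \<theta> * p n \<and>
      integrable (M n) (chi n) \<and>
      (\<integral>\<omega>. chi n \<omega> \<partial>M n) \<le> \<theta> * real n * H (real n * p n) \<and>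
      integrable (M n) (\<lambda>\<omega>. (chi n \<omega>)\<^sup>2) \<and>
      prob_space.variance (M n) (chi n) \<le> \<theta> * (real n)\<^sup>2 * p n * (H (real n * p n))\<^sup>2"
proof -
  \<comment> \<open>The weight law is the same for all \<open>n\<close>, so the model with two
    vertices already shows that \<open>D\<close> is the law of a positive random variable.\<close>
  interpret G2: weighted_random_graph "M 2" 2 "q 2" "Z 2" "W 2" D mk "X 2" "r 2"
    by (rule model) simp
  obtain h0 where h0: "h0 \<in> complete_edges 2" using G2.K_nonempty by auto
  have Dlaw: "D = distr (M 2) borel (W 2 h0)" using G2.W_law[OF h0] by simp
  interpret D: prob_space D unfolding Dlaw by (rule G2.prob_space_distr[OF G2.W_measurable[OF h0]])
  have setsD [simp]: "sets D = sets borel" by (simp add: Dlaw)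
  have F01: "0 \<le> F x" "F x \<le> 1" for x unfolding F_def ccdf_def by simp_all
  have F_mono: "F y \<le> F x" if "x \<le> y" for x y
    unfolding F_def ccdf_def using that by (intro D.finite_measure_mono) auto
  have F_lim: "\<exists>b. F b < e" if e: "0 < e" for e
  proof -
    \<comment> \<open>Since \<open>a powr s \<ge> a > C0 / e\<close>, the tail condition at
      \<open>x0 + 1\<close> brings \<open>F\<close> below \<open>e\<close>.\<close>
    define a where "a = C0 / e + 2"
    have a: "1 < a" using const_a(1) e by (simp add: a_def add_pos_pos)
    have "F (a * (x0 + 1)) \<le> C0 / a powr s * F (x0 + 1)" by (intro cond_a a) simp
    also have "\<dots> \<le> C0 / a powr s" using const_a(1) F01[of "x0 + 1"] by (intro mult_left_le) auto
    also have "\<dots> \<le> C0 / a"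
    proof (intro divide_left_mono)
      have "a powr 1 \<le> a powr s" using a const_a(3) by (intro powr_mono) auto
      then show "a \<le> a powr s" using a by simp
    qed (use a const_a(1) in auto)
    also have "\<dots> < e" using const_a(1) e a by (simp add: a_def field_simps)
    finally show ?thesis by blast
  qed
  \<comment> \<open>Positive weights give full mass to the positive half-line, a countable union of
    half-lines with positive left ends; one of these must have positive mass.\<close>
  have "\<exists>\<kappa>>0. 0 < F \<kappa>"
  proof (rule ccontr)
    assume "\<not> (\<exists>\<kappa>>0. 0 < F \<kappa>)"
    then have no: "F k \<le> 0" if "0 < k" for k using that by (meson not_less)
    have "emeasure D (\<Union>k :: nat. {inverse (real (Suc k))<..}) = 0"
    proof (rule emeasure_UN_eq_0)
      fix k
      have "F (inverse (real (Suc k))) = 0" by (intro antisym no F01) simp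
      then show "emeasure D {inverse (real (Suc k))<..} = 0"
        by (simp add: F_def ccdf_def D.emeasure_eq_measure)
    qed auto
    moreover have "(\<Union>k :: nat. {inverse (real (Suc k))<..}) = {0 :: real<..}"
    proof safe
      fix x :: real and k :: nat assume "inverse (real (Suc k)) < x"
      moreover have "0 < inverse (real (Suc k))" by simp
      ultimately show "0 < x" by linarith
    next
      fix x :: real assume "0 < x"
      then obtain k where "inverse (real (Suc k)) < x" using reals_Archimedean by blast
      then show "x \<in> (\<Union>k :: nat. {inverse (real (Suc k))<..})" by auto
    qed
    moreover have "emeasure D {0<..} = 1"
    proof -
      have "W 2 h0 -` {0<..} \<inter> space (M 2) = space (M 2)" using G2.W_pos[OF h0] by auto
      then show ?thesis unfolding Dlaw using G2.W_measurable[OF h0]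
        by (simp add: emeasure_distr G2.emeasure_space_1)
    qed
    ultimately show False by simp
  qed
  then obtain \<kappa> where \<kappa>: "0 < \<kappa>" "0 < F \<kappa>" by blast
  obtain N0 where N0: "\<And>n. n \<ge> N0 \<Longrightarrow> \<forall>u \<in> {1..n}. \<forall>S. S \<subseteq> {1..n} \<longrightarrow> real (card S) \<ge> \<gamma>0 * real n \<longrightarrow>
        a0 * real n * p n \<le> (\<Sum>v \<in> S - {u}. q n {u, v}) \<and>
        (\<Sum>v \<in> S - {u}. q n {u, v}) \<le> (\<Sum>v \<in> {1..n} - {u}. q n {u, v}) \<and>
        (\<Sum>v \<in> {1..n} - {u}. q n {u, v}) \<le> b0 * real n * p n"
    using cond_i unfolding eventually_sequentially by blast
  \<comment> \<open>Chosen so that \<open>k * y > x0\<close> for every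
    \<open>y \<ge> \<kappa>\<close>; the tail condition then applies at
    \<open>k * H m\<close>.\<close>
  define k where "k = 1 + x0 / \<kappa>"
  have k: "1 < k" using const_a \<kappa> by (simp add: k_def)
  \<comment> \<open>\<open>C0 + 1\<close> also covers the dyadic level 0, where the scaling factor
    is 1 and the tail condition is silent; \<open>c1\<close> converts weight tails into cost
    tails.\<close>
  define A where "A = (C0 + 1) / c1"
  have A: "0 < A" using const_a const_b by (simp add: A_def)
  \<comment> \<open>\<open>eA\<close> and \<open>eB\<close> are the constants of
    \<open>tree_cost_moments\<close> at \<open>L = c2 * k * H m\<close>, with \<open>H m\<close>
    factored out.\<close>
  define eA where "eA = (1 + 8 * A * b0) * (c2 * k)"
  define eB where "eB = (64 * b0 + 8 * (8 * A) * b0 + 8 * (8 * A) * b0\<^sup>2 + 8 + 8 * (8 * A)) * (c2 * k)\<^sup>2"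
  have eA: "0 < eA" using A k const_i const_b by (simp add: eA_def add_pos_pos)
  have eB: "0 < eB" using A k const_i const_b by (simp add: eB_def add_pos_pos)
  have ln2: "0 < ln (2 :: real)" by simp
  \<comment> \<open>The summands ensure in turn: n \<ge> N0, by n > np \<ge> \<theta> log 2; degrees
    of at least 5 log n across small cuts; np \<ge> 1 + 1/F(\<kappa>), hence H(np) \<ge> \<kappa>;
    the variance and Chebyshev bounds; and a mean of at most half the threshold in the probability
    bound.\<close>
  define \<theta> where "\<theta> = (real N0 + 1) / ln 2 + 5 / a0 + (1 / F \<kappa> + 1) / ln 2 + 4 * eB + 2 * eA"
  have parts: "0 < (real N0 + 1) / ln 2" "0 < 5 / a0" "0 < (1 / F \<kappa> + 1) / ln 2"
    using ln2 const_i \<kappa> by (simp_all add: add_pos_pos)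
  have \<theta>: "0 < \<theta>" "(real N0 + 1) / ln 2 \<le> \<theta>" "5 / a0 \<le> \<theta>" "(1 / F \<kappa> + 1) / ln 2 \<le> \<theta>" "4 * eB \<le> \<theta>" "2 * eA \<le> \<theta>"
    unfolding \<theta>_def using parts eA eB by linarith+
  have "\<P>(\<omega> in M n. chi n \<omega> \<le> \<theta> * real n * H (real n * p n)) \<ge> 1 - inverse \<theta> * p n \<and>
      integrable (M n) (chi n) \<and>
      (\<integral>\<omega>. chi n \<omega> \<partial>M n) \<le> \<theta> * real n * H (real n * p n) \<and>
      integrable (M n) (\<lambda>\<omega>. (chi n \<omega>)\<^sup>2) \<and>
      prob_space.variance (M n) (chi n) \<le> \<theta> * (real n)\<^sup>2 * p n * (H (real n * p n))\<^sup>2"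
    if n: "n \<ge> 2" and pn: "p n \<ge> \<theta> * ln (real n) / real n" for n
  proof -
    interpret weighted_random_graph "M n" n "q n" "Z n" "W n" D mk "X n" "r n"
      by (rule model[OF n])
    define m where "m = real n * p n"
    have n0: "0 < real n" using n by simp
    have lnn: "ln 2 \<le> ln (real n)" using n by simp
    have m_ge: "\<theta> * ln (real n) \<le> m" using pn n0 by (simp add: m_def field_simps)
    moreover have "\<theta> * ln 2 \<le> \<theta> * ln (real n)" using \<theta>(1) lnn by simp
    ultimately have m2: "\<theta> * ln 2 \<le> m" by linarith
    have "1 / F \<kappa> + 1 \<le> \<theta> * ln 2" using \<theta>(4) ln2 by (simp add: pos_divide_le_eq)
    then have mF: "1 / F \<kappa> + 1 \<le> m" using m2 by linarith
    have "0 < 1 / F \<kappa>" using \<kappa> by simp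
    then have m1: "1 \<le> m" using mF by linarith
    have "m < real n" using p[OF n] n0 by (simp add: m_def)
    moreover have "real N0 + 1 \<le> \<theta> * ln 2" using \<theta>(2) ln2 by (simp add: pos_divide_le_eq)
    ultimately have "N0 \<le> n" using m2 by linarith
    note deg = N0[OF this]
    define y where "y = H m"
    have "1 / m \<le> F \<kappa>" using mF \<kappa> m1 by (simp add: field_simps)
    note Hb = inv_ccdf_bounds[of F, OF F_mono F_lim \<kappa>(1) this]
    have y: "\<kappa> \<le> y" and Fy: "\<And>x. y < x \<Longrightarrow> F x < 1 / m"
      unfolding y_def H_def using Hb m1 by auto
    have y0: "0 < y" using y \<kappa> by linarith
    have ky: "x0 < k * y"
    proof -
      have "x0 / \<kappa> * \<kappa> \<le> x0 / \<kappa> * y"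
        by (rule mult_left_mono[OF y]) (use const_a(2) \<kappa>(1) in simp)
      moreover have "x0 / \<kappa> * \<kappa> = x0" using \<kappa>(1) by simp
      moreover have "k * y = y + x0 / \<kappa> * y" unfolding k_def by (simp only: distrib_right mult_1)
      ultimately show ?thesis using y0 by linarith
    qed
    define L where "L = c2 * (k * y)"
    have L: "0 < L" using const_b k y0 by (simp add: L_def)
    have Fky: "F (k * y) \<le> 1 / m" by (rule less_imp_le[OF Fy]) (use k y0 in simp)
    have tail: "prob {\<omega> \<in> space (M n). edge_cost (r n) (X n) (W n) h \<omega> > 2 ^ j * L} \<le> A / m / 8 ^ j"
      if h: "h \<in> K" for h and j :: nat
    proof -
      have pos: "0 < 2 ^ j * (k * y)" using k y0 by simp
      have FF: "F (2 ^ j * (k * y)) \<le> (C0 + 1) / 8 ^ j * (1 / m)"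
      proof (cases "j = 0")
        case True
        have "1 * (1 / m) \<le> (C0 + 1) * (1 / m)" using const_a m1 by (intro mult_right_mono) auto
        then show ?thesis using Fky True by simp
      next
        case False
        have "F (2 ^ j * (k * y)) \<le> C0 / (2 ^ j) powr s * F (k * y)"
          using False ky by (intro cond_a) auto
        also have "\<dots> \<le> (C0 + 1) / 8 ^ j * (1 / m)"
        proof (intro mult_mono frac_le Fky)
          \<comment> \<open>The exponent \<open>s > 3\<close> turns the dyadic scale
            \<open>2 ^ j\<close> into the decay \<open>8 ^ j\<close>.\<close>
          have "(8 :: real) ^ j = (2 ^ 3) ^ j" by simp
          also have "\<dots> = (2 ^ j) ^ 3" by (simp only: power_mult[symmetric] mult.commute)
          also have "\<dots> = (2 ^ j) powr 3" by (rule powr_numeral[symmetric]) simp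
          also have "\<dots> \<le> (2 ^ j) powr s" using const_a by (intro powr_mono) auto
          finally show "(8 :: real) ^ j \<le> (2 ^ j) powr s" .
        qed (use const_a F01 in auto)
        finally show ?thesis .
      qed
      have "c1 * prob {\<omega> \<in> space (M n). c n h \<omega> > c2 * (2 ^ j * (k * y))} \<le> F (2 ^ j * (k * y))"
        using cond_b[OF n h pos] .
      also note FF
      finally have "c1 * prob {\<omega> \<in> space (M n). c n h \<omega> > c2 * (2 ^ j * (k * y))} \<le> (C0 + 1) / 8 ^ j * (1 / m)" .
      then have "prob {\<omega> \<in> space (M n). c n h \<omega> > c2 * (2 ^ j * (k * y))} \<le> (C0 + 1) / 8 ^ j * (1 / m) / c1"
        unfolding pos_le_divide_eq[OF const_b(1)] by (subst mult.commute)
      moreover have "c2 * (2 ^ j * (k * y)) = 2 ^ j * L" by (simp add: L_def)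
      moreover have "(C0 + 1) / 8 ^ j * (1 / m) / c1 = A / m / 8 ^ j" by (simp add: A_def)
      ultimately show ?thesis by (simp add: c_def)
    qed
    have all: "real (card {1..n}) \<ge> \<gamma>0 * real n" using const_i n0 by simp
    have up: "(\<Sum>v\<in>{1..n} - {u}. q n {u, v}) \<le> b0 * m" if "u \<in> {1..n}" for u
      using deg[rule_format, OF that order.refl all] by (simp add: m_def mult.assoc)
    have low: "5 * ln (real n) \<le> (\<Sum>v\<in>{1..n} - S. q n {u, v})"
      if S: "S \<subseteq> {1..n}" "2 * card S \<le> n" "u \<in> S" for S u
    proof -
      have "card ({1..n} - S) = n - card S" using S by (simp add: card_Diff_subset finite_subset)
      \<comment> \<open>The complement of a small side has at least n/2 \<ge> \<gamma>0 n vertices,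
        so the lower bound of condition (i) applies to it.\<close>
      then have "real n / 2 \<le> real (card ({1..n} - S))" using S(2) by (simp add: of_nat_diff)
      moreover have "\<gamma>0 * real n \<le> 1 / 2 * real n" using const_i n0 by (intro mult_right_mono) auto
      ultimately have "\<gamma>0 * real n \<le> real (card ({1..n} - S))" by linarith
      then have "a0 * real n * p n \<le> (\<Sum>v\<in>({1..n} - S) - {u}. q n {u, v})"
        using deg[rule_format, of u "{1..n} - S"] S by auto
      also have "({1..n} - S) - {u} = {1..n} - S" using S by auto
      finally have "a0 * m \<le> (\<Sum>v\<in>{1..n} - S. q n {u, v})" by (simp add: m_def mult.assoc)
      moreover have "5 * ln (real n) \<le> a0 * m"
      proof -
        have "5 \<le> a0 * \<theta>" using \<theta>(3) const_i by (simp add: pos_divide_le_eq mult.commute)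
        then have "5 * ln (real n) \<le> a0 * \<theta> * ln (real n)" using n by (intro mult_right_mono) auto
        also have "\<dots> \<le> a0 * m" using m_ge const_i by (simp add: mult.assoc)
        finally show ?thesis .
      qed
      ultimately show ?thesis by linarith
    qed
    have chi: "chi n = max_tree_cost n (sel n) (Z n) (edge_cost (r n) (X n) (W n))"
      by (simp add: chi_def c_def)
    note mom = tree_cost_moments[OF n m1 less_imp_le[OF const_i(2)] less_imp_le[OF A] L sel[OF n] up low tail,
        folded chi]
    have int: "integrable (M n) (chi n)" and int2: "integrable (M n) (\<lambda>\<omega>. (chi n \<omega>)\<^sup>2)"
      using mom(1,2) by blast+
    have "expectation (chi n) \<le> (1 + 8 * A * b0) * (real n * L)" using mom(3) by blast
    also have "\<dots> = eA * (real n * y)" by (simp add: eA_def L_def)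
    finally have E: "expectation (chi n) \<le> eA * (real n * y)" .
    have "variance (chi n) \<le> (64 * b0 + 8 * (8 * A) * b0 + 8 * (8 * A) * b0\<^sup>2 + 8 + 8 * (8 * A)) * (real n * m * L\<^sup>2)"
      using mom(4) by blast
    also have "\<dots> = eB * ((real n)\<^sup>2 * p n * y\<^sup>2)"
      by (simp add: eB_def L_def m_def power2_eq_square)
    finally have V: "variance (chi n) \<le> eB * ((real n)\<^sup>2 * p n * y\<^sup>2)" .
    have ny: "0 < real n * y" using n0 y0 by simp
    have npy: "0 < (real n)\<^sup>2 * p n * y\<^sup>2" using n0 y0 p[OF n] by simp
    have "eA * (real n * y) \<le> \<theta> * (real n * y)" using \<theta>(6) eA ny by (intro mult_right_mono) auto
    then have E': "expectation (chi n) \<le> \<theta> * real n * y" using E by (simp add: mult.assoc)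
    have "eB * ((real n)\<^sup>2 * p n * y\<^sup>2) \<le> \<theta> * ((real n)\<^sup>2 * p n * y\<^sup>2)"
      using \<theta>(5) eB npy by (intro mult_right_mono) auto
    then have V': "variance (chi n) \<le> \<theta> * (real n)\<^sup>2 * p n * y\<^sup>2" using V by (simp add: mult.assoc)
    \<comment> \<open>Half the threshold: the mean is at most the other half since
      \<open>2 * eA \<le> \<theta>\<close>.\<close>
    define a where "a = \<theta> / 2 * (real n * y)"
    have a: "0 < a" using \<theta>(1) ny by (simp add: a_def)
    have meas [measurable]: "chi n \<in> borel_measurable (M n)" by (rule borel_measurable_integrable[OF int])
    let ?B = "{\<omega> \<in> space (M n). a \<le> \<bar>chi n \<omega> - expectation (chi n)\<bar>}"
    let ?G = "{\<omega> \<in> space (M n). chi n \<omega> \<le> \<theta> * real n * y}"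
    have evB: "?B \<in> events" and evG: "?G \<in> events" by measurable
    have "prob ?B \<le> variance (chi n) / a\<^sup>2" by (rule Chebyshev_inequality[OF meas int2 a])
    also have "\<dots> \<le> eB * ((real n)\<^sup>2 * p n * y\<^sup>2) / a\<^sup>2" using V by (intro divide_right_mono) auto
    \<comment> \<open>The factor n^2 H(np)^2 cancels and leaves a multiple of p;
      \<open>4 * eB \<le> \<theta>\<close> then gives \<open>inverse \<theta>\<close>.\<close>
    also have "\<dots> = 4 * eB / \<theta>\<^sup>2 * p n"
      using n0 y0 \<theta>(1) by (simp add: a_def field_simps power2_eq_square)
    also have "\<dots> \<le> inverse \<theta> * p n"
    proof (intro mult_right_mono)
      have "4 * eB / \<theta>\<^sup>2 \<le> \<theta> / \<theta>\<^sup>2" using \<theta>(5) by (intro divide_right_mono) auto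
      then show "4 * eB / \<theta>\<^sup>2 \<le> inverse \<theta>" using \<theta>(1) by (simp add: power2_eq_square inverse_eq_divide)
    qed (use p[OF n] in simp)
    finally have PB: "prob ?B \<le> inverse \<theta> * p n" .
    have "space (M n) - ?B \<subseteq> ?G"
    proof
      fix \<omega> assume \<omega>: "\<omega> \<in> space (M n) - ?B"
      then have "chi n \<omega> < expectation (chi n) + a" by auto
      also have "\<dots> \<le> eA * (real n * y) + \<theta> / 2 * (real n * y)" using E by (simp add: a_def)
      also have "\<dots> \<le> \<theta> / 2 * (real n * y) + \<theta> / 2 * (real n * y)"
        using \<theta>(6) ny by (intro add_right_mono mult_right_mono) auto
      also have "\<dots> = \<theta> * real n * y" by simp
      finally show "\<omega> \<in> ?G" using \<omega> by simp
    qed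
    then have "prob (space (M n) - ?B) \<le> prob ?G" using evG by (intro finite_measure_mono)
    then have "1 - inverse \<theta> * p n \<le> prob ?G" using PB prob_compl[OF evB] by linarith
    then show ?thesis using int int2 E' V' unfolding y_def m_def by blast
  qed
  then show ?thesis using \<theta>(1) by blast
qed

end
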